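(* Let $n\ge 3$ be an integer and let $D=(\mathcal{W}_0,\ldots,\mathcal{W}_n)\in\mathbb{C}^{n+1}$ be any vector with $D\ne 0$, with associated linear form $P_D(\mathcal{Z}_0,\ldots,\mathcal{Z}_n)=\mathcal{W}_0\mathcal{Z}_0+\cdots+\mathcal{W}_n\mathcal{Z}_n$. Then there is an explicitly computable constant $G(n,D)$, which depends solely on $n$ and $D$, such that for any integer $N\ge 1$ we have the bounds $$\bigl|m(P_D)-E_1(N;n,D)\bigr|\le\frac{\Gamma(3/4)}{3}\,\frac{G(n,D)}{N^{3/4}}\qquad\text{and}\qquad\bigl|m(P_D)-E_2(N;n,D)\bigr|\le 2\sqrt[4]{2}\,\frac{G(n,D)}{\sqrt N},$$ where $$E_1(N;n,D)=\log c(D)-\frac12\sum_{j=1}^{N}\frac1j\sum_{k=0}^{j}\binom{j}{k}\frac{(-1)^ka(n,k,D)}{c(D)^{2k}}$$ and $$E_2(N;n,D)=\log c(D)-\frac12-\frac12\sum_{j=1}^{N}\frac{2j+1}{j(j+1)}\sum_{k=0}^{j}\binom{j+k}{k}\binom{j}{k}\frac{(-1)^ka(n,k,D)}{c(D)^{2k}}.$$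
   Context: $c(D)>0$ is defined by $c(D)^2=(n+1)\|D\|^2$, where $\|D\|^2=|\mathcal{W}_0|^2+\cdots+|\mathcal{W}_n|^2$. For integers $k\ge 0$, $$a(n,k,D)=\sum_{\substack{\ell_0+\cdots+\ell_n=k\\ \ell_m\ge 0}}\binom{k}{\ell_0,\ldots,\ell_n}^2|\mathcal{W}_0|^{2\ell_0}\cdots|\mathcal{W}_n|^{2\ell_n},\qquad \binom{k}{\ell_0,\ldots,\ell_n}=\frac{k!}{\ell_0!\cdots\ell_n!}.$$ The logarithmic Mahler measure of a non-zero polynomial $P\in\mathbb{C}[x_1,\ldots,x_q]$ is $$m(P)=\frac{1}{(2\pi)^q}\int_0^{2\pi}\cdots\int_0^{2\pi}\log|P(e^{i\theta_1},\ldots,e^{i\theta_q})|\,d\theta_1\cdots d\theta_q.$$ For the homogeneous linear form $P_D$ this equals $\frac{1}{(2\pi)^n}\int_0^{2\pi}\cdots\int_0^{2\pi}\log|P_D(1,e^{i\theta_1},\ldots,e^{i\theta_n})|\,d\theta_1\cdots d\theta_n$. The constant for which the bounds are derived is $$G(n,D)=c(D)^2\int_0^\infty t\left(\max\left\{1,\tfrac{\pi}{2}c(D)t\right\}\right)^{-1/2}\prod_{m=0}^{n}\bigl|J_0(r_mt)\bigr|\,dt,\qquad r_m=|\mathcal{W}_m|,$$ where $J_0$ is the Bessel function of the first kind of order $0$.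
   Formalization: The integral G(n,D) diverges if fewer than four W_m are non-zero, and for n=3, D=(1,1,0,0) no finite constant works in the E_1 bound; so G(n,D) is taken in [0,∞], the bounds being void when it is infinite, and it is shown finite when at least four W_m are non-zero. *)

theory Defs
  imports "HOL-Analysis.Analysis"
begin

(* A vector D = (W_0, ..., W_n) is a function W :: nat => complex of which only
   the values at 0, ..., n are used. A polynomial in q variables is given by its
   polynomial function, whose argument lists the variables at indices 0, ..., q - 1. *)

definition linear_form :: "nat \<Rightarrow> (nat \<Rightarrow> complex) \<Rightarrow> (nat \<Rightarrow> complex) \<Rightarrow> complex" where
  "linear_form n W Z = (\<Sum>m\<le>n. W m * Z m)"

(* Zeros of P, where ln 0 = 0 in HOL, form a null set of the torus when P is a
   non-zero polynomial, and ln |P| is then integrable, so that the integral over the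
   product measure is the iterated integral. *)
definition log_mahler_measure :: "nat \<Rightarrow> ((nat \<Rightarrow> complex) \<Rightarrow> complex) \<Rightarrow> real" where
  "log_mahler_measure q P =
     1 / (2 * pi) ^ q *
     (LINT \<theta> : ({..<q} \<rightarrow>\<^sub>E {0..2 * pi}) | (\<Pi>\<^sub>M m\<in>{..<q}. lborel).
        ln (cmod (P (\<lambda>m. cis (\<theta> m)))))"

definition c_const :: "nat \<Rightarrow> (nat \<Rightarrow> complex) \<Rightarrow> real" where
  "c_const n W = sqrt (real (n + 1) * (\<Sum>m\<le>n. (cmod (W m))\<^sup>2))"

(* The bound l m <= k is implied by the sum condition; it makes the index set
   visibly finite. *)
definition a_coeff :: "nat \<Rightarrow> nat \<Rightarrow> (nat \<Rightarrow> complex) \<Rightarrow> real" where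
  "a_coeff n k W =
     (\<Sum>l | l \<in> {..n} \<rightarrow>\<^sub>E {..k} \<and> (\<Sum>m\<le>n. l m) = k.
        (fact k / (\<Prod>m\<le>n. fact (l m)))\<^sup>2 * (\<Prod>m\<le>n. cmod (W m) ^ (2 * l m)))"

definition bessel_J0 :: "real \<Rightarrow> real" where
  "bessel_J0 x = (\<Sum>k. (- 1) ^ k / (fact k)\<^sup>2 * (x / 2) ^ (2 * k))"

(* The integral converges iff at least four of W_0, ..., W_n are non-zero. It is
   taken in [0, \<infinity>], so that a divergent integral has the value \<infinity> and not the
   value 0 that HOL gives to a non-integrable function. *)
definition G_const :: "nat \<Rightarrow> (nat \<Rightarrow> complex) \<Rightarrow> ennreal" where
  "G_const n W =
     ennreal ((c_const n W)\<^sup>2) *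
     (\<integral>\<^sup>+ t \<in> {0..}.
        ennreal (t * max 1 (pi / 2 * c_const n W * t) powr (- 1 / 2) *
                 (\<Prod>m\<le>n. \<bar>bessel_J0 (cmod (W m) * t)\<bar>)) \<partial>lborel)"

definition E1 :: "nat \<Rightarrow> nat \<Rightarrow> (nat \<Rightarrow> complex) \<Rightarrow> real" where
  "E1 N n W =
     ln (c_const n W) -
     1 / 2 * (\<Sum>j = 1..N. 1 / real j *
       (\<Sum>k = 0..j. real (j choose k) *
          ((- 1) ^ k * a_coeff n k W / c_const n W ^ (2 * k))))"

definition E2 :: "nat \<Rightarrow> nat \<Rightarrow> (nat \<Rightarrow> complex) \<Rightarrow> real" where
  "E2 N n W =
     ln (c_const n W) - 1 / 2 -
     1 / 2 * (\<Sum>j = 1..N. real (2 * j + 1) / real (j * (j + 1)) *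
       (\<Sum>k = 0..j. real ((j + k) choose k) * real (j choose k) *
          ((- 1) ^ k * a_coeff n k W / c_const n W ^ (2 * k))))"

end

theory Submission
  imports Defs "HOL-Probability.Probability" "HOL-Complex_Analysis.Complex_Analysis"
begin

text \<open>Let \<open>Z\<close> be the value of the linear form at independent uniform phases, \<open>c\<close> the constant
  \<^const>\<open>c_const\<close> and \<open>U = (cmod Z / c)\<^sup>2\<close>, which lies in \<open>{0..1}\<close>. The Mahler measure is the
  expectation of \<open>ln c + ln U / 2\<close>, the moments of \<open>U\<close> are the normalised \<^const>\<open>a_coeff\<close>, and
  \<^const>\<open>E1\<close> and \<^const>\<open>E2\<close> arise by truncating the expansions of \<open>ln U\<close> in powers of
  \<open>1 - U\<close> and in the polynomials \<open>P\<^sub>j (1 - 2 U)\<close>.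

  The addition theorem of \<open>J\<^sub>0\<close> makes the expectation of a Gaussian of \<open>Z - z\<close> a Hankel integral
  against the product of the \<open>J\<^sub>0 (r\<^sub>m t)\<close>. Letting the Gaussian concentrate and using
  \<open>\<bar>J\<^sub>0 x\<bar> \<le> sqrt (2 / (pi x))\<close>, the law of \<open>U\<close> has a density of at most
  \<open>G / 2 * u powr (-1/4)\<close>. It remains to integrate the tails of the two expansions against this
  weight: the power series gives Beta integrals, and the tail of the Legendre expansion has
  \<open>L\<^sup>2\<close> norm exactly \<open>1 / (N + 1)\<close>, by a telescoping sum.\<close>

section \<open>Shifted Legendre polynomials\<close>

text \<open>The obstacle is the point u = 0: \<open>ln\<close> is unbounded there, so the law of U
  must be shown not to concentrate near 0. Formally, Hankel inversion gives the density of Z as 1/(2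
  pi) times the integral of t J0(t|z|) times the product of the J0(r_m t), but the integrals behind
  this formula cannot be exchanged as they stand. Only an upper bound is wanted. The Gaussian
  therefore stays while Fubini is applied, where it makes everything absolutely convergent, and
  afterwards it is removed by exp(-t^2) <= 1; Fatou's lemma is enough for the limit. The shape of G
  comes from separating the variables in |J0(r t)| <= max(1, sqrt(c/r)) * max(1, pi c t/2)^(-1/2).
  The factor in t goes under the integral sign of G; the factor in r becomes u^(-1/4) at r = c sqrt
  u. This weight is still square integrable on {0..1}, so an L2 estimate of the Legendre tail
  controls the error. If G is infinite, both bounds are trivial. Otherwise the argument runs with
  the real number g for which G = c^2 g.\<close>

text \<open>\<open>legendre j u\<close> is the Legendre polynomial \<open>P\<^sub>j (1 - 2 u)\<close>.\<close>
definition legendre_coeff :: "nat \<Rightarrow> nat \<Rightarrow> real" where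
  "legendre_coeff j k = (-1) ^ k * real ((j + k) choose k) * real (j choose k)"

definition legendre :: "nat \<Rightarrow> real \<Rightarrow> real" where
  "legendre j u = (\<Sum>k\<le>j. legendre_coeff j k * u ^ k)"

lemma legendre_0 [simp]: "legendre 0 u = 1"
  by (simp add: legendre_def legendre_coeff_def)

lemma legendre_coeff_eq_0: "j < k \<Longrightarrow> legendre_coeff j k = 0"
  by (simp add: legendre_coeff_def)

text \<open>This is the hypergeometric term ratio in \<open>j\<close>, cleared of its denominator so
  that it also covers \<open>k = Suc j\<close>, where the left factor is 0, and larger
  \<open>k\<close>, where both coefficients vanish. All recurrences below come from it.\<close>

lemma legendre_coeff_Suc:
  "legendre_coeff (Suc j) k * (real j + 1 - real k) = legendre_coeff j k * (real j + 1 + real k)"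
proof (cases "k \<le> j")
  case True
  have 1: "real (Suc j choose k) * (real j + 1 - real k) = (real j + 1) * real (j choose k)"
  proof -
    have "real (Suc j choose k) * real (Suc j - k) = real (Suc j) * real (j choose k)"
      using True by (simp only: flip: of_nat_mult) (metis binomial_absorb_comp diff_Suc_1 mult.commute)
    then show ?thesis using True by (simp add: of_nat_diff algebra_simps)
  qed
  have 2: "real ((Suc j + k) choose k) * (real j + 1) = (real j + 1 + real k) * real ((j + k) choose k)"
  proof -
    have "(Suc j + k - k) * (Suc j + k choose k) = (Suc j + k) * ((Suc j + k - 1) choose k)"
      by (rule binomial_absorb_comp)
    then have "real (Suc j) * real ((Suc j + k) choose k) = real (Suc j + k) * real ((j + k) choose k)"
      by (simp only: flip: of_nat_mult) simp
    then show ?thesis by (simp add: algebra_simps)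
  qed
  have "legendre_coeff (Suc j) k * (real j + 1 - real k) * (real j + 1) =
      (-1) ^ k * (real ((Suc j + k) choose k) * (real j + 1)) * (real (Suc j choose k) * (real j + 1 - real k))"
    unfolding legendre_coeff_def by simp
  also have "\<dots> = legendre_coeff j k * (real j + 1 + real k) * (real j + 1)"
    unfolding 1 2 by (simp add: legendre_coeff_def)
  finally show ?thesis by simp
next
  case False
  then show ?thesis
    by (cases "k = Suc j") (simp_all add: legendre_coeff_eq_0)
qed

text \<open>Upper negation turns (-1)^k binom(j+k, k) into binom(-j-1, k); the sum is then a
  Vandermonde convolution with value binom(-1, j).\<close>

lemma legendre_at_1: "legendre j 1 = (-1) ^ j"
proof -
  have eq: "legendre_coeff j k = ((- real j - 1) gchoose k) * (real j gchoose (j - k))" if "k \<le> j" for k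
  proof -
    have "((- real j - 1) gchoose k) = (-1) ^ k * ((real (j + k)) gchoose k)"
    proof -
      have "- real j - 1 = - (real j + 1)" by simp
      then show ?thesis
        using gbinomial_minus[of "real j + 1" k] by (simp only:) (simp add: algebra_simps)
    qed
    then show ?thesis
      using that binomial_symmetric[of k j] by (simp add: legendre_coeff_def binomial_gbinomial)
  qed
  have "legendre j 1 = (\<Sum>k = 0..j. ((- real j - 1) gchoose k) * (real j gchoose (j - k)))"
    unfolding legendre_def by (intro sum.cong) (auto simp: eq)
  also have "\<dots> = ((- real j - 1) + real j) gchoose j"
    by (rule gbinomial_Vandermonde)
  also have "\<dots> = (-1) ^ j"
    proof -
    have "(real j gchoose j) = 1"
      using binomial_gbinomial[of j j, where ?'a = real] by simp
    then show ?thesis using gbinomial_minus[of "1::real" j] by simp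
  qed
  finally show ?thesis .
qed

text \<open>The Mellin transform of \<^const>\<open>legendre\<close>: the value at \<open>x\<close> is
  \<open>\<integral>\<^sub>0\<^sup>1 u powr (x - 1) * legendre j u du\<close>.\<close>
definition legendre_mellin :: "nat \<Rightarrow> real \<Rightarrow> real" where
  "legendre_mellin j x = (\<Sum>k\<le>j. legendre_coeff j k / (x + real k))"

text \<open>Split x + j + 1 as (x + k) + (j + 1 - k). The first part cancels the denominators and
  leaves the endpoint value \<open>legendre (Suc j) 1\<close>; the second is rewritten by
  \<open>legendre_coeff_Suc\<close>. Since the endpoint value changes sign with \<open>j\<close>, it
  combines termwise to (j+1+k)/(x+k) - 1 = (j+1-x)/(x+k).\<close>

lemma legendre_mellin_Suc:
  assumes "x > 0"
  shows "(x + real j + 1) * legendre_mellin (Suc j) x = (real j + 1 - x) * legendre_mellin j x"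
proof -
  have nz: "x + real k \<noteq> 0" for k using assms by linarith
  have "(x + real j + 1) * legendre_mellin (Suc j) x =
      (\<Sum>k\<le>Suc j. legendre_coeff (Suc j) k + legendre_coeff (Suc j) k * (real j + 1 - real k) / (x + real k))"
    unfolding legendre_mellin_def sum_distrib_left
    by (intro sum.cong refl) (use nz in \<open>simp add: field_simps\<close>)
  also have "\<dots> = legendre (Suc j) 1 + (\<Sum>k\<le>Suc j. legendre_coeff j k * (real j + 1 + real k) / (x + real k))"
    unfolding legendre_coeff_Suc by (simp add: sum.distrib legendre_def)
  also have "\<dots> = - legendre j 1 + (\<Sum>k\<le>j. legendre_coeff j k * (real j + 1 + real k) / (x + real k))"
    by (simp add: legendre_at_1 legendre_coeff_eq_0)
  also have "\<dots> = (\<Sum>k\<le>j. (real j + 1 - x) * (legendre_coeff j k / (x + real k)))"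
    unfolding legendre_def sum_negf [symmetric] sum.distrib [symmetric]
    by (intro sum.cong refl) (use nz in \<open>simp add: field_simps\<close>)
  also have "\<dots> = (real j + 1 - x) * legendre_mellin j x"
    by (simp add: legendre_mellin_def sum_distrib_left)
  finally show ?thesis .
qed

text \<open>The factor j + 1 - x of the recurrence creates a zero at x = j + 1, and the recurrence
  preserves it for all larger \<open>j\<close>. In terms of integrals this is the orthogonality of
  \<open>legendre j\<close> to all lower powers of u.\<close>

lemma legendre_mellin_eq_0:
  assumes "1 \<le> m" "m \<le> j"
  shows "legendre_mellin j (real m) = 0"
  using assms(2)
proof (induction j rule: dec_induct)
  case base
  obtain i where m: "m = Suc i" using assms(1) by (cases m) auto
  have "(real m + real i + 1) * legendre_mellin m (real m) = 0"
    using legendre_mellin_Suc[of "real m" i] assms by (simp add: m)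
  then show ?case by (simp add: add_nonneg_eq_0_iff)
next
  case (step i)
  have "(real m + real i + 1) * legendre_mellin (Suc i) (real m) = 0"
    using legendre_mellin_Suc[of "real m" i] assms step by simp
  then show ?case by (simp add: add_nonneg_eq_0_iff)
qed

lemma legendre_mellin_prod:
  assumes "x > 0"
  shows "legendre_mellin j x = (\<Prod>i<j. real i + 1 - x) / (\<Prod>i\<le>j. x + real i)"
proof (induction j)
  case 0
  then show ?case by (simp add: legendre_mellin_def legendre_coeff_def)
next
  case (Suc j)
  have "(x + real j + 1) * legendre_mellin (Suc j) x = (real j + 1 - x) * legendre_mellin j x"
    using legendre_mellin_Suc[OF assms] .
  moreover have "x + real j + 1 > 0" using assms by linarith
  ultimately have "legendre_mellin (Suc j) x = (real j + 1 - x) / (x + real j + 1) * legendre_mellin j x"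
    by (simp add: field_simps)
  then show ?case
    using Suc by (simp add: field_simps)
qed

text \<open>This is the squared L2 norm of \<open>legendre j\<close>: by orthogonality only the
  leading term of one factor contributes to the integral of the square.\<close>

lemma legendre_mellin_norm: "legendre_coeff j j * legendre_mellin j (real j + 1) = 1 / (2 * real j + 1)"
proof -
  have 1: "(\<Prod>i<j. real i + 1 - (real j + 1)) = (-1) ^ j * fact j"
  proof -
    have "(\<Prod>i<j. real i + 1 - (real j + 1)) = (\<Prod>i<j. - (real (j - i)))"
      by (intro prod.cong) (auto simp: of_nat_diff)
    also have "\<dots> = (-1) ^ j * (\<Prod>i<j. real (j - i))"
      using prod_uminus[of "\<lambda>i. real (j - i)" "{..<j}"] by simp
    also have "(\<Prod>i<j. real (j - i)) = fact j"
      by (simp add: fact_prod_rev lessThan_atLeast0)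
    finally show ?thesis .
  qed
  have 2: "(\<Prod>i\<le>j. real j + 1 + real i) * fact j = fact (2 * j + 1)"
  proof -
    have "(\<Prod>i\<le>m. real j + 1 + real i) * fact j = fact (j + m + 1)" for m
    proof (induction m)
      case (Suc m)
      have "(\<Prod>i\<le>Suc m. real j + 1 + real i) * fact j =
          (real j + 1 + real (Suc m)) * ((\<Prod>i\<le>m. real j + 1 + real i) * fact j)"
        by simp
      then show ?case by (simp only: Suc) (simp add: algebra_simps)
    qed (simp only: atMost_0 prod.insert, simp)
    from this[of j] show ?thesis by (simp only: mult_2)
  qed
  have 3: "real ((j + j) choose j) = fact (2 * j) / (fact j * fact j)"
    using binomial_fact[of j "j + j", where ?'a = real] by (simp flip: mult_2)
  have 4: "(\<Prod>i\<le>j. real j + 1 + real i) = fact (2 * j + 1) / fact j"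
    by (rule eq_divide_imp[OF _ 2]) simp
  have 5: "legendre_mellin j (real j + 1) = ((-1) ^ j * fact j) / (fact (2 * j + 1) / fact j)"
  proof -
    have "real j + 1 > 0" by linarith
    show ?thesis unfolding legendre_mellin_prod[OF \<open>real j + 1 > 0\<close>] 1 4 ..
  qed
  have sq: "(-1 :: real) ^ j * (-1) ^ j = 1"
    by (simp flip: power_mult_distrib)
  have canc: "s * (F / (f * f)) * 1 * ((s * f) / (F' / f)) = F / F'"
    if "s * s = 1" "f \<noteq> 0" for s F f F' :: real
  proof -
    have "s * (F / (f * f)) * 1 * ((s * f) / (F' / f)) = (s * s) * (F / F')"
      using that(2) by simp
    then show ?thesis using that(1) by simp
  qed
  have "legendre_coeff j j * legendre_mellin j (real j + 1) = fact (2 * j) / fact (2 * j + 1)"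
    unfolding 5 legendre_coeff_def 3 binomial_n_n of_nat_1 by (rule canc[OF sq]) simp
  also have "\<dots> = 1 / (2 * real j + 1)" by simp
  finally show ?thesis .
qed

text \<open>The sum is minus the derivative of \<open>legendre_mellin j\<close> at x = 1, that is,
  minus the integral of \<open>ln u * legendre j u\<close>. The proof is the recurrence
  differentiated at x = 1, carried out on the coefficients; the undifferentiated terms are the
  values at 1, which vanish only from j = 1 on.\<close>

lemma legendre_mellin_deriv_1:
  assumes "j \<ge> 1"
  shows "(\<Sum>k\<le>j. legendre_coeff j k / (real k + 1)\<^sup>2) = 1 / (real j * (real j + 1))"
  using assms
proof (induction j rule: dec_induct)
  case base
  then show ?case by (simp add: legendre_coeff_def)
next
  case (step j)
  let ?S = "\<lambda>j. \<Sum>k\<le>j. legendre_coeff j k / (real k + 1)\<^sup>2"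
  have nz: "real k + 1 \<noteq> 0" for k by linarith
  have nz2: "real j + 2 \<noteq> 0" by linarith
  have split: "a * (y + b) / y\<^sup>2 = a / y + a * b / y\<^sup>2" if "y \<noteq> 0" for a b y :: real
    using that by (simp add: field_simps power2_eq_square)
  have "(real j + 2) * ?S (Suc j) =
      (\<Sum>k\<le>Suc j. legendre_coeff (Suc j) k / (1 + real k) +
          legendre_coeff (Suc j) k * (real j + 1 - real k) / (real k + 1)\<^sup>2)"
    unfolding sum_distrib_left
  proof (intro sum.cong refl)
    fix k
    show "(real j + 2) * (legendre_coeff (Suc j) k / (real k + 1)\<^sup>2) =
        legendre_coeff (Suc j) k / (1 + real k) + legendre_coeff (Suc j) k * (real j + 1 - real k) / (real k + 1)\<^sup>2"
      using split[of "real k + 1" "legendre_coeff (Suc j) k" "real j + 1 - real k"] nz[of k]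
      by (simp add: add.commute mult.commute)
  qed
  also have "\<dots> = legendre_mellin (Suc j) (real 1) + (\<Sum>k\<le>Suc j. legendre_coeff j k * (real j + 1 + real k) / (real k + 1)\<^sup>2)"
    unfolding legendre_coeff_Suc by (simp add: sum.distrib legendre_mellin_def)
  also have "\<dots> = (\<Sum>k\<le>j. legendre_coeff j k * (real j + 1 + real k) / (real k + 1)\<^sup>2)"
    using legendre_mellin_eq_0[of 1 "Suc j"] by (simp add: legendre_coeff_eq_0)
  also have "\<dots> = (\<Sum>k\<le>j. legendre_coeff j k / (1 + real k) + real j * (legendre_coeff j k / (real k + 1)\<^sup>2))"
  proof (intro sum.cong refl)
    fix k
    show "legendre_coeff j k * (real j + 1 + real k) / (real k + 1)\<^sup>2 =
        legendre_coeff j k / (1 + real k) + real j * (legendre_coeff j k / (real k + 1)\<^sup>2)"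
      using split[of "real k + 1" "legendre_coeff j k" "real j"] nz[of k]
      by (simp add: algebra_simps)
  qed
  also have "\<dots> = legendre_mellin j (real 1) + real j * ?S j"
    by (simp add: sum.distrib legendre_mellin_def sum_distrib_left)
  also have "\<dots> = real j * (1 / (real j * (real j + 1)))"
    using legendre_mellin_eq_0[of 1 j] step by simp
  finally have "(real j + 2) * ?S (Suc j) = 1 / (real j + 1)"
    using step.hyps by simp
  then have "?S (Suc j) = (1 / (real j + 1)) / (real j + 2)"
    by (metis nonzero_mult_div_cancel_left nz2)
  then show ?case
    by (simp add: mult.commute add.commute)
qed

section \<open>Integrals of powers, logarithms and Legendre polynomials over {0..1}\<close>

lemma has_integral_power_unit: "((\<lambda>u::real. u ^ k) has_integral 1 / (real k + 1)) {0..1}"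
proof -
  have "((\<lambda>u::real. u ^ k) has_integral (1 ^ (k + 1) / (real k + 1) - 0 ^ (k + 1) / (real k + 1))) {0..1}"
    by (intro fundamental_theorem_of_calculus_interior)
       (auto intro!: continuous_intros derivative_eq_intros
             simp flip: has_real_derivative_iff_has_vector_derivative simp: add_nonneg_eq_0_iff field_simps
             simp del: power_Suc)
  then show ?thesis by simp
qed

text \<open>The antiderivatives below are differentiable only in the open interval; this supplies
  their continuity at the endpoint 0.\<close>

lemma continuous_on_mult_ln: "continuous_on {0..} (\<lambda>u::real. u * ln u)"
  unfolding continuous_on_def
proof
  fix x :: real assume x: "x \<in> {0..}"
  show "((\<lambda>u. u * ln u) \<longlongrightarrow> x * ln x) (at x within {0..})"
  proof (cases "x = 0")
    case True
    have "((\<lambda>u::real. u * ln u) \<longlongrightarrow> 0) (at_right 0)" by real_asymp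
    moreover have "at (0::real) within {0..} = at_right 0"
      by (metis at_within_Ici_at_right)
    ultimately show ?thesis using True by simp
  next
    case False
    with x show ?thesis by (auto intro!: tendsto_intros)
  qed
qed

lemma has_integral_power_ln: "((\<lambda>u::real. u ^ k * ln u) has_integral - 1 / (real k + 1)\<^sup>2) {0..1}"
proof -
  \<comment> \<open>The factor \<open>u * ln u\<close> is kept together so that
    \<open>continuous_on_mult_ln\<close> applies; for the differentiation it is merged into
    \<open>u ^ (k + 1) * ln u\<close>.\<close>
  define F where "F u = u ^ k * (u * ln u) / (real k + 1) - u ^ (k + 1) / (real k + 1)\<^sup>2" for u :: real
  have "((\<lambda>u::real. u ^ k * ln u) has_integral (F 1 - F 0)) {0..1}"
  proof (intro fundamental_theorem_of_calculus_interior)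
    show "continuous_on {0..1} F" unfolding F_def
      by (intro continuous_intros continuous_on_subset[OF continuous_on_mult_ln]) auto
    fix u :: real assume u: "u \<in> {0<..<1}"
    have nz: "real k + 1 \<noteq> 0" by linarith
    have F: "F u = u ^ (k + 1) * ln u / (real k + 1) - u ^ (k + 1) / (real k + 1)\<^sup>2" for u
      by (simp add: F_def)
    have "(F has_real_derivative
       ((real k + 1) * u ^ k * ln u + u ^ (k + 1) * (1 / u)) / (real k + 1) - (real k + 1) * u ^ k / (real k + 1)\<^sup>2) (at u)"
      unfolding F using u nz
      by (intro DERIV_diff DERIV_cdivide) (auto intro!: derivative_eq_intros simp del: power_Suc simp: add.commute)
    moreover have "((real k + 1) * u ^ k * ln u + u ^ (k + 1) * (1 / u)) / (real k + 1) - (real k + 1) * u ^ k / (real k + 1)\<^sup>2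
       = u ^ k * ln u"
      using u nz by (simp add: add_divide_distrib power2_eq_square)
    ultimately show "(F has_vector_derivative u ^ k * ln u) (at u)"
      by (simp flip: has_real_derivative_iff_has_vector_derivative)
  qed simp
  then show ?thesis by (simp add: F_def)
qed

lemma has_integral_ln_square: "((\<lambda>u::real. (ln u)\<^sup>2) has_integral 2) {0..1}"
proof -
  define F where "F u = u * (ln u)\<^sup>2 - 2 * (u * ln u) + 2 * u" for u :: real
  have "((\<lambda>u::real. (ln u)\<^sup>2) has_integral (F 1 - F 0)) {0..1}"
  proof (intro fundamental_theorem_of_calculus_interior)
    have "continuous_on {0..1} (\<lambda>u::real. u * (ln u)\<^sup>2)"
      unfolding continuous_on_def
    proof
      fix x :: real assume x: "x \<in> {0..1}"
      show "((\<lambda>u. u * (ln u)\<^sup>2) \<longlongrightarrow> x * (ln x)\<^sup>2) (at x within {0..1})"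
      proof (cases "x = 0")
        case True
        have "((\<lambda>u::real. u * (ln u)\<^sup>2) \<longlongrightarrow> 0) (at_right 0)" by real_asymp
        moreover have "at (0::real) within {0..1} = at_right 0"
          by (simp add: at_within_Icc_at_right)
        ultimately show ?thesis using True by simp
      next
        case False
        with x show ?thesis by (auto intro!: tendsto_intros)
      qed
    qed
    then show "continuous_on {0..1} F" unfolding F_def
      by (intro continuous_on_add continuous_on_diff continuous_on_mult_left continuous_on_id
            continuous_on_subset[OF continuous_on_mult_ln]) auto
    fix u :: real assume u: "u \<in> {0<..<1}"
    have "(F has_real_derivative (ln u)\<^sup>2) (at u)"
      unfolding F_def using u
      by (auto intro!: derivative_eq_intros simp: power2_eq_square field_simps)
    then show "(F has_vector_derivative (ln u)\<^sup>2) (at u)"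
      by (simp flip: has_real_derivative_iff_has_vector_derivative)
  qed simp
  then show ?thesis by (simp add: F_def)
qed

lemma has_integral_power_legendre:
  "((\<lambda>u. u ^ m * legendre j u) has_integral legendre_mellin j (real m + 1)) {0..1}"
proof -
  have "((\<lambda>u. \<Sum>k\<le>j. legendre_coeff j k * u ^ (m + k)) has_integral
      (\<Sum>k\<le>j. legendre_coeff j k * (1 / (real (m + k) + 1)))) {0..1}"
    by (intro has_integral_sum has_integral_mult_right has_integral_power_unit) auto
  then show ?thesis
    by (simp add: legendre_def legendre_mellin_def sum_distrib_left power_add algebra_simps)
qed

text \<open>The polynomial of smaller degree is expanded into powers, so every term is a value of
  \<open>legendre_mellin j\<close> at an integer, and these vanish up to \<open>j\<close>.\<close>

lemma has_integral_legendre_legendre: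
  assumes "i \<le> j"
  shows "((\<lambda>u. legendre i u * legendre j u) has_integral (if i = j then 1 / (2 * real j + 1) else 0)) {0..1}"
proof -
  have "((\<lambda>u. \<Sum>k\<le>i. legendre_coeff i k * (u ^ k * legendre j u)) has_integral
      (\<Sum>k\<le>i. legendre_coeff i k * legendre_mellin j (real k + 1))) {0..1}"
    by (intro has_integral_sum has_integral_mult_right has_integral_power_legendre) auto
  moreover have "(\<Sum>k\<le>i. legendre_coeff i k * legendre_mellin j (real k + 1)) =
      (\<Sum>k\<le>i. if k = j then legendre_coeff i j * legendre_mellin j (real j + 1) else 0)"
    using assms legendre_mellin_eq_0[of "Suc _" j]
    by (intro sum.cong refl) (auto simp: add.commute)
  moreover have "\<dots> = (if i = j then 1 / (2 * real j + 1) else 0)"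
    using assms legendre_mellin_norm[of j] by (auto simp: sum.delta)
  ultimately show ?thesis
    unfolding legendre_def[of i] sum_distrib_right mult.assoc by simp
qed

text \<open>Divided by the squared norm 1/(2j+1), these integrals are the expansion coefficients of
  \<open>ln\<close>; with opposite sign they are the weights (2j+1)/(j(j+1)) in
  \<open>E2\<close>.\<close>

lemma has_integral_ln_legendre:
  assumes "j \<ge> 1"
  shows "((\<lambda>u. ln u * legendre j u) has_integral - 1 / (real j * (real j + 1))) {0..1}"
proof -
  have "((\<lambda>u. \<Sum>k\<le>j. legendre_coeff j k * (u ^ k * ln u)) has_integral
      (\<Sum>k\<le>j. legendre_coeff j k * (- 1 / (real k + 1)\<^sup>2))) {0..1}"
    by (intro has_integral_sum has_integral_mult_right has_integral_power_ln) auto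
  moreover have "(\<Sum>k\<le>j. legendre_coeff j k * (- 1 / (real k + 1)\<^sup>2)) = - 1 / (real j * (real j + 1))"
    using legendre_mellin_deriv_1[OF assms] by (simp add: sum_negf)
  ultimately show ?thesis
    unfolding legendre_def sum_distrib_left by (simp add: mult_ac)
qed

text \<open>This is the remainder of ln u = -1 - sum (2j+1)/(j(j+1)) P_j(1-2u) after the term of
  index \<open>N\<close>; the constant -1 is the mean of \<open>ln\<close> and produces the -1/2 in
  \<open>E2\<close>.\<close>

definition ln_legendre_tail :: "nat \<Rightarrow> real \<Rightarrow> real" where
  "ln_legendre_tail N u =
     ln u + 1 + (\<Sum>j=1..N. real (2 * j + 1) / real (j * (j + 1)) * legendre j u)"

lemma has_integral_ln_legendre_tail_legendre:
  assumes "N < j"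
  shows "((\<lambda>u. ln_legendre_tail N u * legendre j u) has_integral - 1 / (real j * (real j + 1))) {0..1}"
proof -
  have "((\<lambda>u. ln u * legendre j u + legendre 0 u * legendre j u +
        (\<Sum>i=1..N. real (2 * i + 1) / real (i * (i + 1)) * (legendre i u * legendre j u)))
      has_integral - 1 / (real j * (real j + 1)) + (if 0 = j then 1 / (2 * real j + 1) else 0) +
        (\<Sum>i=1..N. real (2 * i + 1) / real (i * (i + 1)) * (if i = j then 1 / (2 * real j + 1) else 0))) {0..1}"
    using assms
    by (intro has_integral_add has_integral_sum has_integral_mult_right has_integral_legendre_legendre
          has_integral_ln_legendre) auto
  moreover have "(\<Sum>i=1..N. real (2 * i + 1) / real (i * (i + 1)) * (if i = j then 1 / (2 * real j + 1) else 0)) = 0"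
    using assms by (intro sum.neutral) auto
  ultimately show ?thesis
    using assms by (simp add: ln_legendre_tail_def distrib_right sum_distrib_right mult.assoc)
qed

text \<open>Induction on \<open>N\<close>: the initial value is 2 - 2 + 1 = 1, and adding the term
  of index j = N + 1 removes its projection, of squared norm (2j+1)/(j(j+1))^2 = 1/j^2 -
  1/(j+1)^2.\<close>

lemma has_integral_ln_legendre_tail_square:
  "((\<lambda>u. (ln_legendre_tail N u)\<^sup>2) has_integral 1 / (real N + 1)\<^sup>2) {0..1}"
proof (induction N)
  case 0
  have "((\<lambda>u::real. (ln u)\<^sup>2 + 2 * (u ^ 0 * ln u) + u ^ 0) has_integral 2 + 2 * (- 1 / (real 0 + 1)\<^sup>2) + 1 / (real 0 + 1)) {0..1}"
    by (intro has_integral_add has_integral_mult_right has_integral_power_ln has_integral_power_unit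
          has_integral_ln_square)
  then show ?case
    by (simp add: ln_legendre_tail_def power2_eq_square algebra_simps)
next
  case (Suc N)
  define j where "j = Suc N"
  define c where "c = real (2 * j + 1) / real (j * (j + 1))"
  have T: "ln_legendre_tail j u = ln_legendre_tail N u + c * legendre j u" for u
    by (simp add: ln_legendre_tail_def c_def j_def del: of_nat_Suc of_nat_add of_nat_mult)
  have "((\<lambda>u. (ln_legendre_tail N u)\<^sup>2 + (2 * c) * (ln_legendre_tail N u * legendre j u) + c\<^sup>2 * (legendre j u * legendre j u))
      has_integral 1 / (real N + 1)\<^sup>2 + (2 * c) * (- 1 / (real j * (real j + 1)))
        + c\<^sup>2 * (if j = j then 1 / (2 * real j + 1) else 0)) {0..1}"
    by (intro has_integral_add has_integral_mult_right Suc has_integral_ln_legendre_tail_legendre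
          has_integral_legendre_legendre) (auto simp: j_def)
  moreover have "1 / (real N + 1)\<^sup>2 + (2 * c) * (- 1 / (real j * (real j + 1)))
        + c\<^sup>2 * (if j = j then 1 / (2 * real j + 1) else 0) = 1 / (real j + 1)\<^sup>2"
  proof -
    define x where "x = real j"
    have x: "x > 0" by (simp add: x_def j_def)
    have N: "real N + 1 = x" by (simp add: x_def j_def)
    have c: "c = (2 * x + 1) / (x * (x + 1))" by (simp add: c_def x_def algebra_simps)
    \<comment> \<open>The cross term is -2 times and the square +1 times the squared norm of the
      projection, so the net change is minus one copy.\<close>
    have "1 / x\<^sup>2 + (2 * c) * (- 1 / (x * (x + 1))) + c\<^sup>2 * (1 / (2 * x + 1)) =
        1 / x\<^sup>2 - (2 * x + 1) / (x\<^sup>2 * (x + 1)\<^sup>2)"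
    proof -
      define d where "d = 1 / (x * (x + 1))"
      have "c\<^sup>2 * (1 / (2 * x + 1)) = (2 * x + 1) * d\<^sup>2"
        using x by (simp add: c d_def power2_eq_square divide_simps)
      moreover have "(2 * c) * (- 1 / (x * (x + 1))) = - 2 * (2 * x + 1) * d\<^sup>2"
        using x by (simp add: c d_def power2_eq_square divide_simps)
      moreover have "(2 * x + 1) / (x\<^sup>2 * (x + 1)\<^sup>2) = (2 * x + 1) * d\<^sup>2"
        by (simp add: d_def power2_eq_square divide_simps)
      ultimately show ?thesis by (simp add: algebra_simps)
    qed
    also have "\<dots> = 1 / (x + 1)\<^sup>2"
      using x by (simp add: divide_simps) (simp add: power2_eq_square algebra_simps)
    finally show ?thesis unfolding N by (simp add: x_def)
  qed
  ultimately show ?case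
    unfolding j_def [symmetric] T by (simp add: power2_eq_square algebra_simps)
qed

section \<open>The Bessel function and random phases\<close>

definition unif_angle :: "real measure" where
  "unif_angle = uniform_measure lborel {0..2 * pi}"

lemma sets_unif_angle [simp, measurable_cong]: "sets unif_angle = sets borel"
  by (simp add: unif_angle_def)

lemma space_unif_angle [simp]: "space unif_angle = UNIV"
  by (simp add: unif_angle_def)

interpretation unif_angle: prob_space unif_angle
  unfolding unif_angle_def by (rule prob_space_uniform_measure) auto

interpretation torus: product_prob_space "\<lambda>_ :: nat. unif_angle" UNIV
  by standard

lemma unif_angle_eq_density:
  "unif_angle = density lborel (\<lambda>x. ennreal (indicator {0..2 * pi} x / (2 * pi)))"
  unfolding unif_angle_def uniform_measure_def
  by (intro density_cong) (auto simp: divide_ennreal split: split_indicator simp flip: ennreal_1)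

lemma integrable_unif_angle:
  fixes f :: "real \<Rightarrow> 'a::euclidean_space"
  assumes "continuous_on UNIV f"
  shows "integrable unif_angle f"
proof -
  have "set_integrable lborel {0..2 * pi} f"
    by (intro borel_integrable_atLeastAtMost' continuous_on_subset[OF assms]) auto
  then have "integrable lborel (\<lambda>x. (1 / (2 * pi)) *\<^sub>R (indicator {0..2 * pi} x *\<^sub>R f x))"
    unfolding set_integrable_def by (rule integrable_scaleR_right)
  moreover have "f \<in> borel_measurable borel"
    using assms by (rule borel_measurable_continuous_onI)
  ultimately show ?thesis unfolding unif_angle_eq_density
    by (subst integrable_density) (auto simp: mult.commute)
qed

lemma integral_unif_angle:
  fixes f :: "real \<Rightarrow> 'a::euclidean_space"
  assumes "continuous_on UNIV f" "(f has_integral I) {0..2 * pi}"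
  shows "integral\<^sup>L unif_angle f = (1 / (2 * pi)) *\<^sub>R I"
proof -
  have int: "set_integrable lborel {0..2 * pi} f"
    by (intro borel_integrable_atLeastAtMost' continuous_on_subset[OF assms(1)]) auto
  have "f \<in> borel_measurable borel"
    using assms(1) by (rule borel_measurable_continuous_onI)
  then have "integral\<^sup>L unif_angle f = (LINT x|lborel. (indicator {0..2 * pi} x / (2 * pi)) *\<^sub>R f x)"
    unfolding unif_angle_eq_density by (intro integral_density) auto
  also have "\<dots> = (LINT x|lborel. (1 / (2 * pi)) *\<^sub>R (indicator {0..2 * pi} x *\<^sub>R f x))"
    by (intro Bochner_Integration.integral_cong refl) simp
  also have "\<dots> = (1 / (2 * pi)) *\<^sub>R (LINT x : {0..2 * pi} | lborel. f x)"
    unfolding set_lebesgue_integral_def by (rule integral_scaleR_right)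
  also have "(LINT x : {0..2 * pi} | lborel. f x) = I"
    using set_borel_integral_eq_integral[OF int] assms(2) by (simp add: integral_unique)
  finally show ?thesis .
qed

lemma integral_cis_unif_angle: "(LINT \<theta>|unif_angle. cis (of_int m * \<theta>)) = (if m = 0 then 1 else 0)"
proof (cases "m = 0")
  case False
  define F where "F \<theta> = (1 / (\<i> * of_int m)) * cis (of_int m * \<theta>)" for \<theta>
  have "((\<lambda>\<theta>. cis (of_int m * \<theta>)) has_integral (F (2 * pi) - F 0)) {0..2 * pi}"
  proof (intro fundamental_theorem_of_calculus)
    fix \<theta> :: real
    show "(F has_vector_derivative cis (of_int m * \<theta>)) (at \<theta> within {0..2 * pi})"
      unfolding F_def has_vector_derivative_def
      by (rule derivative_eq_intros refl | simp)+ (use False in \<open>auto simp: fun_eq_iff scaleR_conv_of_real\<close>)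
  qed simp
  moreover have "F (2 * pi) = F 0"
    using cis_multiple_2pi[of "of_int m"] by (simp add: F_def mult_ac)
  ultimately have "((\<lambda>\<theta>. cis (of_int m * \<theta>)) has_integral 0) {0..2 * pi}" by simp
  then show ?thesis
    using False by (subst integral_unif_angle[where I = 0]) (auto intro!: continuous_intros)
qed (simp add: unif_angle.prob_space[simplified])

text \<open>Parseval for the trigonometric polynomial (z + w e^(i theta))^k. Dividing by (k!)^2
  turns the squared binomials into a convolution, and this form serves three purposes: the moments
  of cos(theta/2), the addition theorem of J0 as a Cauchy product, and the recursion for the moments
  of the linear form.\<close>

lemma angle_moment_recurrence:
  "(LINT \<theta>|unif_angle. cmod (z + w * cis \<theta>) ^ (2 * k) / (fact k)\<^sup>2) =
    (\<Sum>l\<le>k. cmod w ^ (2 * l) / (fact l)\<^sup>2 * (cmod z ^ (2 * (k - l)) / (fact (k - l))\<^sup>2))"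
proof -
  define a where "a l = of_nat (k choose l) * w ^ l * z ^ (k - l)" for l
  have expand: "complex_of_real (cmod (z + w * cis \<theta>) ^ (2 * k)) =
      (\<Sum>l\<le>k. \<Sum>l'\<le>k. (a l * cnj (a l')) * cis (of_int (int l - int l') * \<theta>))" for \<theta>
  proof -
    have 1: "(z + w * cis \<theta>) ^ k = (\<Sum>l\<le>k. a l * cis (real l * \<theta>))"
      unfolding a_def by (subst add.commute, subst binomial_ring)
        (simp add: power_mult_distrib Complex.DeMoivre mult_ac)
    have "complex_of_real (cmod (z + w * cis \<theta>) ^ (2 * k)) = (z + w * cis \<theta>) ^ k * cnj ((z + w * cis \<theta>) ^ k)"
    proof -
      have "complex_of_real (cmod (z + w * cis \<theta>) ^ (2 * k)) = complex_of_real ((cmod (z + w * cis \<theta>))\<^sup>2) ^ k"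
        by (simp add: power_mult)
      then show ?thesis by (simp only: complex_norm_square power_mult_distrib complex_cnj_power)
    qed
    also have "\<dots> = (\<Sum>l\<le>k. \<Sum>l'\<le>k. (a l * cis (real l * \<theta>)) * (cnj (a l') * cis (- (real l' * \<theta>))))"
      unfolding 1 by (simp add: sum_product cis_cnj)
    also have "\<dots> = (\<Sum>l\<le>k. \<Sum>l'\<le>k. (a l * cnj (a l')) * cis (of_int (int l - int l') * \<theta>))"
      by (intro sum.cong refl) (simp add: cis_mult algebra_simps)
    finally show ?thesis .
  qed
  have "complex_of_real (LINT \<theta>|unif_angle. cmod (z + w * cis \<theta>) ^ (2 * k)) =
      (LINT \<theta>|unif_angle. complex_of_real (cmod (z + w * cis \<theta>) ^ (2 * k)))"
    by (rule integral_complex_of_real[symmetric])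
  also have "\<dots> = (\<Sum>l\<le>k. \<Sum>l'\<le>k. (a l * cnj (a l')) * (LINT \<theta>|unif_angle. cis (of_int (int l - int l') * \<theta>)))"
  proof -
    define g where "g l l' \<theta> = (a l * cnj (a l')) * cis (of_int (int l - int l') * \<theta>)" for l l' \<theta>
    have "integrable unif_angle (g l l')" for l l'
      unfolding g_def by (intro integrable_unif_angle continuous_intros)
    then have "(LINT \<theta>|unif_angle. (\<Sum>l\<le>k. \<Sum>l'\<le>k. g l l' \<theta>)) = (\<Sum>l\<le>k. \<Sum>l'\<le>k. integral\<^sup>L unif_angle (g l l'))"
      by (simp add: Bochner_Integration.integral_sum Bochner_Integration.integrable_sum)
    then show ?thesis
      unfolding expand g_def integral_mult_right_zero .
  qed
  also have "\<dots> = (\<Sum>l\<le>k. \<Sum>l'\<le>k. if l = l' then a l * cnj (a l) else 0)"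
    unfolding integral_cis_unif_angle by (intro sum.cong refl) auto
  also have "\<dots> = (\<Sum>l\<le>k. a l * cnj (a l))"
    by simp
  also have "\<dots> = complex_of_real (\<Sum>l\<le>k. cmod (a l) ^ 2)"
    by (simp only: of_real_sum complex_norm_square)
  finally have *: "(LINT \<theta>|unif_angle. cmod (z + w * cis \<theta>) ^ (2 * k)) = (\<Sum>l\<le>k. cmod (a l) ^ 2)"
    by (simp only: of_real_eq_iff)
  have "cmod (a l) ^ 2 / (fact k)\<^sup>2 = cmod w ^ (2 * l) / (fact l)\<^sup>2 * (cmod z ^ (2 * (k - l)) / (fact (k - l))\<^sup>2)"
    if "l \<le> k" for l
  proof -
    have "cmod (a l) = real (k choose l) * cmod w ^ l * cmod z ^ (k - l)"
      by (simp add: a_def norm_mult norm_power)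
    also have "real (k choose l) = fact k / (fact l * fact (k - l))"
      by (rule binomial_fact[OF that])
    finally show ?thesis
      by (simp add: power_mult_distrib power_divide power_even_eq)
  qed
  then show ?thesis
    by (simp add: * sum_divide_distrib)
qed

lemma summable_bessel_J0: "summable (\<lambda>k. norm ((- 1) ^ k / (fact k)\<^sup>2 * (x / 2 :: real) ^ (2 * k)))"
proof (rule summable_comparison_test')
  show "summable (\<lambda>k. ((x / 2)\<^sup>2) ^ k /\<^sub>R fact k)"
    using summable_exp_generic[of "(x / 2)\<^sup>2"] .
  fix k :: nat
  have "(1::real) * fact k \<le> fact k * fact k"
    by (intro mult_right_mono) (auto simp: fact_ge_1)
  then have "inverse (fact k * fact k) \<le> inverse (fact k :: real)"
    by (intro le_imp_inverse_le) auto
  then have B: "((x / 2)\<^sup>2) ^ k * inverse (fact k * fact k) \<le> ((x / 2)\<^sup>2) ^ k * inverse (fact k :: real)"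
    by (intro mult_left_mono) auto
  have A: "norm ((- 1) ^ k / (fact k)\<^sup>2 * (x / 2) ^ (2 * k)) = ((x / 2)\<^sup>2) ^ k * inverse (fact k * fact k)"
  proof -
    have 1: "norm ((- 1 :: real) ^ k) = 1" by (simp add: norm_power)
    have 2: "norm ((fact k :: real)\<^sup>2) = fact k * fact k" by (simp add: power2_eq_square)
    have 3: "norm ((x / 2) ^ (2 * k)) = ((x / 2)\<^sup>2) ^ k"
      unfolding power_mult real_norm_def by (rule abs_of_nonneg) simp
    show ?thesis
      unfolding norm_mult norm_divide 1 2 3 by (simp only: divide_inverse mult_1_left mult.commute)
  qed
  show "norm (norm ((- 1) ^ k / (fact k)\<^sup>2 * (x / 2) ^ (2 * k))) \<le> ((x / 2)\<^sup>2) ^ k /\<^sub>R fact k"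
    unfolding A unfolding real_norm_def real_scaleR_def
    by (subst abs_of_nonneg) (simp, use B in \<open>simp only: mult.commute\<close>)
qed

lemma borel_measurable_bessel_J0 [measurable]: "bessel_J0 \<in> borel_measurable borel"
  unfolding bessel_J0_def by measurable

lemma bessel_J0_sums: "(\<lambda>k. (- 1) ^ k / (fact k)\<^sup>2 * (x / 2) ^ (2 * k)) sums bessel_J0 x"
  unfolding bessel_J0_def by (rule summable_sums[OF summable_norm_cancel[OF summable_bessel_J0]])

text \<open>The even powers of \<open>cos (\<theta> / 2)\<close> are, up to the factor \<open>4 ^ k\<close>, those of
  \<open>cmod (1 + cis \<theta>)\<close>.\<close>
lemma integral_cos_half_power:
  "(LINT \<theta>|unif_angle. cos (\<theta> / 2) ^ (2 * k)) = fact (2 * k) / ((fact k)\<^sup>2 * 4 ^ k)"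
proof -
  have eq: "cos (\<theta> / 2) ^ (2 * k) = ((fact k)\<^sup>2 / 4 ^ k) * (cmod (1 + 1 * cis \<theta>) ^ (2 * k) / (fact k)\<^sup>2)" for \<theta>
  proof -
    have "(cmod (1 + cis \<theta>))\<^sup>2 = (1 + cos \<theta>)\<^sup>2 + (sin \<theta>)\<^sup>2"
      by (simp add: cmod_power2)
    also have "\<dots> = 2 + 2 * cos \<theta>"
      using sin_cos_squared_add[of \<theta>] by (simp add: power2_eq_square algebra_simps)
    also have "\<dots> = 4 * cos (\<theta> / 2) ^ 2"
      using cos_double_cos[of "\<theta> / 2"] by simp
    finally show ?thesis
      by (simp add: power_mult power_mult_distrib)
  qed
  have "(LINT \<theta>|unif_angle. cos (\<theta> / 2) ^ (2 * k)) =
      ((fact k)\<^sup>2 / 4 ^ k) * (\<Sum>l\<le>k. 1 / (fact l)\<^sup>2 * (1 / (fact (k - l))\<^sup>2))"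
    unfolding eq integral_mult_right_zero angle_moment_recurrence by simp
  also have "\<dots> = (\<Sum>l\<le>k. (real (k choose l))\<^sup>2) / 4 ^ k"
    by (simp add: sum_distrib_left sum_divide_distrib binomial_fact power_divide power_mult_distrib mult_ac)
  also have "(\<Sum>l\<le>k. (real (k choose l))\<^sup>2) = fact (2 * k) / (fact k)\<^sup>2"
  proof -
    have "(\<Sum>l\<le>k. (real (k choose l))\<^sup>2) = real (2 * k choose k)"
      using choose_square_sum[of k] by (simp flip: of_nat_power of_nat_sum)
    also have "\<dots> = fact (2 * k) / (fact k)\<^sup>2"
      using binomial_fact[of k "2 * k", where ?'a = real] by (simp add: power2_eq_square)
    finally show ?thesis .
  qed
  finally show ?thesis by simp
qed

text \<open>Termwise integration of the cosine series. The half angle appears because the even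
  moments of cos(theta/2) are available from |1 + e^(i theta)|; their factor (2k)! cancels the
  denominator of the cosine series.\<close>

lemma bessel_J0_eq_integral: "bessel_J0 x = (LINT \<theta>|unif_angle. cos (x * cos (\<theta> / 2)))"
proof -
  define f where "f k \<theta> = (-1) ^ k * x ^ (2 * k) / fact (2 * k) * cos (\<theta> / 2) ^ (2 * k)" for k \<theta>
  have int: "integrable unif_angle (f k)" for k
    unfolding f_def by (intro integrable_unif_angle continuous_intros) auto
  have le: "norm (f k \<theta>) \<le> \<bar>x\<bar> ^ (2 * k) / fact (2 * k)" for k \<theta>
  proof -
    have "\<bar>cos (\<theta> / 2)\<bar> ^ (2 * k) \<le> 1" by (intro power_le_one) auto
    then have "\<bar>x\<bar> ^ (2 * k) / fact (2 * k) * \<bar>cos (\<theta> / 2)\<bar> ^ (2 * k) \<le> \<bar>x\<bar> ^ (2 * k) / fact (2 * k) * 1"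
      by (intro mult_left_mono) auto
    then show ?thesis
      by (simp add: f_def abs_mult power_abs)
  qed
  have sm: "summable (\<lambda>k. \<bar>x\<bar> ^ (2 * k) / fact (2 * k))"
  proof (rule summable_comparison_test'[OF summable_exp_generic[of "x\<^sup>2"]])
    fix k :: nat
    have "inverse (fact (2 * k)) \<le> inverse (fact k :: real)"
      by (intro le_imp_inverse_le fact_mono) auto
    then have "(x\<^sup>2) ^ k * inverse (fact (2 * k)) \<le> (x\<^sup>2) ^ k * inverse (fact k :: real)"
      by (intro mult_left_mono) auto
    moreover have "\<bar>x\<bar> ^ (2 * k) = (x\<^sup>2) ^ k"
      by (simp add: power_mult)
    ultimately show "norm (\<bar>x\<bar> ^ (2 * k) / fact (2 * k)) \<le> (x\<^sup>2) ^ k /\<^sub>R fact k"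
      by (simp add: divide_inverse mult.commute)
  qed
  have sums: "(\<lambda>k. f k \<theta>) sums cos (x * cos (\<theta> / 2))" for \<theta>
    using cos_paired[of "x * cos (\<theta> / 2)"] by (simp add: f_def power_mult_distrib mult_ac)
  have "(\<lambda>k. integral\<^sup>L unif_angle (f k)) sums (LINT \<theta>|unif_angle. (\<Sum>k. f k \<theta>))"
  proof (rule sums_integral[OF int])
    show "AE \<theta> in unif_angle. summable (\<lambda>k. norm (f k \<theta>))"
      by (intro always_eventually allI summable_comparison_test'[OF sm]) (use le in auto)
    show "summable (\<lambda>k. LINT \<theta>|unif_angle. norm (f k \<theta>))"
    proof (rule summable_comparison_test'[OF sm])
      fix k
      have "(LINT \<theta>|unif_angle. norm (f k \<theta>)) \<le> \<bar>x\<bar> ^ (2 * k) / fact (2 * k)"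
        by (intro unif_angle.integral_le_const integrable_norm int always_eventually allI le)
      then show "norm (LINT \<theta>|unif_angle. norm (f k \<theta>)) \<le> \<bar>x\<bar> ^ (2 * k) / fact (2 * k)"
        by (simp add: Bochner_Integration.integral_nonneg)
    qed
  qed
  moreover have "integral\<^sup>L unif_angle (f k) = (- 1) ^ k / (fact k)\<^sup>2 * (x / 2) ^ (2 * k)" for k
    unfolding f_def integral_mult_right_zero integral_cos_half_power
    by (simp add: power_divide power_mult)
  moreover have "(\<Sum>k. f k \<theta>) = cos (x * cos (\<theta> / 2))" for \<theta>
    using sums by (rule sums_unique[symmetric])
  ultimately have "(\<lambda>k. (- 1) ^ k / (fact k)\<^sup>2 * (x / 2) ^ (2 * k)) sums (LINT \<theta>|unif_angle. cos (x * cos (\<theta> / 2)))"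
    by simp
  with bessel_J0_sums[of x] show ?thesis
    by (rule sums_unique2)
qed

lemma abs_bessel_J0_le_1: "\<bar>bessel_J0 x\<bar> \<le> 1"
proof -
  have "norm (LINT \<theta>|unif_angle. cos (x * cos (\<theta> / 2))) \<le> (LINT \<theta>|unif_angle. norm (cos (x * cos (\<theta> / 2))))"
    by (rule integral_norm_bound)
  also have "\<dots> \<le> 1"
    by (intro unif_angle.integral_le_const integrable_unif_angle continuous_intros) auto
  finally show ?thesis by (simp add: bessel_J0_eq_integral)
qed

text \<open>Both sides are power series in t: integrating the series of the left side term by term
  with \<open>angle_moment_recurrence\<close> gives exactly the Cauchy product of the two series on
  the right. The phases of \<open>z\<close> and \<open>w\<close> drop out in the average.\<close>

lemma bessel_J0_addition:
  "(LINT \<theta>|unif_angle. bessel_J0 (t * cmod (z + w * cis \<theta>))) = bessel_J0 (t * cmod z) * bessel_J0 (t * cmod w)"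
proof -
  define f where "f k \<theta> = (-1) ^ k * (t / 2) ^ (2 * k) * (cmod (z + w * cis \<theta>) ^ (2 * k) / (fact k)\<^sup>2)" for k \<theta>
  \<comment> \<open>Bounds the argument of J0 uniformly in the phase, so the absolute series at
    \<open>B\<close> dominates the termwise integration.\<close>
  define B where "B = \<bar>t\<bar> * (cmod z + cmod w)"
  have int: "integrable unif_angle (f k)" for k
    unfolding f_def by (intro integrable_unif_angle continuous_intros) auto
  have le: "norm (f k \<theta>) \<le> norm ((- 1) ^ k / (fact k)\<^sup>2 * (B / 2) ^ (2 * k))" for k \<theta>
  proof -
    have "cmod (z + w * cis \<theta>) \<le> cmod z + cmod w"
      by (metis norm_cis norm_mult mult.right_neutral norm_triangle_ineq)
    then have "(\<bar>t\<bar> / 2) ^ (2 * k) * (cmod (z + w * cis \<theta>) ^ (2 * k) / (fact k)\<^sup>2) \<le>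
       (\<bar>t\<bar> / 2) ^ (2 * k) * ((cmod z + cmod w) ^ (2 * k) / (fact k)\<^sup>2)"
      by (intro mult_left_mono divide_right_mono power_mono) auto
    then show ?thesis
      by (simp add: f_def B_def abs_mult power_abs norm_mult norm_divide norm_power power_mult_distrib power_divide mult_ac)
  qed
  have sums: "(\<lambda>k. f k \<theta>) sums bessel_J0 (t * cmod (z + w * cis \<theta>))" for \<theta>
    using bessel_J0_sums[of "t * cmod (z + w * cis \<theta>)"]
    by (simp add: f_def power_mult_distrib power_divide mult_ac)
  have "(\<lambda>k. integral\<^sup>L unif_angle (f k)) sums (LINT \<theta>|unif_angle. (\<Sum>k. f k \<theta>))"
  proof (rule sums_integral[OF int])
    show "AE \<theta> in unif_angle. summable (\<lambda>k. norm (f k \<theta>))"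
      by (intro always_eventually allI summable_comparison_test'[OF summable_bessel_J0[of B]]) (use le in auto)
    show "summable (\<lambda>k. LINT \<theta>|unif_angle. norm (f k \<theta>))"
    proof (rule summable_comparison_test'[OF summable_bessel_J0[of B]])
      fix k
      have "(LINT \<theta>|unif_angle. norm (f k \<theta>)) \<le> norm ((- 1) ^ k / (fact k)\<^sup>2 * (B / 2) ^ (2 * k))"
        by (intro unif_angle.integral_le_const integrable_norm int always_eventually allI le)
      then show "norm (LINT \<theta>|unif_angle. norm (f k \<theta>)) \<le> norm ((- 1) ^ k / (fact k)\<^sup>2 * (B / 2) ^ (2 * k))"
        by (simp add: Bochner_Integration.integral_nonneg)
    qed
  qed
  moreover have "integral\<^sup>L unif_angle (f k) =
      (\<Sum>l\<le>k. ((-1) ^ l / (fact l)\<^sup>2 * (t * cmod w / 2) ^ (2 * l)) *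
        ((-1) ^ (k - l) / (fact (k - l))\<^sup>2 * (t * cmod z / 2) ^ (2 * (k - l))))" for k
  proof -
    have "integral\<^sup>L unif_angle (f k) = (-1) ^ k * (t / 2) ^ (2 * k) *
      (\<Sum>l\<le>k. cmod w ^ (2 * l) / (fact l)\<^sup>2 * (cmod z ^ (2 * (k - l)) / (fact (k - l))\<^sup>2))"
      unfolding f_def integral_mult_right_zero angle_moment_recurrence ..
    also have "\<dots> = (\<Sum>l\<le>k. ((-1) ^ l * (t / 2) ^ (2 * l)) * ((-1) ^ (k - l) * (t / 2) ^ (2 * (k - l))) *
       (cmod w ^ (2 * l) / (fact l)\<^sup>2 * (cmod z ^ (2 * (k - l)) / (fact (k - l))\<^sup>2)))"
      unfolding sum_distrib_left
    proof (intro sum.cong refl, goal_cases)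
      case (1 l)
      then have k: "k = l + (k - l)" by simp
      have "(-1 :: real) ^ k * (t / 2) ^ (2 * k) = ((-1) ^ l * (t / 2) ^ (2 * l)) * ((-1) ^ (k - l) * (t / 2) ^ (2 * (k - l)))"
        by (subst (1 2) k) (simp only: power_add distrib_left mult_ac)
      then show ?case by simp
    qed
    also have "\<dots> = (\<Sum>l\<le>k. ((-1) ^ l / (fact l)\<^sup>2 * (t * cmod w / 2) ^ (2 * l)) *
        ((-1) ^ (k - l) / (fact (k - l))\<^sup>2 * (t * cmod z / 2) ^ (2 * (k - l))))"
    proof -
      have e: "(t * v / 2) ^ n = (t / 2) ^ n * v ^ n" for v n
        by (simp flip: power_mult_distrib)
      show ?thesis by (intro sum.cong refl) (simp add: e mult_ac)
    qed
    finally show ?thesis .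
  qed
  moreover have "(\<Sum>k. f k \<theta>) = bessel_J0 (t * cmod (z + w * cis \<theta>))" for \<theta>
    using sums by (rule sums_unique[symmetric])
  ultimately have "(\<lambda>k. \<Sum>l\<le>k. ((-1) ^ l / (fact l)\<^sup>2 * (t * cmod w / 2) ^ (2 * l)) *
        ((-1) ^ (k - l) / (fact (k - l))\<^sup>2 * (t * cmod z / 2) ^ (2 * (k - l))))
      sums (LINT \<theta>|unif_angle. bessel_J0 (t * cmod (z + w * cis \<theta>)))"
    by simp
  moreover have "(\<lambda>k. \<Sum>l\<le>k. ((-1) ^ l / (fact l)\<^sup>2 * (t * cmod w / 2) ^ (2 * l)) *
        ((-1) ^ (k - l) / (fact (k - l))\<^sup>2 * (t * cmod z / 2) ^ (2 * (k - l))))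
      sums (bessel_J0 (t * cmod w) * bessel_J0 (t * cmod z))"
    unfolding bessel_J0_def
    by (rule Cauchy_product_sums[OF summable_bessel_J0[of "t * cmod w"] summable_bessel_J0[of "t * cmod z"]])
  ultimately have "(LINT \<theta>|unif_angle. bessel_J0 (t * cmod (z + w * cis \<theta>))) = bessel_J0 (t * cmod w) * bessel_J0 (t * cmod z)"
    by (rule sums_unique2)
  then show ?thesis by (simp only: mult.commute)
qed

text \<open>Keeps \<open>csqrt (1 - z\<^sup>2)\<close> off its branch cut, hence holomorphic and
  non-zero, in the upper half plane: 1 - z^2 is real there only on the imaginary axis, where it
  exceeds 1.\<close>

lemma one_minus_square_notin_nonpos_Reals:
  fixes z :: complex
  assumes "Im z > 0"
  shows "1 - z\<^sup>2 \<notin> \<real>\<^sub>\<le>\<^sub>0"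
proof
  assume "1 - z\<^sup>2 \<in> \<real>\<^sub>\<le>\<^sub>0"
  then have *: "Im (1 - z\<^sup>2) = 0" "Re (1 - z\<^sup>2) \<le> 0"
    by (auto simp: complex_nonpos_Reals_iff)
  then have "Re z = 0" using assms by (simp add: power2_eq_square)
  then show False using * by (simp add: power2_eq_square add_nonneg_pos not_le)
      (smt (verit) mult_nonneg_nonneg assms)
qed

text \<open>Up to a factor \<open>pi\<close>, \<^term>\<open>bessel_J0 x\<close> is the real part of the integral of
  \<open>exp (\<i> x z) / sqrt (1 - z\<^sup>2)\<close> along \<open>{-1..1}\<close>. Moving the path to the vertical half
  lines above \<open>-1\<close> and \<open>1\<close>, where \<open>cmod (1 - z\<^sup>2) \<ge> 2 * Im z\<close>, gives the sharp constant.\<close>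
lemma abs_bessel_J0_le:
  assumes x: "x > 0"
  shows "\<bar>bessel_J0 x\<bar> \<le> sqrt (2 / (pi * x))"
proof -
  define f where "f z = exp (\<i> * of_real x * z) / csqrt (1 - z\<^sup>2)" for z
  define S where "S = {z. Im z > 0}"
  have S: "convex S" "open S"
    unfolding S_def by (auto simp: convex_halfspace_Im_gt open_halfspace_Im_gt)
  have "f holomorphic_on S"
    unfolding f_def S_def
    by (intro holomorphic_intros) (auto dest: one_minus_square_notin_nonpos_Reals)
  \<comment> \<open>A primitive on the convex half plane replaces contour integration: every path
    integral of \<open>f\<close> is a difference of values of \<open>g\<close>. Since
    \<open>f\<close> is singular at -1 and 1, all paths start at a height \<epsilon> > 0, which
    tends to 0 at the end.\<close>
  with S obtain g where "\<And>z. z \<in> S \<Longrightarrow> (g has_field_derivative f z) (at z within S)"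
    using holomorphic_convex_primitive' by blast
  then have g: "(g has_field_derivative f z) (at z)" if "Im z > 0" for z
    using that S by (metis S_def at_within_open mem_Collect_eq)
  have norm_f: "cmod (f z) = exp (- x * Im z) / sqrt (cmod (1 - z\<^sup>2))" for z
    by (simp add: f_def norm_divide)
  have factor: "cmod (1 - z\<^sup>2) = cmod (1 - z) * cmod (1 + z)" for z :: complex
    by (simp add: norm_mult [symmetric] power2_eq_square algebra_simps)

  \<comment> \<open>On a vertical side substitute v = x Im z. With |1 - z^2| >= 2v/x the integrand
    is at most exp(-v) v^(-1/2) / sqrt(2x), whose integral over the half line is Gamma(1/2) /
    sqrt(2x).\<close>
  have side: "cmod (g (of_real \<sigma> + \<i> * of_real Y) - g (of_real \<sigma> + \<i> * of_real \<epsilon>)) \<le> sqrt pi / sqrt (2 * x)"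
    if \<sigma>: "\<sigma> = 1 \<or> \<sigma> = -1" and \<epsilon>: "0 < \<epsilon>" "\<epsilon> \<le> Y" for \<sigma> \<epsilon> Y
  proof -
    define \<phi> where "\<phi> v = g (of_real \<sigma> + \<i> * of_real (v / x))" for v
    define \<psi> where "\<psi> v = (\<i> / x) * f (of_real \<sigma> + \<i> * of_real (v / x))" for v
    have ab: "0 < x * \<epsilon>" "x * \<epsilon> \<le> x * Y" using \<epsilon> x by auto
    have int: "(\<psi> has_integral (\<phi> (x * Y) - \<phi> (x * \<epsilon>))) {x * \<epsilon>..x * Y}"
    proof (intro fundamental_theorem_of_calculus ab)
      fix v assume v: "v \<in> {x * \<epsilon>..x * Y}"
      then have v0: "v > 0" using ab by auto
      have "(g has_field_derivative f (of_real \<sigma> + \<i> * of_real (v / x))) (at (of_real \<sigma> + \<i> * of_real (v / x)))"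
        using v0 x by (intro g) auto
      moreover have "((\<lambda>v. of_real \<sigma> + \<i> * of_real (v / x)) has_vector_derivative \<i> / x) (at v within {x * \<epsilon>..x * Y})"
        unfolding has_vector_derivative_def using x
        by (auto intro!: derivative_eq_intros simp: fun_eq_iff scaleR_conv_of_real)
      ultimately have "((g \<circ> (\<lambda>v. of_real \<sigma> + \<i> * of_real (v / x))) has_vector_derivative \<psi> v) (at v within {x * \<epsilon>..x * Y})"
        unfolding \<psi>_def by (intro field_vector_diff_chain_within) (auto intro: has_field_derivative_at_within)
      then show "(\<phi> has_vector_derivative \<psi> v) (at v within {x * \<epsilon>..x * Y})"
        unfolding \<phi>_def [abs_def] o_def .
    qed
    define B where "B v = (1 / sqrt (2 * x)) * (v powr (1 / 2 - 1) / exp v)" for v :: real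
    have B: "(B has_integral sqrt pi / sqrt (2 * x)) {0..}"
      unfolding B_def using has_integral_mult_right[OF Gamma_integral_real[of "1 / 2"], of "1 / sqrt (2 * x)"]
      by (simp add: Gamma_one_half_real)
    have B_int: "B integrable_on {x * \<epsilon>..x * Y}"
      using B ab integrable_on_subinterval[of B "{0..}" "x * \<epsilon>" "x * Y"] by (auto simp: integrable_on_def)
    have le: "norm (\<psi> v) \<le> B v" if v: "v \<in> {x * \<epsilon>..x * Y}" for v
    proof -
      have v0: "v > 0" using v ab by auto
      define z where "z = complex_of_real \<sigma> + \<i> * of_real (v / x)"
      have Imz: "Im z = v / x" by (simp add: z_def)
      have "2 * (v / x) \<le> cmod (1 - z\<^sup>2)"
      proof (cases "\<sigma> = 1")
        case True
        have "cmod (1 - z) = v / x" using v0 x by (simp add: z_def True norm_mult norm_divide)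
        moreover have "2 \<le> cmod (1 + z)"
          using complex_Re_le_cmod[of "1 + z"] by (simp add: z_def True)
        ultimately show ?thesis unfolding factor using v0 x
          by (simp add: mult.commute mult_left_mono divide_right_mono)
      next
        case False
        then have \<sigma>': "\<sigma> = -1" using \<sigma> by simp
        have "cmod (1 + z) = v / x" using v0 x by (simp add: z_def \<sigma>' norm_mult norm_divide)
        moreover have "2 \<le> cmod (1 - z)"
          using complex_Re_le_cmod[of "1 - z"] by (simp add: z_def \<sigma>')
        ultimately show ?thesis unfolding factor using v0 x
          by (simp add: mult_right_mono divide_right_mono)
      qed
      then have "exp (- x * Im z) / sqrt (cmod (1 - z\<^sup>2)) \<le> exp (- x * Im z) / sqrt (2 * (v / x))"
      proof (intro divide_left_mono)
        show "sqrt (2 * (v / x)) \<le> sqrt (cmod (1 - z\<^sup>2))"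
          using \<open>2 * (v / x) \<le> cmod (1 - z\<^sup>2)\<close> by (rule real_sqrt_le_mono)
        have "0 < 2 * (v / x)" using v0 x by simp
        then have "0 < sqrt (2 * (v / x))" "0 < sqrt (cmod (1 - z\<^sup>2))"
          using \<open>2 * (v / x) \<le> cmod (1 - z\<^sup>2)\<close> by (simp_all only: real_sqrt_gt_0_iff)
        then show "0 < sqrt (cmod (1 - z\<^sup>2)) * sqrt (2 * (v / x))" by (intro mult_pos_pos)
      qed simp
      then have "(1 / x) * cmod (f z) \<le> (1 / x) * (exp (- v) / sqrt (2 * (v / x)))"
        unfolding norm_f using x by (intro mult_left_mono) (simp_all add: Imz)
      moreover have "norm (\<psi> v) = (1 / x) * cmod (f z)"
        unfolding \<psi>_def z_def [symmetric] using x by (simp add: norm_mult norm_divide)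
      ultimately have "norm (\<psi> v) \<le> (1 / x) * (exp (- v) / sqrt (2 * (v / x)))" by simp
      also have "\<dots> = B v"
      proof -
        have "v powr (1 / 2 - 1) = 1 / sqrt v"
          using v0 by (simp add: powr_minus_divide powr_half_sqrt)
        moreover have "sqrt (2 * (v / x)) = sqrt (2 * x) * sqrt v / x"
        proof -
          have "2 * (v / x) = 2 * x * v / x\<^sup>2" using x by (simp add: power2_eq_square)
          then show ?thesis using x by (simp add: real_sqrt_mult real_sqrt_divide)
        qed
        ultimately show ?thesis using x v0 by (simp add: B_def exp_minus field_simps)
      qed
      finally show ?thesis .
    qed
    have "cmod (\<phi> (x * Y) - \<phi> (x * \<epsilon>)) = norm (integral {x * \<epsilon>..x * Y} \<psi>)"
      using int by (simp add: integral_unique)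
    also have "\<dots> \<le> integral {x * \<epsilon>..x * Y} B"
      using int by (intro integral_norm_bound_integral B_int le) (auto simp: integrable_on_def)
    also have "\<dots> \<le> integral {0..} B"
    proof -
      have "B v \<ge> 0" for v unfolding B_def using x by (intro mult_nonneg_nonneg divide_nonneg_nonneg) auto
      then show ?thesis
        using B ab B_int by (intro integral_subset_le) (auto simp: integrable_on_def)
    qed
    also have "\<dots> = sqrt pi / sqrt (2 * x)" using B by (rule integral_unique)
    finally show ?thesis using x by (simp add: \<phi>_def)
  qed

  \<comment> \<open>The horizontal side at height Y has length 2, and |1 - z^2| >= 1 there, so it
    disappears exponentially as Y grows.\<close>
  have top: "cmod (g (1 + \<i> * of_real Y) - g (-1 + \<i> * of_real Y)) \<le> exp (- x * Y) * 2"
    if Y: "Y \<ge> 2" for Y :: real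
  proof -
    have f_le: "cmod (f z) \<le> exp (- x * Y)" if z: "Im z \<ge> Y" for z
    proof -
      have "cmod z \<ge> 2" using z Y abs_Im_le_cmod[of z] by auto
      then have "(cmod z)\<^sup>2 \<ge> 2\<^sup>2" by (intro power_mono) auto
      moreover have "cmod (z\<^sup>2) - cmod 1 \<le> cmod (z\<^sup>2 - 1)" by (rule norm_triangle_ineq2)
      ultimately have "cmod (1 - z\<^sup>2) \<ge> 1" by (simp add: norm_power norm_minus_commute)
      moreover have "exp (- x * Im z) \<le> exp (- x * Y)" using x z by simp
      ultimately show "cmod (f z) \<le> exp (- x * Y)"
        unfolding norm_f using frac_le[of "exp (- x * Y)" "exp (- x * Im z)" 1 "sqrt (cmod (1 - z\<^sup>2))"] by simp
    qed
    have g': "(g has_field_derivative f z) (at z within {z. Im z \<ge> Y})" if "Im z \<ge> Y" for z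
      using Y that by (intro has_field_derivative_at_within[OF g]) auto
    have "cmod (g (1 + \<i> * of_real Y) - g (-1 + \<i> * of_real Y)) \<le>
      exp (- x * Y) * cmod ((1 + \<i> * of_real Y) - (-1 + \<i> * of_real Y))"
      using field_differentiable_bound[OF convex_halfspace_Im_ge[of Y], of g f "exp (- x * Y)"
          "1 + \<i> * of_real Y" "-1 + \<i> * of_real Y"] g' f_le by simp
    then show ?thesis by simp
  qed

  \<comment> \<open>Only the two vertical sides survive Y going to infinity. The bound is uniform in
    \<epsilon>, hence passes to the limit.\<close>
  have bound: "cmod (g (1 + \<i> * of_real \<epsilon>) - g (-1 + \<i> * of_real \<epsilon>)) \<le> 2 * (sqrt pi / sqrt (2 * x))"
    if \<epsilon>: "\<epsilon> > 0" for \<epsilon> :: real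
  proof (rule tendsto_lowerbound)
    have "((\<lambda>Y. exp (- x * Y)) \<longlongrightarrow> 0) at_top"
      using x by real_asymp
    then have "((\<lambda>Y. 2 * (sqrt pi / sqrt (2 * x)) + exp (- x * Y) * 2) \<longlongrightarrow> 2 * (sqrt pi / sqrt (2 * x)) + 0 * 2) at_top"
      by (intro tendsto_intros)
    then show "((\<lambda>Y. 2 * (sqrt pi / sqrt (2 * x)) + exp (- x * Y) * 2) \<longlongrightarrow> 2 * (sqrt pi / sqrt (2 * x))) at_top"
      by simp
    show "\<forall>\<^sub>F Y in at_top. cmod (g (1 + \<i> * of_real \<epsilon>) - g (-1 + \<i> * of_real \<epsilon>)) \<le>
        2 * (sqrt pi / sqrt (2 * x)) + exp (- x * Y) * 2"
      using eventually_ge_at_top[of "max 2 \<epsilon>"]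
    proof eventually_elim
      case (elim Y)
      let ?a = "g (1 + \<i> * of_real \<epsilon>)" and ?b = "g (-1 + \<i> * of_real \<epsilon>)"
        and ?a' = "g (1 + \<i> * of_real Y)" and ?b' = "g (-1 + \<i> * of_real Y)"
      have "cmod (?a - ?b) \<le> cmod (?a' - ?b') + cmod (?a' - ?a) + cmod (?b' - ?b)"
      proof -
        have "?a - ?b = (?a' - ?b') - (?a' - ?a) + (?b' - ?b)" by simp
        then have "cmod (?a - ?b) \<le> cmod ((?a' - ?b') - (?a' - ?a)) + cmod (?b' - ?b)"
          by (metis norm_triangle_ineq)
        also have "cmod ((?a' - ?b') - (?a' - ?a)) \<le> cmod (?a' - ?b') + cmod (?a' - ?a)"
          by (rule norm_triangle_ineq4)
        finally show ?thesis by simp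
      qed
      with side[of 1 \<epsilon> Y] side[of "-1" \<epsilon> Y] top[of Y] elim \<epsilon> show ?case by simp
    qed
  qed simp

  \<comment> \<open>The path runs from -1 to 1 at height \<epsilon> as the angle runs over {0..2
    pi}. In the limit csqrt(1 - p^2) becomes sin(theta/2), which the derivative sin(theta/2)/2 of
    the path cancels; what remains is the function \<open>e\<close> below, twice whose real part is
    the integrand of J0.\<close>
  define p where "p \<epsilon> \<theta> = of_real (- cos (\<theta> / 2)) + \<i> * of_real \<epsilon>" for \<epsilon> \<theta> :: real
  define h where "h \<epsilon> \<theta> = of_real (sin (\<theta> / 2) / 2) * f (p \<epsilon> \<theta>)" for \<epsilon> \<theta>
  have cont_h: "continuous_on UNIV (h \<epsilon>)" if \<epsilon>: "\<epsilon> > 0" for \<epsilon> :: real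
  proof -
    have "1 - (p \<epsilon> \<theta>)\<^sup>2 \<notin> \<real>\<^sub>\<le>\<^sub>0" for \<theta>
      using \<epsilon> by (intro one_minus_square_notin_nonpos_Reals) (simp add: p_def)
    moreover from this have "csqrt (1 - (p \<epsilon> \<theta>)\<^sup>2) \<noteq> 0" for \<theta>
      by (metis csqrt_eq_0 complex_nonpos_Reals_iff order_refl zero_complex.simps)
    moreover have p: "continuous_on UNIV (p \<epsilon>)"
      unfolding p_def by (intro continuous_intros) auto
    moreover have "continuous_on UNIV (\<lambda>\<theta>. csqrt (1 - (p \<epsilon> \<theta>)\<^sup>2))"
      by (rule continuous_on_compose2[OF holomorphic_on_imp_continuous_on[OF holomorphic_on_csqrt]])
         (use calculation in \<open>auto intro!: continuous_intros\<close>)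
    ultimately show ?thesis
      unfolding h_def f_def by (intro continuous_intros) auto
  qed
  have int_h: "(LINT \<theta>|unif_angle. h \<epsilon> \<theta>) = (1 / (2 * pi)) *\<^sub>R (g (1 + \<i> * of_real \<epsilon>) - g (-1 + \<i> * of_real \<epsilon>))"
    if \<epsilon>: "\<epsilon> > 0" for \<epsilon> :: real
  proof (rule integral_unif_angle[OF cont_h[OF \<epsilon>]])
    have "(h \<epsilon> has_integral ((g \<circ> p \<epsilon>) (2 * pi) - (g \<circ> p \<epsilon>) 0)) {0..2 * pi}"
    proof (intro fundamental_theorem_of_calculus)
      fix \<theta> assume "\<theta> \<in> {0..2 * pi}"
      have "(g has_field_derivative f (p \<epsilon> \<theta>)) (at (p \<epsilon> \<theta>))"
        using \<epsilon> by (intro g) (simp add: p_def)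
      moreover have "(p \<epsilon> has_vector_derivative of_real (sin (\<theta> / 2) / 2)) (at \<theta> within {0..2 * pi})"
      proof -
        have "((\<lambda>\<theta>. - cos (\<theta> / 2)) has_real_derivative (sin (\<theta> / 2) / 2)) (at \<theta> within {0..2 * pi})"
          by (auto intro!: derivative_eq_intros)
        then have "(p \<epsilon> has_vector_derivative of_real (sin (\<theta> / 2) / 2) + 0) (at \<theta> within {0..2 * pi})"
          unfolding p_def [abs_def]
          by (intro has_vector_derivative_add has_vector_derivative_of_real has_vector_derivative_const)
        then show ?thesis by simp
      qed
      ultimately show "((g \<circ> p \<epsilon>) has_vector_derivative h \<epsilon> \<theta>) (at \<theta> within {0..2 * pi})"
        unfolding h_def by (intro field_vector_diff_chain_within) (auto intro: has_field_derivative_at_within)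
    qed simp
    then show "(h \<epsilon> has_integral (g (1 + \<i> * of_real \<epsilon>) - g (-1 + \<i> * of_real \<epsilon>))) {0..2 * pi}"
      by (simp add: p_def)
  qed

  define e where "e \<theta> = exp (\<i> * of_real (- x * cos (\<theta> / 2))) / 2" for \<theta> :: real
  define \<epsilon> where "\<epsilon> n = 1 / real (Suc n)" for n
  have \<epsilon>: "\<epsilon> n > 0" for n by (simp add: \<epsilon>_def)
  have "(\<lambda>n. LINT \<theta>|unif_angle. h (\<epsilon> n) \<theta>) \<longlonglongrightarrow> (LINT \<theta>|unif_angle. e \<theta>)"
  proof (rule integral_dominated_convergence[where w = "\<lambda>_. 1 / 2"])
    have "continuous_on UNIV e" unfolding e_def by (intro continuous_intros) auto
    then have "e \<in> borel_measurable borel" by (rule borel_measurable_continuous_onI)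
    then show "e \<in> borel_measurable unif_angle" by measurable
    show "h (\<epsilon> n) \<in> borel_measurable unif_angle" for n
      using borel_measurable_continuous_onI[OF cont_h[OF \<epsilon>[of n]]] by measurable
    \<comment> \<open>At the two endpoints sin(theta/2) = 0, and the cancellation in the limit of
      \<open>h\<close> breaks down.\<close>
    have ae: "AE \<theta> in lborel. \<theta> \<noteq> 0 \<and> \<theta> \<noteq> 2 * pi"
      using AE_lborel_singleton[of 0] AE_lborel_singleton[of "2 * pi"] by eventually_elim auto
    then have "AE \<theta> in unif_angle. 0 < \<theta> \<and> \<theta> < 2 * pi"
      unfolding unif_angle_eq_density
    proof (subst AE_density)
      show "AE \<theta> in lborel. 0 < ennreal (indicator {0..2 * pi} \<theta> / (2 * pi)) \<longrightarrow> 0 < \<theta> \<and> \<theta> < 2 * pi"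
        using ae by (rule eventually_mono) (auto split: split_indicator)
    qed simp
    then show "AE \<theta> in unif_angle. (\<lambda>n. h (\<epsilon> n) \<theta>) \<longlonglongrightarrow> e \<theta>"
    proof eventually_elim
      case (elim \<theta>)
      define s where "s = sin (\<theta> / 2)"
      define q :: complex where "q = of_real (- cos (\<theta> / 2))"
      have s: "s > 0" using elim unfolding s_def by (intro sin_gt_zero) auto
      have q: "1 - q\<^sup>2 = of_real (s\<^sup>2)"
        by (simp add: q_def s_def sin_squared_eq)
      have csq: "csqrt (1 - q\<^sup>2) = of_real s"
        unfolding q using s by (simp add: of_real_sqrt [symmetric] del: of_real_power)
      have "\<epsilon> \<longlonglongrightarrow> 0"
        unfolding \<epsilon>_def by real_asymp
      then have lim: "(\<lambda>n. p (\<epsilon> n) \<theta>) \<longlonglongrightarrow> q"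
        unfolding p_def q_def by (auto intro!: tendsto_eq_intros)
      have "(\<lambda>n. csqrt (1 - (p (\<epsilon> n) \<theta>)\<^sup>2)) \<longlonglongrightarrow> csqrt (1 - q\<^sup>2)"
      proof (rule isCont_tendsto_compose[where g = csqrt])
        show "isCont csqrt (1 - q\<^sup>2)"
          unfolding q using s by (intro continuous_at_csqrt) (auto simp: complex_nonpos_Reals_iff simp flip: of_real_power)
        show "(\<lambda>n. 1 - (p (\<epsilon> n) \<theta>)\<^sup>2) \<longlonglongrightarrow> 1 - q\<^sup>2"
          by (intro tendsto_intros lim)
      qed
      then have "(\<lambda>n. h (\<epsilon> n) \<theta>) \<longlonglongrightarrow> of_real (s / 2) * (exp (\<i> * of_real x * q) / of_real s)"
        unfolding h_def f_def s_def [symmetric] csq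
        using s by (intro tendsto_intros lim) auto
      also have "of_real (s / 2) * (exp (\<i> * of_real x * q) / of_real s) = e \<theta>"
        using s by (simp add: e_def q_def mult.assoc)
      finally show ?case .
    qed
    show "AE \<theta> in unif_angle. norm (h (\<epsilon> n) \<theta>) \<le> 1 / 2" for n
    proof (intro always_eventually allI)
      fix \<theta>
      define z where "z = p (\<epsilon> n) \<theta>"
      \<comment> \<open>Comparing each factor of 1 - z^2 with its real part gives |1 - z^2| >=
        sin(theta/2)^2 for every \<epsilon>; this is what makes the constant 1/2 a dominating
        function.\<close>
      have "\<bar>Re (1 - z)\<bar> * \<bar>Re (1 + z)\<bar> \<le> cmod (1 - z\<^sup>2)"
        unfolding factor by (intro mult_mono abs_Re_le_cmod) auto
      moreover have "\<bar>Re (1 - z)\<bar> * \<bar>Re (1 + z)\<bar> = \<bar>(sin (\<theta> / 2))\<^sup>2\<bar>"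
        unfolding abs_mult [symmetric] sin_squared_eq
        by (simp add: z_def p_def power2_eq_square algebra_simps)
      ultimately have "\<bar>sin (\<theta> / 2)\<bar> \<le> sqrt (cmod (1 - z\<^sup>2))"
        by (metis abs_of_nonneg real_sqrt_abs real_sqrt_le_mono zero_le_power2)
      moreover have "exp (- x * Im z) \<le> 1"
        using \<epsilon>[of n] x by (simp add: z_def p_def)
      moreover have "sqrt (cmod (1 - z\<^sup>2)) > 0"
        using one_minus_square_notin_nonpos_Reals[of z] \<epsilon>[of n]
        by (auto simp: z_def p_def)
      ultimately have "(\<bar>sin (\<theta> / 2)\<bar> / sqrt (cmod (1 - z\<^sup>2))) * exp (- x * Im z) \<le> 1 * 1"
        by (intro mult_mono) simp_all
      then have "\<bar>sin (\<theta> / 2)\<bar> * (exp (- x * Im z) / sqrt (cmod (1 - z\<^sup>2))) \<le> 1"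
        by simp
      then show "norm (h (\<epsilon> n) \<theta>) \<le> 1 / 2"
        unfolding h_def norm_mult norm_of_real norm_f z_def [symmetric] by (simp add: abs_mult)
    qed
  qed simp
  then have "(\<lambda>n. norm (LINT \<theta>|unif_angle. h (\<epsilon> n) \<theta>)) \<longlonglongrightarrow> norm (LINT \<theta>|unif_angle. e \<theta>)"
    by (rule tendsto_norm)
  then have "norm (LINT \<theta>|unif_angle. e \<theta>) \<le> (1 / (2 * pi)) * (2 * (sqrt pi / sqrt (2 * x)))"
  proof (rule LIMSEQ_le_const2, intro exI allI impI)
    fix n
    show "norm (LINT \<theta>|unif_angle. h (\<epsilon> n) \<theta>) \<le> (1 / (2 * pi)) * (2 * (sqrt pi / sqrt (2 * x)))"
      unfolding int_h[OF \<epsilon>] norm_scaleR using bound[OF \<epsilon>[of n]]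
      by (intro mult_mono) auto
  qed
  moreover have "bessel_J0 x = 2 * Re (LINT \<theta>|unif_angle. e \<theta>)"
  proof -
    have "integrable unif_angle e"
      unfolding e_def by (intro integrable_unif_angle continuous_intros) auto
    then have "Re (LINT \<theta>|unif_angle. e \<theta>) = (LINT \<theta>|unif_angle. Re (e \<theta>))"
      by (rule integral_Re [symmetric])
    also have "\<dots> = (LINT \<theta>|unif_angle. cos (x * cos (\<theta> / 2)) / 2)"
      by (simp add: e_def Re_exp)
    finally show ?thesis by (simp add: bessel_J0_eq_integral)
  qed
  ultimately have "\<bar>bessel_J0 x\<bar> \<le> 2 * ((1 / (2 * pi)) * (2 * (sqrt pi / sqrt (2 * x))))"
    using abs_Re_le_cmod[of "LINT \<theta>|unif_angle. e \<theta>"] by simp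
  also have "\<dots> = sqrt (2 / (pi * x))"
  proof -
    have "sqrt pi * sqrt pi = pi" "sqrt 2 * sqrt 2 = 2" by simp_all
    then show ?thesis using x
      by (simp add: real_sqrt_divide real_sqrt_mult field_simps)
  qed
  finally show ?thesis .
qed

section \<open>Averages over independent phases and the identification with the given
  definitions\<close>

lemma borel_measurable_cis [measurable]: "cis \<in> borel_measurable borel"
  by (intro borel_measurable_continuous_onI continuous_intros)

abbreviation torus :: "nat set \<Rightarrow> (nat \<Rightarrow> real) measure" where
  "torus I \<equiv> \<Pi>\<^sub>M m\<in>I. unif_angle"

lemma prob_space_torus: "prob_space (torus I)"
  by (intro prob_space_PiM unif_angle.prob_space_axioms)

definition rotated_sum :: "nat set \<Rightarrow> (nat \<Rightarrow> complex) \<Rightarrow> (nat \<Rightarrow> real) \<Rightarrow> complex" where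
  "rotated_sum I W \<theta> = (\<Sum>m\<in>I. W m * cis (\<theta> m))"

lemma borel_measurable_rotated_sum [measurable]:
  "rotated_sum I W \<in> borel_measurable (torus I)"
  unfolding rotated_sum_def by measurable

lemma rotated_sum_insert:
  assumes "finite I" "i \<notin> I"
  shows "rotated_sum (insert i I) W (\<theta>(i := y)) = rotated_sum I W \<theta> + W i * cis y"
proof -
  have "(\<Sum>m\<in>I. W m * cis ((\<theta>(i := y)) m)) = (\<Sum>m\<in>I. W m * cis (\<theta> m))"
    using assms by (intro sum.cong) auto
  then show ?thesis using assms by (simp add: rotated_sum_def add.commute)
qed

lemma cmod_rotated_sum_le: "cmod (rotated_sum I W \<theta>) \<le> (\<Sum>m\<in>I. cmod (W m))"
  unfolding rotated_sum_def by (rule order_trans[OF norm_sum]) (simp add: norm_mult)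

lemma integrable_torus_bounded:
  fixes f :: "(nat \<Rightarrow> real) \<Rightarrow> real"
  assumes "f \<in> borel_measurable (torus I)" "\<And>\<theta>. \<bar>f \<theta>\<bar> \<le> B"
  shows "integrable (torus I) f"
proof -
  interpret prob_space "torus I" by (rule prob_space_torus)
  show ?thesis using assms by (intro integrable_const_bound[of _ B]) auto
qed

text \<open>Integrate one coordinate at a time; the addition theorem is applied with
  \<open>z\<close> plus the remaining sum in the role of its first vector. The offset
  \<open>z\<close> is what later allows Gaussians centred at any point.\<close>

lemma integral_torus_bessel_J0:
  assumes "finite I"
  shows "(LINT \<theta>|torus I. bessel_J0 (t * cmod (z + rotated_sum I W \<theta>))) =
    bessel_J0 (t * cmod z) * (\<Prod>m\<in>I. bessel_J0 (t * cmod (W m)))"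
  using assms
proof (induction I)
  case empty
  then show ?case
    using prob_space.prob_space[OF prob_space_torus, of "{}"] by (simp add: rotated_sum_def)
next
  case (insert i I)
  have "(LINT \<theta>|torus (insert i I). bessel_J0 (t * cmod (z + rotated_sum (insert i I) W \<theta>))) =
      (LINT \<theta>|torus I. LINT y|unif_angle. bessel_J0 (t * cmod (z + rotated_sum (insert i I) W (\<theta>(i := y)))))"
    using insert.hyps
    by (intro torus.product_integral_insert integrable_torus_bounded[of _ _ 1] abs_bessel_J0_le_1) measurable
  also have "\<dots> = (LINT \<theta>|torus I. bessel_J0 (t * cmod (z + rotated_sum I W \<theta>)) * bessel_J0 (t * cmod (W i)))"
    unfolding rotated_sum_insert[OF insert.hyps] add.assoc [symmetric] bessel_J0_addition ..
  also have "\<dots> = bessel_J0 (t * cmod z) * (\<Prod>m\<in>I. bessel_J0 (t * cmod (W m))) * bessel_J0 (t * cmod (W i))"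
    by (simp add: insert.IH)
  finally show ?case using insert.hyps by (simp add: mult_ac)
qed

text \<open>The index set of \<open>a_coeff\<close> with {..n} replaced by any set \<open>I\<close>,
  so that induction over \<open>I\<close> is possible.\<close>

definition compositions :: "nat set \<Rightarrow> nat \<Rightarrow> (nat \<Rightarrow> nat) set" where
  "compositions I k = {l. l \<in> I \<rightarrow>\<^sub>E {..k} \<and> (\<Sum>m\<in>I. l m) = k}"

lemma finite_compositions: "finite I \<Longrightarrow> finite (compositions I k)"
  unfolding compositions_def
  by (rule finite_subset[of _ "I \<rightarrow>\<^sub>E {..k}"]) (auto intro: finite_PiE)

lemma compositions_empty: "compositions {} k = (if k = 0 then {\<lambda>_. undefined} else {})"
  by (auto simp: compositions_def)

text \<open>Sorts the compositions by their part \<open>j\<close> at \<open>i\<close>. Resetting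
  that place to \<open>undefined\<close>, the value prescribed outside the domain by extensionality,
  is the inverse of the update.\<close>

lemma sum_compositions_insert:
  assumes I: "finite I" "i \<notin> I"
  shows "(\<Sum>l\<in>compositions (insert i I) k. f l) =
    (\<Sum>j\<le>k. \<Sum>l\<in>compositions I (k - j). (f (l(i := j)) :: 'a :: comm_monoid_add))"
proof -
  have "(\<Sum>j\<le>k. \<Sum>l\<in>compositions I (k - j). f (l(i := j))) =
      (\<Sum>(j, l)\<in>(SIGMA j:{..k}. compositions I (k - j)). f (l(i := j)))"
    using finite_compositions[OF I(1)] by (intro sum.Sigma) auto
  also have "\<dots> = (\<Sum>l\<in>compositions (insert i I) k. f l)"
  proof (rule sum.reindex_bij_witness[where i = "\<lambda>l. (l i, l(i := undefined))" and j = "\<lambda>(j, l). l(i := j)"])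
    fix a assume "a \<in> (SIGMA j:{..k}. compositions I (k - j))"
    then obtain j l where a: "a = (j, l)" "j \<le> k" "l \<in> compositions I (k - j)" by auto
    have l: "l \<in> I \<rightarrow>\<^sub>E {..k - j}" "(\<Sum>m\<in>I. l m) = k - j"
      using a(3) by (auto simp: compositions_def)
    have "l i = undefined" using l I by (auto simp: PiE_def extensional_def)
    then show "(case case a of (j, l) \<Rightarrow> l(i := j) of l \<Rightarrow> (l i, l(i := undefined))) = a"
      by (auto simp: a)
    have "(\<Sum>m\<in>I. (l(i := j)) m) = (\<Sum>m\<in>I. l m)"
      using I by (intro sum.cong) auto
    then have "(\<Sum>m\<in>insert i I. (l(i := j)) m) = k"
      using I l a by simp
    moreover have "l(i := j) \<in> insert i I \<rightarrow>\<^sub>E {..k}"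
    proof (rule PiE_I)
      fix x assume "x \<in> insert i I"
      then show "(l(i := j)) x \<in> {..k}"
        using a l(1) PiE_mem[OF l(1), of x] by (cases "x = i") auto
    next
      fix x assume "x \<notin> insert i I"
      then show "(l(i := j)) x = undefined"
        using l(1) by (auto simp: PiE_def extensional_def)
    qed
    ultimately show "(case a of (j, l) \<Rightarrow> l(i := j)) \<in> compositions (insert i I) k"
      by (simp add: a compositions_def)
    show "f (case a of (j, l) \<Rightarrow> l(i := j)) = (case a of (j, l) \<Rightarrow> f (l(i := j)))"
      by (simp add: a)
  next
    fix l assume "l \<in> compositions (insert i I) k"
    then have l: "l \<in> insert i I \<rightarrow>\<^sub>E {..k}" "(\<Sum>m\<in>insert i I. l m) = k"
      by (auto simp: compositions_def)
    show "(case (l i, l(i := undefined)) of (j, l) \<Rightarrow> l(i := j)) = l" by simp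
    have s: "l i + (\<Sum>m\<in>I. l m) = k" using l(2) I by simp
    have s': "(\<Sum>m\<in>I. (l(i := undefined)) m) = (\<Sum>m\<in>I. l m)"
      using I by (intro sum.cong) auto
    have "l(i := undefined) \<in> I \<rightarrow>\<^sub>E {..k - l i}"
    proof (rule PiE_I)
      fix x assume x: "x \<in> I"
      then have "l x \<le> (\<Sum>m\<in>I. l m)" using I by (intro member_le_sum) auto
      then show "(l(i := undefined)) x \<in> {..k - l i}" using s x I by auto
    next
      fix x assume "x \<notin> I"
      then show "(l(i := undefined)) x = undefined"
        using l(1) by (auto simp: PiE_def extensional_def)
    qed
    then show "(l i, l(i := undefined)) \<in> (SIGMA j:{..k}. compositions I (k - j))"
      using s s' by (auto simp: compositions_def)
  qed
  finally show ?thesis ..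
qed

text \<open>After division by (k!)^2 the squared multinomial coefficients factor over the parts, so
  adding one coordinate is the convolution of \<open>angle_moment_recurrence\<close>, matched with
  \<open>sum_compositions_insert\<close>.\<close>

lemma integral_torus_moment:
  assumes "finite I"
  shows "(LINT \<theta>|torus I. cmod (rotated_sum I W \<theta>) ^ (2 * k) / (fact k)\<^sup>2) =
    (\<Sum>l\<in>compositions I k. \<Prod>m\<in>I. cmod (W m) ^ (2 * l m) / (fact (l m))\<^sup>2)"
  using assms
proof (induction I arbitrary: k)
  case empty
  then show ?case
    using prob_space.prob_space[OF prob_space_torus, of "{}"]
    by (auto simp: rotated_sum_def compositions_empty)
next
  case (insert i I)
  have int: "integrable (torus J) (\<lambda>\<theta>. cmod (rotated_sum J W \<theta>) ^ (2 * k) / (fact k)\<^sup>2)" for J k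
  proof (rule integrable_torus_bounded)
    show "(\<lambda>\<theta>. cmod (rotated_sum J W \<theta>) ^ (2 * k) / (fact k)\<^sup>2) \<in> borel_measurable (torus J)"
      by measurable
    show "\<bar>cmod (rotated_sum J W \<theta>) ^ (2 * k) / (fact k)\<^sup>2\<bar> \<le> (\<Sum>m\<in>J. cmod (W m)) ^ (2 * k) / (fact k)\<^sup>2" for \<theta>
      by (auto intro!: divide_right_mono power_mono cmod_rotated_sum_le)
  qed
  have "(LINT \<theta>|torus (insert i I). cmod (rotated_sum (insert i I) W \<theta>) ^ (2 * k) / (fact k)\<^sup>2) =
      (LINT \<theta>|torus I. LINT y|unif_angle. cmod (rotated_sum (insert i I) W (\<theta>(i := y))) ^ (2 * k) / (fact k)\<^sup>2)"
    by (intro torus.product_integral_insert insert.hyps int)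
  also have "\<dots> = (LINT \<theta>|torus I. (\<Sum>j\<le>k. cmod (W i) ^ (2 * j) / (fact j)\<^sup>2 *
      (cmod (rotated_sum I W \<theta>) ^ (2 * (k - j)) / (fact (k - j))\<^sup>2)))"
    unfolding rotated_sum_insert[OF insert.hyps] angle_moment_recurrence ..
  also have "\<dots> = (\<Sum>j\<le>k. cmod (W i) ^ (2 * j) / (fact j)\<^sup>2 *
      (LINT \<theta>|torus I. cmod (rotated_sum I W \<theta>) ^ (2 * (k - j)) / (fact (k - j))\<^sup>2))"
    by (subst Bochner_Integration.integral_sum) (intro integrable_mult_right int, simp)
  also have "\<dots> = (\<Sum>j\<le>k. \<Sum>l\<in>compositions I (k - j).
      \<Prod>m\<in>insert i I. cmod (W m) ^ (2 * (l(i := j)) m) / (fact ((l(i := j)) m))\<^sup>2)"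
    unfolding insert.IH sum_distrib_left
  proof (intro sum.cong refl, goal_cases)
    case (1 j l)
    have "(\<Prod>m\<in>I. cmod (W m) ^ (2 * (l(i := j)) m) / (fact ((l(i := j)) m))\<^sup>2) =
        (\<Prod>m\<in>I. cmod (W m) ^ (2 * l m) / (fact (l m))\<^sup>2)"
      using insert.hyps by (intro prod.cong) auto
    then show ?case using insert.hyps by simp
  qed
  also have "\<dots> = (\<Sum>l\<in>compositions (insert i I) k. \<Prod>m\<in>insert i I. cmod (W m) ^ (2 * l m) / (fact (l m))\<^sup>2)"
    by (rule sum_compositions_insert[OF insert.hyps, symmetric])
  finally show ?case .
qed

lemma integral_torus_power_eq_a_coeff:
  "(LINT \<theta>|torus {..n}. cmod (rotated_sum {..n} W \<theta>) ^ (2 * k)) = a_coeff n k W"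
proof -
  have "(LINT \<theta>|torus {..n}. cmod (rotated_sum {..n} W \<theta>) ^ (2 * k)) / (fact k)\<^sup>2 =
    (\<Sum>l\<in>compositions {..n} k. \<Prod>m\<le>n. cmod (W m) ^ (2 * l m) / (fact (l m))\<^sup>2)"
    using integral_torus_moment[of "{..n}" W k] by simp
  then have "(LINT \<theta>|torus {..n}. cmod (rotated_sum {..n} W \<theta>) ^ (2 * k)) =
    (fact k)\<^sup>2 * (\<Sum>l\<in>compositions {..n} k. \<Prod>m\<le>n. cmod (W m) ^ (2 * l m) / (fact (l m))\<^sup>2)"
    by (simp add: field_simps)
  also have "\<dots> = a_coeff n k W"
    unfolding a_coeff_def compositions_def sum_distrib_left
    by (intro sum.cong refl) (simp add: prod_dividef power_divide prod_power_distrib)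
  finally show ?thesis .
qed

text \<open>A product measure is determined by its values on boxes, where the integral of the
  product density factors. This identifies \<open>torus\<close> with normalised Lebesgue measure on
  a cube, as in \<open>log_mahler_measure\<close>.\<close>

lemma PiM_density:
  assumes "finite I" and f: "\<And>i. i \<in> I \<Longrightarrow> f i \<in> borel_measurable lborel"
    and sf: "\<And>i. sigma_finite_measure (density lborel (f i))"
  shows "(\<Pi>\<^sub>M i\<in>I. density lborel (f i)) = density (\<Pi>\<^sub>M i\<in>I. lborel) (\<lambda>x. \<Prod>i\<in>I. f i (x i :: real))"
proof -
  interpret D: product_sigma_finite "\<lambda>i. density lborel (f i)"
    using sf by (simp add: product_sigma_finite_def)
  interpret L: product_sigma_finite "\<lambda>i. lborel :: real measure"
    by standard
  have [measurable]: "(\<lambda>x. \<Prod>i\<in>I. f i (x i)) \<in> borel_measurable (\<Pi>\<^sub>M i\<in>I. lborel)"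
    by (intro borel_measurable_prod_ennreal measurable_compose[OF _ f] measurable_component_singleton)
  show ?thesis
  proof (rule D.PiM_eqI[OF assms(1), symmetric])
    show "sets (density (\<Pi>\<^sub>M i\<in>I. lborel) (\<lambda>x. \<Prod>i\<in>I. f i (x i))) = sets (\<Pi>\<^sub>M i\<in>I. density lborel (f i))"
      by (auto intro!: sets_PiM_cong)
    fix A assume A: "\<And>i. i \<in> I \<Longrightarrow> A i \<in> sets (density lborel (f i))"
    have "emeasure (density (\<Pi>\<^sub>M i\<in>I. lborel) (\<lambda>x. \<Prod>i\<in>I. f i (x i))) (Pi\<^sub>E I A) =
        (\<integral>\<^sup>+ x. (\<Prod>i\<in>I. f i (x i)) * indicator (Pi\<^sub>E I A) x \<partial>(\<Pi>\<^sub>M i\<in>I. lborel))"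
      using A assms(1) by (intro emeasure_density) (auto intro!: sets_PiM_I_finite)
    also have "\<dots> = (\<integral>\<^sup>+ x. (\<Prod>i\<in>I. f i (x i) * indicator (A i) (x i)) \<partial>(\<Pi>\<^sub>M i\<in>I. lborel))"
    proof (intro nn_integral_cong)
      fix x :: "'a \<Rightarrow> real" assume "x \<in> space (\<Pi>\<^sub>M i\<in>I. lborel)"
      then have "indicator (Pi\<^sub>E I A) x = (\<Prod>i\<in>I. indicator (A i) (x i) :: ennreal)"
        using assms(1) by (auto simp: space_PiM PiE_def Pi_def indicator_def prod.If_cases)
      then show "(\<Prod>i\<in>I. f i (x i)) * indicator (Pi\<^sub>E I A) x = (\<Prod>i\<in>I. f i (x i) * indicator (A i) (x i))"
        by (simp add: prod.distrib)
    qed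
    also have "\<dots> = (\<Prod>i\<in>I. \<integral>\<^sup>+ x. f i x * indicator (A i) x \<partial>lborel)"
      using A f assms(1) by (intro L.product_nn_integral_prod) auto
    also have "\<dots> = (\<Prod>i\<in>I. emeasure (density lborel (f i)) (A i))"
      using A f by (intro prod.cong refl) (simp add: emeasure_density)
    finally show "emeasure (density (\<Pi>\<^sub>M i\<in>I. lborel) (\<lambda>x. \<Prod>i\<in>I. f i (x i))) (Pi\<^sub>E I A) =
      (\<Prod>i\<in>I. emeasure (density lborel (f i)) (A i))" .
  qed
qed

lemma integral_torus_eq_set_integral:
  fixes f :: "(nat \<Rightarrow> real) \<Rightarrow> real"
  assumes [measurable]: "f \<in> borel_measurable (torus {..<q})"
  shows "(LINT \<theta>|torus {..<q}. f \<theta>) =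
    1 / (2 * pi) ^ q * (LINT \<theta> : ({..<q} \<rightarrow>\<^sub>E {0..2 * pi}) | (\<Pi>\<^sub>M m\<in>{..<q}. lborel). f \<theta>)"
proof -
  have sets_eq: "sets (torus {..<q}) = sets (\<Pi>\<^sub>M m\<in>{..<q}. (lborel :: real measure))"
    by (intro sets_PiM_cong) auto
  have f: "f \<in> borel_measurable (\<Pi>\<^sub>M m\<in>{..<q}. lborel)"
    using assms measurable_cong_sets[OF sets_eq refl] by blast
  have "torus {..<q} = density (\<Pi>\<^sub>M m\<in>{..<q}. lborel)
      (\<lambda>x. \<Prod>i<q. ennreal (indicator {0..2 * pi} (x i) / (2 * pi)))"
    unfolding unif_angle_eq_density
    by (intro PiM_density)
       (auto simp flip: unif_angle_eq_density intro: prob_space_imp_sigma_finite unif_angle.prob_space_axioms)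
  then have "(LINT \<theta>|torus {..<q}. f \<theta>) =
      (LINT \<theta>|density (\<Pi>\<^sub>M m\<in>{..<q}. lborel) (\<lambda>x. ennreal (\<Prod>i<q. indicator {0..2 * pi} (x i) / (2 * pi))). f \<theta>)"
    by (simp add: prod_ennreal)
  also have "\<dots> = (LINT x|(\<Pi>\<^sub>M m\<in>{..<q}. lborel). (\<Prod>i<q. indicator {0..2 * pi} (x i) / (2 * pi)) *\<^sub>R f x)"
    by (intro integral_density f borel_measurable_prod AE_I2) (auto intro!: prod_nonneg)
  also have "\<dots> = (LINT x|(\<Pi>\<^sub>M m\<in>{..<q}. lborel). (1 / (2 * pi) ^ q) *\<^sub>R
      (indicator ({..<q} \<rightarrow>\<^sub>E {0..2 * pi}) x *\<^sub>R f x))"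
  proof (intro Bochner_Integration.integral_cong refl)
    fix x :: "nat \<Rightarrow> real" assume "x \<in> space (\<Pi>\<^sub>M m\<in>{..<q}. lborel)"
    then have "indicator ({..<q} \<rightarrow>\<^sub>E {0..2 * pi}) x = (\<Prod>i<q. indicator {0..2 * pi} (x i) :: real)"
      by (auto simp: space_PiM PiE_def Pi_def indicator_def prod.If_cases)
    then show "(\<Prod>i<q. indicator {0..2 * pi} (x i) / (2 * pi)) *\<^sub>R f x =
        (1 / (2 * pi) ^ q) *\<^sub>R (indicator ({..<q} \<rightarrow>\<^sub>E {0..2 * pi}) x *\<^sub>R f x)"
      by (simp add: prod_dividef)
  qed
  also have "\<dots> = 1 / (2 * pi) ^ q * (LINT \<theta> : ({..<q} \<rightarrow>\<^sub>E {0..2 * pi}) | (\<Pi>\<^sub>M m\<in>{..<q}. lborel). f \<theta>)"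
    unfolding set_lebesgue_integral_def by simp
  finally show ?thesis .
qed

lemma log_mahler_measure_linear_form:
  "log_mahler_measure (n + 1) (linear_form n W) =
    (LINT \<theta>|torus {..n}. ln (cmod (rotated_sum {..n} W \<theta>)))"
proof -
  have I: "{..n} = {..<n + 1}" by auto
  have "(LINT \<theta>|torus {..<n + 1}. ln (cmod (rotated_sum {..<n + 1} W \<theta>))) =
      log_mahler_measure (n + 1) (\<lambda>Z. \<Sum>m<n + 1. W m * Z m)"
    unfolding log_mahler_measure_def rotated_sum_def [symmetric]
    by (intro integral_torus_eq_set_integral) measurable
  then show ?thesis
    unfolding linear_form_def [abs_def] I by simp
qed

section \<open>The density of the linear form\<close>

text \<open>Weber's first exponential integral.\<close>
lemma integral_gaussian_bessel_J0:
  "(LINT t|lborel. indicator {0..} t * (t * exp (- t\<^sup>2) * bessel_J0 (t * w))) = exp (- w\<^sup>2 / 4) / 2"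
proof -
  define a where "a k = (- 1) ^ k / (fact k)\<^sup>2 * (w / 2) ^ (2 * k)" for k
  define g where "g k t = indicator {0..} t *\<^sub>R (exp (- t\<^sup>2) * t ^ (2 * k + 1))" for k and t :: real
  define f where "f k t = a k * g k t" for k t
  \<comment> \<open>The odd Gaussian moment k!/2 cancels one of the two factorials in the series of
    J0, so termwise integration leaves an exponential series.\<close>
  have g: "has_bochner_integral lborel (g k) (fact k / 2)" for k
    unfolding g_def by (rule gaussian_moment_odd_pos)
  have g_nonneg: "g k t \<ge> 0" for k t
    by (simp add: g_def split: split_indicator)
  have int: "integrable lborel (f k)" for k
    unfolding f_def using g[of k] by (intro integrable_mult_right) (simp add: has_bochner_integral_iff)
  have lint: "integral\<^sup>L lborel (f k) = a k * (fact k / 2)" for k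
    unfolding f_def using g[of k] by (simp add: has_bochner_integral_iff)
  have aeq: "a k * (fact k / 2) = ((- (w\<^sup>2 / 4)) ^ k /\<^sub>R fact k) / 2" for k
  proof -
    define q where "q = w\<^sup>2 / 4"
    have "(w / 2) ^ (2 * k) = q ^ k" by (simp add: q_def power_mult power_divide)
    then have "a k = (-1) ^ k * q ^ k / (fact k * fact k)"
      by (simp add: a_def power2_eq_square)
    moreover have "(- q) ^ k = (-1) ^ k * q ^ k" by (rule power_minus)
    ultimately show ?thesis
      unfolding q_def [symmetric] by (simp add: divide_simps)
  qed
  have sums: "(\<lambda>k. f k t) sums (indicator {0..} t * (t * exp (- t\<^sup>2) * bessel_J0 (t * w)))" for t
  proof -
    have "(\<lambda>k. (indicator {0..} t * (t * exp (- t\<^sup>2))) * ((- 1) ^ k / (fact k)\<^sup>2 * (t * w / 2) ^ (2 * k))) sums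
        ((indicator {0..} t * (t * exp (- t\<^sup>2))) * bessel_J0 (t * w))"
      by (intro sums_mult bessel_J0_sums)
    moreover have "(indicator {0..} t * (t * exp (- t\<^sup>2))) * ((- 1) ^ k / (fact k)\<^sup>2 * (t * w / 2) ^ (2 * k)) = f k t" for k
      by (simp add: f_def a_def g_def power_mult_distrib power_divide)
    ultimately show ?thesis by (simp add: mult.assoc)
  qed
  have "(\<lambda>k. integral\<^sup>L lborel (f k)) sums (LINT t|lborel. (\<Sum>k. f k t))"
  proof (rule sums_integral[OF int])
    show "AE t in lborel. summable (\<lambda>k. norm (f k t))"
    proof (intro always_eventually allI)
      fix t :: real
      have "summable (\<lambda>k. \<bar>indicator {0..} t * (t * exp (- t\<^sup>2))\<bar> * norm ((- 1) ^ k / (fact k)\<^sup>2 * (t * w / 2) ^ (2 * k)))"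
        by (intro summable_mult summable_bessel_J0)
      moreover have "\<bar>indicator {0..} t * (t * exp (- t\<^sup>2))\<bar> * norm ((- 1) ^ k / (fact k)\<^sup>2 * (t * w / 2) ^ (2 * k)) = norm (f k t)" for k
        by (simp add: f_def a_def g_def power_mult_distrib power_divide abs_mult)
      ultimately show "summable (\<lambda>k. norm (f k t))" by simp
    qed
    have "(LINT t|lborel. norm (f k t)) = norm (a k * (fact k / 2))" for k
    proof -
      have "norm (f k t) = \<bar>a k\<bar> * g k t" for t
        using g_nonneg[of k t] by (simp add: f_def abs_mult)
      then have "(LINT t|lborel. norm (f k t)) = \<bar>a k\<bar> * (fact k / 2)"
        using g[of k] by (simp add: has_bochner_integral_iff)
      then show ?thesis by (simp add: abs_mult)
    qed
    moreover have "summable (\<lambda>k. norm (a k * (fact k / 2)))"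
      unfolding aeq norm_divide by (intro summable_divide summable_norm_exp)
    ultimately show "summable (\<lambda>k. LINT t|lborel. norm (f k t))" by (simp only:)
  qed
  moreover have "(\<lambda>k. integral\<^sup>L lborel (f k)) sums (exp (- (w\<^sup>2 / 4)) / 2)"
    unfolding lint aeq by (intro sums_divide exp_converges)
  moreover have "(\<Sum>k. f k t) = indicator {0..} t * (t * exp (- t\<^sup>2) * bessel_J0 (t * w))" for t
    using sums by (rule sums_unique[symmetric])
  ultimately show ?thesis by (simp add: sums_iff)
qed

text \<open>The disc of radius sqrt a has area pi a. In the variable |z|^2 polar coordinates thus
  have a constant Jacobian, and the open initial segments suffice as a generator closed under
  intersection.\<close>

lemma distr_cmod_square:
  "distr lborel borel (\<lambda>z. (cmod z)\<^sup>2) = density lborel (\<lambda>u. ennreal (pi * indicator {0..} u))"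
proof (rule measure_eqI_generator_eq[where E = "range lessThan" and \<Omega> = UNIV and A = "\<lambda>n. {..<real n}"])
  show "Int_stable (range lessThan :: real set set)"
  proof (rule Int_stableI)
    fix a b :: "real set" assume "a \<in> range lessThan" "b \<in> range lessThan"
    then obtain x y where "a = {..<x}" "b = {..<y}" by auto
    then have "a \<inter> b = {..<min x y}" by auto
    then show "a \<inter> b \<in> range lessThan" by blast
  qed
  have sets_borel: "sets (borel :: real measure) = sigma_sets UNIV (range lessThan)"
    by (subst borel_Iio) simp
  show "sets (distr lborel borel (\<lambda>z. (cmod z)\<^sup>2)) = sigma_sets UNIV (range lessThan)"
    by (simp add: sets_borel)
  show "sets (density lborel (\<lambda>u :: real. ennreal (pi * indicator {0..} u))) = sigma_sets UNIV (range lessThan)"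
    by (simp add: sets_borel)
  show "(\<Union>n. {..<real n}) = UNIV"
    by (auto intro: reals_Archimedean2)
  have *: "emeasure (distr lborel borel (\<lambda>z. (cmod z)\<^sup>2)) {..<a} = ennreal (pi * max 0 a)" for a :: real
  proof -
    have "{z. (cmod z)\<^sup>2 < a} = ball 0 (sqrt (max 0 a))"
    proof (cases "a \<le> 0")
      case True
      then show ?thesis by (auto simp: not_less intro: order_trans)
    next
      case False
      then show ?thesis by (auto simp: real_less_lsqrt abs_square_less_1 intro: real_less_rsqrt)
          (metis real_sqrt_less_iff real_sqrt_abs abs_norm_cancel)
    qed
    then show ?thesis
      by (simp add: emeasure_distr vimage_def emeasure_ball unit_ball_vol_2)
  qed
  then show "emeasure (distr lborel borel (\<lambda>z. (cmod z)\<^sup>2)) {..<real n} \<noteq> \<infinity>" for n by simp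
  fix X :: "real set" assume "X \<in> range lessThan"
  then obtain a where X: "X = {..<a}" by auto
  have "emeasure (density lborel (\<lambda>u :: real. ennreal (pi * indicator {0..} u))) {..<a} =
      (\<integral>\<^sup>+ u. ennreal pi * indicator {0..<max 0 a} u \<partial>lborel)"
    by (subst emeasure_density) (auto intro!: nn_integral_cong split: split_indicator)
  also have "\<dots> = ennreal (pi * max 0 a)"
    by (subst nn_integral_cmult_indicator) (auto simp: ennreal_mult)
  finally show "emeasure (distr lborel borel (\<lambda>z. (cmod z)\<^sup>2)) X =
      emeasure (density lborel (\<lambda>u :: real. ennreal (pi * indicator {0..} u))) X"
    using * by (simp add: X)
qed auto

lemma nn_integral_cmod_square:
  assumes [measurable]: "f \<in> borel_measurable borel"
  shows "(\<integral>\<^sup>+ z. f ((cmod z)\<^sup>2) \<partial>lborel) = (\<integral>\<^sup>+ u. ennreal (pi * indicator {0..} u) * f u \<partial>lborel)"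
proof -
  have "(\<integral>\<^sup>+ z. f ((cmod z)\<^sup>2) \<partial>lborel) = (\<integral>\<^sup>+ u. f u \<partial>distr lborel borel (\<lambda>z. (cmod z)\<^sup>2))"
    by (subst nn_integral_distr) auto
  also have "\<dots> = (\<integral>\<^sup>+ u. ennreal (pi * indicator {0..} u) * f u \<partial>lborel)"
    unfolding distr_cmod_square by (subst nn_integral_density) auto
  finally show ?thesis .
qed

text \<open>The total mass 2 pi of the kernel from Weber's integral; it is the normalisation between
  \<open>radial_density\<close> and a density of Z.\<close>

lemma nn_integral_gaussian_plane:
  "(\<integral>\<^sup>+ w. ennreal (exp (- (cmod w)\<^sup>2 / 4) / 2) \<partial>lborel) = ennreal (2 * pi)"
proof -
  have "(\<integral>\<^sup>+ w. ennreal (exp (- (cmod w)\<^sup>2 / 4) / 2) \<partial>lborel) =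
      (\<integral>\<^sup>+ u. ennreal (pi * indicator {0..} u) * ennreal (exp (- u / 4) / 2) \<partial>lborel)"
    by (subst nn_integral_cmod_square[symmetric]) auto
  also have "\<dots> = (\<integral>\<^sup>+ u\<in>{0..}. ennreal (pi / 2 * exp (- u / 4)) \<partial>lborel)"
    by (intro nn_integral_cong) (auto split: split_indicator simp flip: ennreal_mult)
  also have "\<dots> = ennreal (0 - (- 2 * pi * exp (- 0 / 4)))"
  proof (rule nn_integral_FTC_atLeast)
    show "((\<lambda>u. - 2 * pi * exp (- u / 4)) \<longlongrightarrow> 0) at_top" by real_asymp
    show "((\<lambda>u. - 2 * pi * exp (- u / 4)) has_real_derivative pi / 2 * exp (- u / 4)) (at u)" for u
      by (auto intro!: derivative_eq_intros)
  qed auto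
  finally show ?thesis by simp
qed

lemma nn_integral_complex_affine:
  assumes [measurable]: "f \<in> borel_measurable borel" and h: "h > 0"
  shows "(\<integral>\<^sup>+ z. f z \<partial>lborel) = ennreal (h\<^sup>2) * (\<integral>\<^sup>+ w. f (a + h *\<^sub>R (w :: complex)) \<partial>lborel)"
proof -
  have "(\<integral>\<^sup>+ z. f z \<partial>lborel) =
      (\<integral>\<^sup>+ z. f z \<partial>density (distr lborel borel (\<lambda>w. a + h *\<^sub>R w)) (\<lambda>_. ennreal (\<bar>h\<bar> ^ DIM(complex))))"
    using h by (subst lborel_affine[of h a]) auto
  also have "\<dots> = (\<integral>\<^sup>+ w. ennreal (h\<^sup>2) * f (a + h *\<^sub>R w) \<partial>lborel)"
    by (subst nn_integral_density) (auto simp: nn_integral_distr)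
  also have "\<dots> = ennreal (h\<^sup>2) * (\<integral>\<^sup>+ w. f (a + h *\<^sub>R w) \<partial>lborel)"
    by (rule nn_integral_cmult) measurable
  finally show ?thesis .
qed

text \<open>Without integrability the left side is the default value 0, so the bound holds for every
  function.\<close>

lemma ennreal_integral_le:
  fixes f :: "'a \<Rightarrow> real"
  shows "ennreal (integral\<^sup>L M f) \<le> (\<integral>\<^sup>+ x. norm (f x) \<partial>M)"
proof (cases "integrable M f")
  case True
  have "ennreal (integral\<^sup>L M f) \<le> ennreal (norm (integral\<^sup>L M f))"
    by (intro ennreal_leI) simp
  also have "\<dots> \<le> (\<integral>\<^sup>+ x. norm (f x) \<partial>M)"
    by (rule integral_norm_bound_ennreal[OF True])
  finally show ?thesis .
qed (simp add: not_integrable_integral_eq)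

text \<open>The Hankel inversion integral for 2 pi times the density of the linear form at distance
  \<open>r\<close> from 0, with absolute values inside and taken in [0, infinity], so that it is an
  upper bound whether or not it converges.\<close>

definition radial_density :: "nat set \<Rightarrow> (nat \<Rightarrow> complex) \<Rightarrow> real \<Rightarrow> ennreal" where
  "radial_density I W r =
    (\<integral>\<^sup>+ t\<in>{0..}. ennreal (t * \<bar>bessel_J0 (t * r)\<bar> * (\<Prod>m\<in>I. \<bar>bessel_J0 (t * cmod (W m))\<bar>)) \<partial>lborel)"

lemma borel_measurable_radial_density [measurable]: "radial_density I W \<in> borel_measurable borel"
  unfolding radial_density_def by measurable

text \<open>Weber's integral writes the Gaussian as a superposition of J0(t|Z - z|/h); after the
  exchange of integrals the average over the phases factors into J0 values. Then exp(-t^2) is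
  bounded by 1, and the substitution t = h s produces the factor h^2.\<close>

lemma gaussian_average_le_radial_density:
  assumes I: "finite I" and h: "h > 0"
  shows "(\<integral>\<^sup>+ \<theta>. ennreal (exp (- (cmod (rotated_sum I W \<theta> - z) / h)\<^sup>2 / 4) / 2) \<partial>torus I) \<le>
    ennreal (h\<^sup>2) * radial_density I W (cmod z)"
proof -
  interpret T: prob_space "torus I" by (rule prob_space_torus)
  interpret P: pair_sigma_finite "torus I" "lborel :: real measure" by standard
  define g where "g t = indicator {0..} t * (t * exp (- t\<^sup>2))" for t :: real
  have [measurable]: "g \<in> borel_measurable borel" unfolding g_def by measurable
  have g_nonneg: "g t \<ge> 0" for t by (simp add: g_def split: split_indicator)
  have g_int: "integrable lborel g"
    using gaussian_moment_odd_pos[of 0] by (simp add: g_def [abs_def] has_bochner_integral_iff mult.commute)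
  define F where "F \<theta> t = g t * bessel_J0 (t * (cmod (rotated_sum I W \<theta> - z) / h))" for \<theta> t
  have F_le: "norm (F \<theta> t) \<le> g t" for \<theta> t
  proof -
    have "g t * \<bar>bessel_J0 (t * (cmod (rotated_sum I W \<theta> - z) / h))\<bar> \<le> g t * 1"
      by (intro mult_left_mono abs_bessel_J0_le_1 g_nonneg)
    then show ?thesis by (simp add: F_def abs_mult g_nonneg)
  qed
  have [measurable]: "case_prod F \<in> borel_measurable (torus I \<Otimes>\<^sub>M lborel)"
    unfolding F_def by measurable
  \<comment> \<open>The factor t exp(-t^2) is integrable and |J0| <= 1, so Fubini is legitimate even
    where \<open>radial_density\<close> is infinite.\<close>
  have F_int: "integrable (torus I \<Otimes>\<^sub>M lborel) (case_prod F)"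
  proof (rule P.Fubini_integrable)
    have F_int': "integrable lborel (F \<theta>)" for \<theta>
      by (rule Bochner_Integration.integrable_bound[OF g_int])
         (use F_le g_nonneg in \<open>auto simp: F_def [abs_def]\<close>)
    then show "AE \<theta> in torus I. integrable lborel (\<lambda>t. case_prod F (\<theta>, t))"
      by (intro AE_I2) simp
    show "integrable (torus I) (\<lambda>\<theta>. LINT t|lborel. norm (case_prod F (\<theta>, t)))"
    proof (rule integrable_torus_bounded[where B = "integral\<^sup>L lborel g"])
      fix \<theta>
      have "(LINT t|lborel. norm (F \<theta> t)) \<le> integral\<^sup>L lborel g"
        by (intro integral_mono integrable_norm F_int' g_int F_le)
      then show "\<bar>LINT t|lborel. norm (case_prod F (\<theta>, t))\<bar> \<le> integral\<^sup>L lborel g"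
        by (simp add: Bochner_Integration.integral_nonneg)
    qed measurable
  qed measurable
  have "(LINT \<theta>|torus I. exp (- (cmod (rotated_sum I W \<theta> - z) / h)\<^sup>2 / 4) / 2) =
      (LINT \<theta>|torus I. LINT t|lborel. F \<theta> t)"
    unfolding F_def g_def integral_gaussian_bessel_J0 [symmetric] by (simp add: mult.assoc)
  also have "\<dots> = (LINT t|lborel. LINT \<theta>|torus I. F \<theta> t)"
    using P.Fubini_integral[OF F_int] by simp
  also have "\<dots> = (LINT t|lborel. g t * (bessel_J0 (t / h * cmod z) * (\<Prod>m\<in>I. bessel_J0 (t / h * cmod (W m)))))"
  proof (intro Bochner_Integration.integral_cong refl)
    fix t
    have "(LINT \<theta>|torus I. F \<theta> t) = g t * (LINT \<theta>|torus I. bessel_J0 (t / h * cmod (- z + rotated_sum I W \<theta>)))"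
      by (simp add: F_def)
    then show "(LINT \<theta>|torus I. F \<theta> t) = g t * (bessel_J0 (t / h * cmod z) * (\<Prod>m\<in>I. bessel_J0 (t / h * cmod (W m))))"
      unfolding integral_torus_bessel_J0[OF I] by simp
  qed
  finally have eq: "(LINT \<theta>|torus I. exp (- (cmod (rotated_sum I W \<theta> - z) / h)\<^sup>2 / 4) / 2) =
    (LINT t|lborel. g t * (bessel_J0 (t / h * cmod z) * (\<Prod>m\<in>I. bessel_J0 (t / h * cmod (W m)))))" .
  have "(\<integral>\<^sup>+ \<theta>. ennreal (exp (- (cmod (rotated_sum I W \<theta> - z) / h)\<^sup>2 / 4) / 2) \<partial>torus I) =
      ennreal (LINT \<theta>|torus I. exp (- (cmod (rotated_sum I W \<theta> - z) / h)\<^sup>2 / 4) / 2)"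
    by (intro nn_integral_eq_integral integrable_torus_bounded[of _ _ "1 / 2"]) auto
  also have "\<dots> \<le> (\<integral>\<^sup>+ t. norm (g t * (bessel_J0 (t / h * cmod z) * (\<Prod>m\<in>I. bessel_J0 (t / h * cmod (W m))))) \<partial>lborel)"
    unfolding eq by (rule ennreal_integral_le)
  also have "\<dots> \<le> (\<integral>\<^sup>+ t. ennreal (t * \<bar>bessel_J0 (t / h * cmod z)\<bar> * (\<Prod>m\<in>I. \<bar>bessel_J0 (t / h * cmod (W m))\<bar>)) * indicator {0..} t \<partial>lborel)"
  proof (intro nn_integral_mono)
    fix t :: real
    define Q where "Q = \<bar>bessel_J0 (t / h * cmod z)\<bar> * (\<Prod>m\<in>I. \<bar>bessel_J0 (t / h * cmod (W m))\<bar>)"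
    have "Q \<ge> 0" unfolding Q_def by (intro mult_nonneg_nonneg prod_nonneg) auto
    have "exp (- t\<^sup>2) \<le> 1" by simp
    then have "t \<ge> 0 \<Longrightarrow> t * exp (- t\<^sup>2) * Q \<le> t * 1 * Q"
      using \<open>Q \<ge> 0\<close> by (intro mult_right_mono mult_left_mono) auto
    then show "ennreal (norm (g t * (bessel_J0 (t / h * cmod z) * (\<Prod>m\<in>I. bessel_J0 (t / h * cmod (W m)))))) \<le>
        ennreal (t * \<bar>bessel_J0 (t / h * cmod z)\<bar> * (\<Prod>m\<in>I. \<bar>bessel_J0 (t / h * cmod (W m))\<bar>)) * indicator {0..} t"
      by (auto simp: g_def abs_mult abs_prod Q_def mult.assoc split: split_indicator intro!: ennreal_leI)
  qed
  also have "\<dots> = ennreal \<bar>h\<bar> * (\<integral>\<^sup>+ s. ennreal ((0 + h * s) * \<bar>bessel_J0 ((0 + h * s) / h * cmod z)\<bar> *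
      (\<Prod>m\<in>I. \<bar>bessel_J0 ((0 + h * s) / h * cmod (W m))\<bar>)) * indicator {0..} (0 + h * s) \<partial>lborel)"
    using h by (intro nn_integral_real_affine) auto
  also have "\<dots> = ennreal h * (\<integral>\<^sup>+ s. ennreal h * (ennreal (s * \<bar>bessel_J0 (s * cmod z)\<bar> *
      (\<Prod>m\<in>I. \<bar>bessel_J0 (s * cmod (W m))\<bar>)) * indicator {0..} s) \<partial>lborel)"
  proof -
    have "ennreal ((0 + h * s) * \<bar>bessel_J0 ((0 + h * s) / h * cmod z)\<bar> *
        (\<Prod>m\<in>I. \<bar>bessel_J0 ((0 + h * s) / h * cmod (W m))\<bar>)) * indicator {0..} (0 + h * s) =
      ennreal h * (ennreal (s * \<bar>bessel_J0 (s * cmod z)\<bar> * (\<Prod>m\<in>I. \<bar>bessel_J0 (s * cmod (W m))\<bar>)) * indicator {0..} s)" for s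
    proof (cases "s \<ge> 0")
      case True
      then show ?thesis
        using h by (simp add: ennreal_mult [symmetric] prod_nonneg mult.assoc)
    next
      case False
      then have "h * s < 0" using h by (simp add: mult_pos_neg)
      then show ?thesis using False by simp
    qed
    then show ?thesis using h by simp
  qed
  also have "\<dots> = ennreal (h\<^sup>2) * radial_density I W (cmod z)"
    unfolding radial_density_def using h
    by (subst nn_integral_cmult) (auto simp: power2_eq_square ennreal_mult mult.assoc)
  finally show ?thesis .
qed

text \<open>For Z in an open set, the mass that a narrowing Gaussian centred at Z gives to the set
  tends to the full 2 pi. Fatou's lemma, once in the plane and once on the torus, turns the smoothed
  bound of each width into a bound for the law itself.\<close>

lemma emeasure_rotated_sum_open_le:
  assumes I: "finite I" and A: "open A"
  shows "ennreal (2 * pi) * emeasure (distr (torus I) borel (rotated_sum I W)) A \<le>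
    (\<integral>\<^sup>+ z\<in>A. radial_density I W (cmod z) \<partial>lborel)"
proof -
  interpret T: prob_space "torus I" by (rule prob_space_torus)
  interpret P: pair_sigma_finite "torus I" "lborel :: complex measure" by standard
  have [measurable]: "A \<in> sets borel" using A by simp
  define h where "h i = 1 / real (Suc i)" for i
  have h: "h i > 0" for i by (simp add: h_def)
  have h_lim: "h \<longlonglongrightarrow> 0" unfolding h_def by real_asymp
  let ?Z = "rotated_sum I W"
  \<comment> \<open>The Gaussian mass of \<open>A\<close> around Z at width \<open>h i\<close>, in
    the rescaled variable w; the kernel no longer depends on \<open>i\<close>, so the limit only
    concerns the indicator, which is eventually 1 because \<open>A\<close> is open.\<close>
  define \<Phi> where "\<Phi> i \<theta> = (\<integral>\<^sup>+ w. indicator A (?Z \<theta> + h i *\<^sub>R w) * ennreal (exp (- (cmod w)\<^sup>2 / 4) / 2) \<partial>lborel)" for i \<theta>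
  have \<Phi>_meas [measurable]: "\<Phi> i \<in> borel_measurable (torus I)" for i
    unfolding \<Phi>_def by measurable
  have "(\<integral>\<^sup>+ \<theta>. \<Phi> i \<theta> \<partial>torus I) \<le> (\<integral>\<^sup>+ z\<in>A. radial_density I W (cmod z) \<partial>lborel)" for i
  proof -
    define E where "E \<theta> z = ennreal (exp (- (cmod (?Z \<theta> - z) / h i)\<^sup>2 / 4) / 2)" for \<theta> z
    have [measurable]: "(\<lambda>(\<theta>, z). E \<theta> z) \<in> borel_measurable (torus I \<Otimes>\<^sub>M lborel)"
      unfolding E_def by measurable
    have "ennreal ((h i)\<^sup>2) * \<Phi> i \<theta> = (\<integral>\<^sup>+ z. indicator A z * E \<theta> z \<partial>lborel)" for \<theta>
    proof -
      have "(\<integral>\<^sup>+ z. indicator A z * E \<theta> z \<partial>lborel) =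
          ennreal ((h i)\<^sup>2) * (\<integral>\<^sup>+ w. indicator A (?Z \<theta> + h i *\<^sub>R w) * E \<theta> (?Z \<theta> + h i *\<^sub>R w) \<partial>lborel)"
        by (intro nn_integral_complex_affine h) (unfold E_def, measurable)
      moreover have "E \<theta> (?Z \<theta> + h i *\<^sub>R w) = ennreal (exp (- (cmod w)\<^sup>2 / 4) / 2)" for w
        using h[of i] by (simp add: E_def)
      ultimately show ?thesis by (simp add: \<Phi>_def)
    qed
    then have "ennreal ((h i)\<^sup>2) * (\<integral>\<^sup>+ \<theta>. \<Phi> i \<theta> \<partial>torus I) = (\<integral>\<^sup>+ \<theta>. (\<integral>\<^sup>+ z. indicator A z * E \<theta> z \<partial>lborel) \<partial>torus I)"
      by (simp flip: nn_integral_cmult)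
    also have "\<dots> = (\<integral>\<^sup>+ z. (\<integral>\<^sup>+ \<theta>. indicator A z * E \<theta> z \<partial>torus I) \<partial>lborel)"
      by (rule P.Fubini'[symmetric]) measurable
    also have "\<dots> = (\<integral>\<^sup>+ z. indicator A z * (\<integral>\<^sup>+ \<theta>. E \<theta> z \<partial>torus I) \<partial>lborel)"
      by (intro nn_integral_cong nn_integral_cmult) (unfold E_def, measurable)
    also have "\<dots> \<le> (\<integral>\<^sup>+ z. indicator A z * (ennreal ((h i)\<^sup>2) * radial_density I W (cmod z)) \<partial>lborel)"
      unfolding E_def by (intro nn_integral_mono mult_left_mono gaussian_average_le_radial_density I h) auto
    also have "\<dots> = (\<integral>\<^sup>+ z. ennreal ((h i)\<^sup>2) * (radial_density I W (cmod z) * indicator A z) \<partial>lborel)"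
      by (simp add: mult_ac)
    also have "\<dots> = ennreal ((h i)\<^sup>2) * (\<integral>\<^sup>+ z\<in>A. radial_density I W (cmod z) \<partial>lborel)"
      by (intro nn_integral_cmult) measurable
    finally show ?thesis
      using h[of i] by (simp add: ennreal_mult_le_mult_iff)
  qed
  then have l1: "liminf (\<lambda>i. \<integral>\<^sup>+ \<theta>. \<Phi> i \<theta> \<partial>torus I) \<le> (\<integral>\<^sup>+ z\<in>A. radial_density I W (cmod z) \<partial>lborel)"
    by (intro Liminf_le) auto
  have l2: "(\<integral>\<^sup>+ \<theta>. liminf (\<lambda>i. \<Phi> i \<theta>) \<partial>torus I) \<le> liminf (\<lambda>i. \<integral>\<^sup>+ \<theta>. \<Phi> i \<theta> \<partial>torus I)"
    by (rule nn_integral_liminf) measurable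
  have "ennreal (2 * pi) * indicator A (?Z \<theta>) \<le> liminf (\<lambda>i. \<Phi> i \<theta>)" for \<theta>
  proof (cases "?Z \<theta> \<in> A")
    case True
    have "ennreal (2 * pi) \<le> (\<integral>\<^sup>+ w. liminf (\<lambda>i. indicator A (?Z \<theta> + h i *\<^sub>R w) * ennreal (exp (- (cmod w)\<^sup>2 / 4) / 2)) \<partial>lborel)"
      unfolding nn_integral_gaussian_plane [symmetric]
    proof (intro nn_integral_mono Liminf_bounded)
      fix w
      have "(\<lambda>i. ?Z \<theta> + h i *\<^sub>R w) \<longlonglongrightarrow> ?Z \<theta> + 0 *\<^sub>R w"
        by (intro tendsto_intros h_lim)
      then have "\<forall>\<^sub>F i in sequentially. ?Z \<theta> + h i *\<^sub>R w \<in> A"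
        by (rule topological_tendstoD[OF _ A]) (use True in simp)
      then show "\<forall>\<^sub>F i in sequentially. ennreal (exp (- (cmod w)\<^sup>2 / 4) / 2) \<le>
          indicator A (?Z \<theta> + h i *\<^sub>R w) * ennreal (exp (- (cmod w)\<^sup>2 / 4) / 2)"
        by eventually_elim simp
    qed
    also have "\<dots> \<le> liminf (\<lambda>i. \<Phi> i \<theta>)"
      unfolding \<Phi>_def by (rule nn_integral_liminf) measurable
    finally show ?thesis using True by simp
  qed simp
  then have l3: "(\<integral>\<^sup>+ \<theta>. ennreal (2 * pi) * indicator A (?Z \<theta>) \<partial>torus I) \<le> (\<integral>\<^sup>+ \<theta>. liminf (\<lambda>i. \<Phi> i \<theta>) \<partial>torus I)"
    by (intro nn_integral_mono) blast
  have l4: "(\<integral>\<^sup>+ \<theta>. ennreal (2 * pi) * indicator A (?Z \<theta>) \<partial>torus I) =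
      ennreal (2 * pi) * emeasure (distr (torus I) borel ?Z) A"
  proof -
    have "emeasure (distr (torus I) borel ?Z) A = (\<integral>\<^sup>+ z. indicator A z \<partial>distr (torus I) borel ?Z)"
      by simp
    also have "\<dots> = (\<integral>\<^sup>+ \<theta>. indicator A (?Z \<theta>) \<partial>torus I)"
      by (rule nn_integral_distr) measurable
    finally show ?thesis by (simp add: nn_integral_cmult)
  qed
  show ?thesis
    using order_trans[OF order_trans[OF l3 l2] l1] unfolding l4 .
qed

text \<open>Separates r from t and is the origin of the factor with the maximum in G. For pi c t/2
  <= 1 use |J0| <= 1; otherwise sqrt(2/(pi t r)) = sqrt(c/r) (pi c t/2)^(-1/2).\<close>

lemma abs_bessel_J0_mult_le:
  assumes c: "c > 0" and r: "r > 0" and t: "t \<ge> 0"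
  shows "\<bar>bessel_J0 (t * r)\<bar> \<le> max 1 (sqrt (c / r)) * max 1 (pi / 2 * c * t) powr (- 1 / 2)"
proof (cases "pi / 2 * c * t \<le> 1")
  case True
  then have "max 1 (pi / 2 * c * t) powr (- 1 / 2) = 1" by (simp add: max_def)
  moreover have "\<bar>bessel_J0 (t * r)\<bar> \<le> max 1 (sqrt (c / r))"
    by (rule order_trans[OF abs_bessel_J0_le_1]) simp
  ultimately show ?thesis by (simp only: mult_1_right)
next
  case False
  then have t': "t > 0" using t by (cases "t = 0") auto
  have "\<bar>bessel_J0 (t * r)\<bar> \<le> sqrt (2 / (pi * (t * r)))"
    using t' r by (intro abs_bessel_J0_le) auto
  also have "\<dots> = sqrt (c / r) * (1 / sqrt (pi / 2 * c * t))"
    using c r t' by (simp flip: real_sqrt_divide real_sqrt_mult)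
  also have "1 / sqrt (pi / 2 * c * t) = (pi / 2 * c * t) powr (- 1 / 2)"
    using c t' by (simp add: powr_minus_divide powr_half_sqrt)
  also have "sqrt (c / r) * (pi / 2 * c * t) powr (- 1 / 2) \<le>
      max 1 (sqrt (c / r)) * max 1 (pi / 2 * c * t) powr (- 1 / 2)"
    using False by (intro mult_mono) auto
  finally show ?thesis .
qed

section \<open>A majorant for the law of the normalised square\<close>

lemma c_const_pos:
  assumes "\<exists>m\<le>n. W m \<noteq> 0"
  shows "c_const n W > 0"
proof -
  from assms obtain m where "m \<le> n" "W m \<noteq> 0" by blast
  then have "(\<Sum>m\<le>n. (cmod (W m))\<^sup>2) > 0"
    by (intro sum_pos2[of _ m]) auto
  then show ?thesis by (simp add: c_const_def)
qed

text \<open>Cauchy-Schwarz over the n + 1 coefficients, which explains the factor n + 1 in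
  \<open>c_const\<close>.\<close>

lemma cmod_rotated_sum_le_c_const: "cmod (rotated_sum {..n} W \<theta>) \<le> c_const n W"
proof -
  have "(\<Sum>m\<le>n. cmod (W m))\<^sup>2 \<le> real (n + 1) * (\<Sum>m\<le>n. (cmod (W m))\<^sup>2)"
    using sum_squared_le_sum_of_squares[of "\<lambda>m. cmod (W m)" "{..n}"] by (simp add: mult.commute)
  then have "(\<Sum>m\<le>n. cmod (W m)) \<le> c_const n W"
    unfolding c_const_def by (intro real_le_rsqrt)
  then show ?thesis using cmod_rotated_sum_le order_trans by blast
qed

definition G_integral :: "nat \<Rightarrow> (nat \<Rightarrow> complex) \<Rightarrow> ennreal" where
  "G_integral n W =
     (\<integral>\<^sup>+ t\<in>{0..}. ennreal (t * max 1 (pi / 2 * c_const n W * t) powr (- 1 / 2) *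
        (\<Prod>m\<le>n. \<bar>bessel_J0 (cmod (W m) * t)\<bar>)) \<partial>lborel)"

lemma G_const_eq: "G_const n W = ennreal ((c_const n W)\<^sup>2) * G_integral n W"
  by (simp add: G_const_def G_integral_def)

lemma radial_density_le:
  assumes c: "c_const n W > 0" and r: "r > 0"
  shows "radial_density {..n} W r \<le> ennreal (max 1 (sqrt (c_const n W / r))) * G_integral n W"
proof -
  let ?c = "c_const n W" and ?M = "max 1 (sqrt (c_const n W / r))"
  have "radial_density {..n} W r \<le> (\<integral>\<^sup>+ t. ennreal ?M * (ennreal (t * max 1 (pi / 2 * ?c * t) powr (- 1 / 2) *
        (\<Prod>m\<le>n. \<bar>bessel_J0 (cmod (W m) * t)\<bar>)) * indicator {0..} t) \<partial>lborel)"
    unfolding radial_density_def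
  proof (intro nn_integral_mono)
    fix t :: real
    define Q where "Q = (\<Prod>m\<le>n. \<bar>bessel_J0 (cmod (W m) * t)\<bar>)"
    have Q: "Q \<ge> 0" unfolding Q_def by (intro prod_nonneg) auto
    show "ennreal (t * \<bar>bessel_J0 (t * r)\<bar> * (\<Prod>m\<le>n. \<bar>bessel_J0 (t * cmod (W m))\<bar>)) * indicator {0..} t \<le>
        ennreal ?M * (ennreal (t * max 1 (pi / 2 * ?c * t) powr (- 1 / 2) *
        (\<Prod>m\<le>n. \<bar>bessel_J0 (cmod (W m) * t)\<bar>)) * indicator {0..} t)"
    proof (cases "t \<ge> 0")
      case True
      have "t * \<bar>bessel_J0 (t * r)\<bar> * Q \<le> t * (?M * max 1 (pi / 2 * ?c * t) powr (- 1 / 2)) * Q"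
        using True Q c r by (intro mult_right_mono mult_left_mono abs_bessel_J0_mult_le)
      then have "ennreal (t * \<bar>bessel_J0 (t * r)\<bar> * Q) \<le> ennreal (?M * (t * max 1 (pi / 2 * ?c * t) powr (- 1 / 2) * Q))"
        by (intro ennreal_leI) (simp only: mult_ac)
      also have "\<dots> = ennreal ?M * ennreal (t * max 1 (pi / 2 * ?c * t) powr (- 1 / 2) * Q)"
        using True Q by (intro ennreal_mult) auto
      finally show ?thesis using True by (simp add: Q_def mult.commute)
    qed simp
  qed
  also have "\<dots> = ennreal ?M * G_integral n W"
    unfolding G_integral_def by (intro nn_integral_cmult) measurable
  finally show ?thesis .
qed

lemma finite_inverse_fourth_root_integral:
  assumes "a \<ge> 0" "b \<ge> 0" "s \<ge> 0"
  shows "(\<integral>\<^sup>+ u\<in>{0..a}. ennreal (b * (1 + s * u powr (- 1 / 4))) \<partial>lborel) < \<infinity>"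
proof -
  have "((\<lambda>u. b * (1 + s * u powr (- 1 / 4))) has_integral
      b * (a + s * (a powr (- 1 / 4 + 1) / (- 1 / 4 + 1)))) {0..a}"
    using has_integral_const_real[of "1 :: real" 0 a] assms
    by (intro has_integral_mult_right has_integral_add has_integral_powr_from_0) simp_all
  then have "(\<integral>\<^sup>+ u\<in>{0..a}. ennreal (b * (1 + s * u powr (- 1 / 4))) \<partial>lborel) =
      ennreal (b * (a + s * (a powr (- 1 / 4 + 1) / (- 1 / 4 + 1))))"
    using assms by (intro nn_integral_has_integral_lebesgue') auto
  then show ?thesis by simp
qed

context
  fixes n :: nat and W :: "nat \<Rightarrow> complex" and g :: real
  assumes c: "c_const n W > 0" and g: "g \<ge> 0" and G_integral: "G_integral n W = ennreal g"
begin

text \<open>A majorant for the density of Z as a function of |z|^2. The law lives on |z| <= c;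
  cutting off at |z| < 2c gives finite total mass, as outer regularity requires, and still leaves an
  open neighbourhood of the support.\<close>

private definition profile :: "real \<Rightarrow> ennreal" where
  "profile u = ennreal (1 / (2 * pi) * (max 1 (sqrt (c_const n W / sqrt u)) * g)) *
     indicator {..<4 * (c_const n W)\<^sup>2} u"

private lemma profile_measurable [measurable]: "profile \<in> borel_measurable borel"
  unfolding profile_def by measurable

private lemma norm_less_iff: "cmod z < 2 * c_const n W \<longleftrightarrow> (cmod z)\<^sup>2 \<in> {..<4 * (c_const n W)\<^sup>2}"
proof -
  have "cmod z < 2 * c_const n W \<longleftrightarrow> (cmod z)\<^sup>2 < (2 * c_const n W)\<^sup>2"
    using c power_strict_mono[of "cmod z" "2 * c_const n W" 2] power2_less_imp_less[of "cmod z" "2 * c_const n W"]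
    by auto
  then show ?thesis by (simp add: power_mult_distrib)
qed

private lemma profile_finite: "(\<integral>\<^sup>+ z. profile ((cmod z)\<^sup>2) \<partial>lborel) < \<infinity>"
proof -
  let ?c = "c_const n W"
  have "(\<integral>\<^sup>+ z. profile ((cmod z)\<^sup>2) \<partial>lborel) = (\<integral>\<^sup>+ u. ennreal (pi * indicator {0..} u) * profile u \<partial>lborel)"
    by (rule nn_integral_cmod_square) measurable
  also have "\<dots> \<le> (\<integral>\<^sup>+ u\<in>{0..4 * ?c\<^sup>2}. ennreal (g / 2 * (1 + sqrt ?c * u powr (- 1 / 4))) \<partial>lborel)"
  proof (intro nn_integral_mono)
    fix u :: real
    show "ennreal (pi * indicator {0..} u) * profile u \<le>
        ennreal (g / 2 * (1 + sqrt ?c * u powr (- 1 / 4))) * indicator {0..4 * ?c\<^sup>2} u"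
    proof (cases "0 \<le> u \<and> u < 4 * ?c\<^sup>2")
      case True
      have "sqrt (?c / sqrt u) = sqrt ?c * u powr (- 1 / 4)"
      proof (cases "u = 0")
        case False
        then have "u powr (- 1 / 4) = 1 / sqrt (sqrt u)"
          using True by (simp add: powr_minus_divide powr_powr flip: powr_half_sqrt)
        then show ?thesis by (simp add: real_sqrt_divide)
      qed simp
      then have "max 1 (sqrt (?c / sqrt u)) \<le> 1 + sqrt ?c * u powr (- 1 / 4)"
        using c by simp
      then have "g / 2 * max 1 (sqrt (?c / sqrt u)) \<le> g / 2 * (1 + sqrt ?c * u powr (- 1 / 4))"
        using g by (intro mult_left_mono) auto
      moreover have "ennreal (pi * indicator {0..} u) * profile u = ennreal (g / 2 * max 1 (sqrt (?c / sqrt u)))"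
        using True g by (simp add: profile_def ennreal_mult [symmetric] mult.commute)
      ultimately show ?thesis
        using True by (simp add: ennreal_leI del: ennreal_le_iff)
    next
      case False
      then show ?thesis by (auto simp: profile_def split: split_indicator)
    qed
  qed
  also have "\<dots> < \<infinity>"
    using g c by (intro finite_inverse_fourth_root_integral) auto
  finally show ?thesis .
qed

text \<open>The bound is known for open sets only; since the majorant is a finite Borel measure, it
  is outer regular, and the infimum over open supersets extends the bound to all Borel sets.\<close>

private lemma law_le:
  assumes A: "A \<in> sets borel"
  shows "emeasure (distr (torus {..n}) borel (rotated_sum {..n} W)) A \<le>
    emeasure (density lborel (\<lambda>z. profile ((cmod z)\<^sup>2))) A"
proof -
  let ?c = "c_const n W" and ?Z = "rotated_sum {..n} W"
  let ?\<mu> = "distr (torus {..n}) borel ?Z" and ?\<nu> = "density lborel (\<lambda>z. profile ((cmod z)\<^sup>2))"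
  have open_le: "emeasure ?\<mu> U \<le> emeasure ?\<nu> U" if U: "open U" for U
  proof -
    \<comment> \<open>Restricting to this ball loses no mass of the law, and inside it the cutoff of
      \<open>profile\<close> is inactive.\<close>
    define B where "B = U \<inter> ball 0 (2 * ?c)"
    have B: "open B" using U by (auto simp: B_def)
    have [measurable]: "U \<in> sets borel" "B \<in> sets borel" using U B by auto
    have "?Z \<theta> \<in> ball 0 (2 * ?c)" for \<theta>
      using cmod_rotated_sum_le_c_const[of n W \<theta>] c by simp
    then have "?Z -` U = ?Z -` B" by (auto simp: B_def)
    then have "emeasure ?\<mu> U = emeasure ?\<mu> B"
      by (simp add: emeasure_distr)
    have "ennreal (2 * pi) * emeasure ?\<mu> B \<le> (\<integral>\<^sup>+ z\<in>B. radial_density {..n} W (cmod z) \<partial>lborel)"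
      by (intro emeasure_rotated_sum_open_le B) auto
    also have "\<dots> \<le> (\<integral>\<^sup>+ z. ennreal (2 * pi) * (profile ((cmod z)\<^sup>2) * indicator U z) \<partial>lborel)"
    proof (intro nn_integral_mono_AE)
      have "AE z in lborel. (z :: complex) \<noteq> 0" by (rule AE_lborel_singleton)
      then show "AE z in lborel. radial_density {..n} W (cmod z) * indicator B z \<le>
          ennreal (2 * pi) * (profile ((cmod z)\<^sup>2) * indicator U z)"
      proof eventually_elim
        case (elim z)
        show ?case
        proof (cases "z \<in> B")
          case True
          then have z: "z \<in> U" "(cmod z)\<^sup>2 \<in> {..<4 * ?c\<^sup>2}"
            using norm_less_iff[of z] by (auto simp: B_def)
          have "radial_density {..n} W (cmod z) \<le> ennreal (max 1 (sqrt (?c / cmod z)) * g)"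
            using radial_density_le[OF c, of "cmod z"] elim g
            by (simp add: G_integral ennreal_mult)
          also have "\<dots> = ennreal (2 * pi) * profile ((cmod z)\<^sup>2)"
            using z g by (simp add: profile_def ennreal_mult [symmetric])
          finally show ?thesis using True z by simp
        qed simp
      qed
    qed
    also have "\<dots> = ennreal (2 * pi) * emeasure ?\<nu> U"
      by (subst nn_integral_cmult) (auto simp: emeasure_density)
    finally have "emeasure ?\<mu> B \<le> emeasure ?\<nu> U"
      by (simp add: ennreal_mult_le_mult_iff)
    with \<open>emeasure ?\<mu> U = emeasure ?\<mu> B\<close> show ?thesis by simp
  qed
  have "emeasure ?\<nu> A = (INF U \<in> {U. A \<subseteq> U \<and> open U}. emeasure ?\<nu> U)"
  proof (rule outer_regular)
    show "sets ?\<nu> = sets borel" by simp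
    show "emeasure ?\<nu> (space ?\<nu>) \<noteq> \<infinity>"
      using profile_finite by (simp add: emeasure_density)
  qed (use A in auto)
  moreover have "emeasure ?\<mu> A \<le> (INF U \<in> {U. A \<subseteq> U \<and> open U}. emeasure ?\<nu> U)"
  proof (rule INF_greatest)
    fix U assume U: "U \<in> {U. A \<subseteq> U \<and> open U}"
    then have "emeasure ?\<mu> A \<le> emeasure ?\<mu> U" by (intro emeasure_mono) auto
    also have "\<dots> \<le> emeasure ?\<nu> U" using U by (intro open_le) auto
    finally show "emeasure ?\<mu> A \<le> emeasure ?\<nu> U" .
  qed
  ultimately show ?thesis by simp
qed

text \<open>Passing from z to |z|^2 contributes pi, the profile g v^(-1/4) / (2 pi), and the
  rescaling u = c^2 v the factor c^2, in total c^2 g/2 = G/2. On v <= 1 the maximum with 1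
  disappears because v^(-1/4) >= 1.\<close>

lemma nn_integral_rotated_sum_le:
  assumes [measurable]: "F \<in> borel_measurable borel"
  shows "(\<integral>\<^sup>+ \<theta>. F ((cmod (rotated_sum {..n} W \<theta>) / c_const n W)\<^sup>2) \<partial>torus {..n}) \<le>
    ennreal ((c_const n W)\<^sup>2 * g / 2) * (\<integral>\<^sup>+ u\<in>{0<..1}. F u * ennreal (u powr (- 1 / 4)) \<partial>lborel)"
proof -
  let ?c = "c_const n W" and ?Z = "rotated_sum {..n} W"
  let ?\<mu> = "distr (torus {..n}) borel ?Z" and ?\<nu> = "density lborel (\<lambda>z. profile ((cmod z)\<^sup>2))"
  \<comment> \<open>The majorant reaches out to |z| < 2c, so \<open>F\<close> must be cut off at 1
    before the law is replaced by it.\<close>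
  define H where "H u = F u * indicator {..1} u" for u
  have [measurable]: "H \<in> borel_measurable borel" unfolding H_def by measurable
  have "(cmod (?Z \<theta>) / ?c)\<^sup>2 \<le> 1" for \<theta>
    using cmod_rotated_sum_le_c_const[of n W \<theta>] c by (intro power_le_one) auto
  then have "(\<integral>\<^sup>+ \<theta>. F ((cmod (?Z \<theta>) / ?c)\<^sup>2) \<partial>torus {..n}) = (\<integral>\<^sup>+ \<theta>. H ((cmod (?Z \<theta>) / ?c)\<^sup>2) \<partial>torus {..n})"
    by (simp add: H_def)
  also have "\<dots> = (\<integral>\<^sup>+ z. H ((cmod z / ?c)\<^sup>2) \<partial>?\<mu>)"
    by (subst nn_integral_distr) auto
  also have "\<dots> \<le> (\<integral>\<^sup>+ z. H ((cmod z / ?c)\<^sup>2) \<partial>?\<nu>)"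
    by (intro nn_integral_mono_measure) (auto simp: le_measure law_le)
  also have "\<dots> = (\<integral>\<^sup>+ z. profile ((cmod z)\<^sup>2) * H ((cmod z)\<^sup>2 / ?c\<^sup>2) \<partial>lborel)"
    by (subst nn_integral_density) (auto simp: power_divide)
  also have "\<dots> = (\<integral>\<^sup>+ u. ennreal (pi * indicator {0..} u) * (profile u * H (u / ?c\<^sup>2)) \<partial>lborel)"
    by (rule nn_integral_cmod_square) measurable
  also have "\<dots> = ennreal \<bar>?c\<^sup>2\<bar> * (\<integral>\<^sup>+ v. ennreal (pi * indicator {0..} (0 + ?c\<^sup>2 * v)) * (profile (0 + ?c\<^sup>2 * v) * H ((0 + ?c\<^sup>2 * v) / ?c\<^sup>2)) \<partial>lborel)"
    using c by (intro nn_integral_real_affine) auto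
  also have "(\<integral>\<^sup>+ v. ennreal (pi * indicator {0..} (0 + ?c\<^sup>2 * v)) * (profile (0 + ?c\<^sup>2 * v) * H ((0 + ?c\<^sup>2 * v) / ?c\<^sup>2)) \<partial>lborel) =
      (\<integral>\<^sup>+ v. ennreal (g / 2) * (F v * ennreal (v powr (- 1 / 4)) * indicator {0<..1} v) \<partial>lborel)"
  proof (intro nn_integral_cong_AE)
    have "AE v in lborel. (v :: real) \<noteq> 0" by (rule AE_lborel_singleton)
    then show "AE v in lborel. ennreal (pi * indicator {0..} (0 + ?c\<^sup>2 * v)) * (profile (0 + ?c\<^sup>2 * v) * H ((0 + ?c\<^sup>2 * v) / ?c\<^sup>2)) =
        ennreal (g / 2) * (F v * ennreal (v powr (- 1 / 4)) * indicator {0<..1} v)"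
    proof eventually_elim
      case (elim v)
      consider "v < 0" | "0 < v" "v \<le> 1" | "v > 1" using elim by linarith
      then show ?case
      proof cases
        case 1
        then have "?c\<^sup>2 * v < 0" using c by (simp add: mult_pos_neg)
        then show ?thesis using 1 by simp
      next
        case 2
        have pos: "0 \<le> ?c\<^sup>2 * v" using 2 by simp
        have "?c\<^sup>2 * v \<le> ?c\<^sup>2 * 1" using 2 by (intro mult_left_mono) auto
        also have "\<dots> < 4 * ?c\<^sup>2" using c by simp
        finally have lt: "?c\<^sup>2 * v < 4 * ?c\<^sup>2" .
        have root: "sqrt (?c / sqrt (?c\<^sup>2 * v)) = v powr (- 1 / 4)"
        proof -
          have "sqrt (?c / sqrt (?c\<^sup>2 * v)) = 1 / sqrt (sqrt v)"
            using c by (simp add: real_sqrt_mult real_sqrt_divide)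
          also have "\<dots> = v powr (- 1 / 4)"
            using 2 by (simp add: powr_minus_divide powr_powr flip: powr_half_sqrt)
          finally show ?thesis .
        qed
        have "1 powr (- 1 / 4) \<le> v powr (- 1 / 4)"
          using 2 by (intro powr_mono2') auto
        then have "max 1 (sqrt (?c / sqrt (?c\<^sup>2 * v))) = v powr (- 1 / 4)"
          unfolding root by simp
        then have "profile (?c\<^sup>2 * v) = ennreal (1 / (2 * pi) * (v powr (- 1 / 4) * g))"
          using lt by (simp add: profile_def)
        then have "ennreal (pi * indicator {0..} (?c\<^sup>2 * v)) * profile (?c\<^sup>2 * v) = ennreal (g / 2) * ennreal (v powr (- 1 / 4))"
          using pos g by (simp add: ennreal_mult [symmetric])
        moreover have "H ((?c\<^sup>2 * v) / ?c\<^sup>2) = F v" using 2 c by (simp add: H_def)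
        ultimately show ?thesis using 2
          by (simp add: mult.assoc [symmetric]) (simp add: mult_ac)
      next
        case 3
        then show ?thesis using c by (simp add: H_def)
      qed
    qed
  qed
  also have "\<dots> = ennreal (g / 2) * (\<integral>\<^sup>+ u\<in>{0<..1}. F u * ennreal (u powr (- 1 / 4)) \<partial>lborel)"
    by (intro nn_integral_cmult) measurable
  finally show ?thesis
    using g by (simp add: ennreal_mult [symmetric] mult.assoc [symmetric])
qed

end

section \<open>Truncation errors\<close>

text \<open>Log-convexity of Gamma at x + 1 = (3/4)(x + 3/4) + (1/4)(x + 7/4), combined with Gamma(x
  + 7/4) = (x + 3/4) Gamma(x + 3/4).\<close>

lemma Gamma_ratio_le:
  assumes "x > 0"
  shows "Gamma (x + 1) / Gamma (x + 7 / 4) \<le> x powr (- 3 / 4 :: real)"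
proof -
  let ?L = "\<lambda>x :: real. ln (Gamma x)"
  have pos: "Gamma (x + 1) > 0" "Gamma (x + 3 / 4) > 0" "Gamma (x + 7 / 4) > 0"
    using assms by (auto intro!: Gamma_real_pos)
  have "?L ((1 - 1 / 4) * (x + 3 / 4) + 1 / 4 * (x + 7 / 4)) \<le> (1 - 1 / 4) * ?L (x + 3 / 4) + 1 / 4 * ?L (x + 7 / 4)"
    using convex_onD[OF log_convex_Gamma_real, of "1 / 4" "x + 3 / 4" "x + 7 / 4"] assms by simp
  moreover have "(1 - 1 / 4) * (x + 3 / 4) + 1 / 4 * (x + 7 / 4) = x + 1" by (simp add: field_simps)
  ultimately have 1: "?L (x + 1) \<le> 3 / 4 * ?L (x + 3 / 4) + 1 / 4 * ?L (x + 7 / 4)" by simp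
  have "Gamma (x + 7 / 4) = (x + 3 / 4) * Gamma (x + 3 / 4)"
  proof -
    have "x + 3 / 4 \<notin> \<int>\<^sub>\<le>\<^sub>0" using assms by (auto elim!: nonpos_Ints_cases)
    moreover have "x + 3 / 4 + 1 = x + 7 / 4" by simp
    ultimately show ?thesis using Gamma_plus1[of "x + 3 / 4"] by (simp add: add.commute)
  qed
  then have 2: "?L (x + 7 / 4) = ln (x + 3 / 4) + ?L (x + 3 / 4)"
    using assms pos by (simp add: ln_mult_pos)
  have "ln x \<le> ln (x + 3 / 4)" using assms by simp
  then have "?L (x + 1) \<le> ?L (x + 7 / 4) - 3 / 4 * ln x" using 1 2 by linarith
  then have "exp (?L (x + 1)) \<le> exp (?L (x + 7 / 4) + (- 3 / 4) * ln x)" by simp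
  also have "\<dots> = Gamma (x + 7 / 4) * x powr (- 3 / 4)"
    unfolding exp_add using assms pos by (simp add: powr_def)
  finally have "Gamma (x + 1) \<le> Gamma (x + 7 / 4) * x powr (- 3 / 4)"
    using pos by simp
  then show ?thesis using pos by (simp add: divide_le_eq mult.commute)
qed

lemma Beta_le:
  assumes "j \<ge> 1"
  shows "Beta (3 / 4) (real j + 1) \<le> Gamma (3 / 4) * real j powr (- 3 / 4)"
proof -
  have "Gamma (real j + 1) / Gamma (real j + 7 / 4) \<le> real j powr (- 3 / 4)"
    using assms by (intro Gamma_ratio_le) simp
  then have "Gamma (3 / 4) * (Gamma (real j + 1) / Gamma (real j + 7 / 4)) \<le> Gamma (3 / 4) * real j powr (- 3 / 4)"
    by (intro mult_left_mono) (auto intro!: less_imp_le Gamma_real_pos)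
  moreover have "3 / 4 + (real j + 1) = real j + 7 / 4" by simp
  ultimately show ?thesis by (simp only: Beta_def times_divide_eq_right)
qed

text \<open>The mean value theorem for an antiderivative of y^(-7/4); it makes the sum of j^(-7/4)
  over j > N telescope to at most (4/3) N^(-3/4).\<close>

lemma powr_le_telescope:
  assumes "x > 0"
  shows "(x + 1) powr (- 7 / 4) \<le> 4 / 3 * (x powr (- 3 / 4) - (x + 1) powr (- 3 / 4 :: real))"
proof -
  have "\<exists>z. x < z \<and> z < x + 1 \<and>
      (- 4 / 3 * (x + 1) powr (- 3 / 4)) - (- 4 / 3 * x powr (- 3 / 4)) = (x + 1 - x) * z powr (- 7 / 4)"
  proof (rule MVT2)
    fix y assume "x \<le> y" "y \<le> x + 1"
    then show "((\<lambda>y. - 4 / 3 * y powr (- 3 / 4)) has_real_derivative y powr (- 7 / 4)) (at y)"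
      using assms by (auto intro!: derivative_eq_intros simp: powr_diff)
  qed simp
  then obtain z where z: "x < z" "z < x + 1"
    "4 / 3 * (x powr (- 3 / 4) - (x + 1) powr (- 3 / 4)) = z powr (- 7 / 4)"
    by (auto simp: algebra_simps)
  have "(x + 1) powr (- 7 / 4) \<le> z powr (- 7 / 4)"
    using z assms by (intro powr_mono2') auto
  then show ?thesis using z by simp
qed

definition ln_power_tail :: "nat \<Rightarrow> real \<Rightarrow> real" where
  "ln_power_tail N u = ln u + (\<Sum>j=1..N. 1 / real j * (1 - u) ^ j)"

lemma ln_power_tail_sums:
  assumes "0 < u" "u \<le> 1"
  shows "(\<lambda>i. (1 - u) ^ (N + 1 + i) / real (N + 1 + i)) sums (- ln_power_tail N u)"
proof -
  have "(\<lambda>j. - ((- (u - 1)) ^ j) / real j) sums ln (1 + (u - 1))"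
    using assms by (intro ln_series') auto
  then have "(\<lambda>j. (1 - u) ^ j / real j) sums (- ln u)"
    using sums_minus by fastforce
  then have "(\<lambda>i. (1 - u) ^ (i + (N + 1)) / real (i + (N + 1))) sums (- ln u - (\<Sum>j<N + 1. (1 - u) ^ j / real j))"
    by (rule sums_split_initial_segment)
  moreover have "(\<Sum>j<N + 1. (1 - u) ^ j / real j) = (\<Sum>j=1..N. 1 / real j * (1 - u) ^ j)"
    by (rule sum.mono_neutral_cong_right) auto
  ultimately show ?thesis by (simp add: ln_power_tail_def add.commute)
qed

text \<open>On (0, 1] the tail is minus a series with non-negative terms, so it can be integrated
  termwise without cancellation. The term of index j gives Beta(3/4, j+1)/j <= Gamma(3/4) j^(-7/4),
  where 3/4 - 1 is the exponent of the weight.\<close>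

lemma nn_integral_ln_power_tail_le:
  assumes N: "N \<ge> 1"
  shows "(\<integral>\<^sup>+ u\<in>{0<..1}. ennreal \<bar>ln_power_tail N u\<bar> * ennreal (u powr (- 1 / 4)) \<partial>lborel) \<le>
    ennreal (4 / 3 * Gamma (3 / 4) * real N powr (- 3 / 4))"
proof -
  define x where "x i u = (1 - u) ^ (N + 1 + i) / real (N + 1 + i)" for i u
  have x_nonneg: "x i u \<ge> 0" if "u \<le> 1" for i u
    using that by (simp add: x_def)
  have "(\<integral>\<^sup>+ u\<in>{0<..1}. ennreal \<bar>ln_power_tail N u\<bar> * ennreal (u powr (- 1 / 4)) \<partial>lborel) =
      (\<integral>\<^sup>+ u. (\<Sum>i. ennreal (u powr (3 / 4 - 1) * x i u) * indicator {0<..1} u) \<partial>lborel)"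
  proof (intro nn_integral_cong)
    fix u :: real
    show "ennreal \<bar>ln_power_tail N u\<bar> * ennreal (u powr (- 1 / 4)) * indicator {0<..1} u =
        (\<Sum>i. ennreal (u powr (3 / 4 - 1) * x i u) * indicator {0<..1} u)"
    proof (cases "0 < u \<and> u \<le> 1")
      case True
      have s: "(\<lambda>i. x i u) sums (- ln_power_tail N u)"
        unfolding x_def using True by (intro ln_power_tail_sums) auto
      then have "- ln_power_tail N u \<ge> 0"
        using True x_nonneg by (intro sums_le[OF _ sums_zero s]) auto
      then have "\<bar>ln_power_tail N u\<bar> = - ln_power_tail N u" by simp
      moreover have "(\<lambda>i. u powr (3 / 4 - 1) * x i u) sums (u powr (3 / 4 - 1) * (- ln_power_tail N u))"
        by (intro sums_mult s)
      then have "(\<Sum>i. ennreal (u powr (3 / 4 - 1) * x i u)) = ennreal (u powr (3 / 4 - 1) * (- ln_power_tail N u))"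
        using True x_nonneg mult_nonneg_nonneg[OF powr_ge_zero \<open>- ln_power_tail N u \<ge> 0\<close>]
        by (intro sums_unique[symmetric] sums_ennreal[THEN iffD2]) auto
      ultimately show ?thesis
        using True \<open>- ln_power_tail N u \<ge> 0\<close> by (simp add: ennreal_mult [symmetric] mult.commute)
    qed auto
  qed
  also have "\<dots> = (\<Sum>i. \<integral>\<^sup>+ u. ennreal (u powr (3 / 4 - 1) * x i u) * indicator {0<..1} u \<partial>lborel)"
    unfolding x_def by (intro nn_integral_suminf) measurable
  also have "\<dots> \<le> ennreal (4 / 3 * Gamma (3 / 4) * real N powr (- 3 / 4))"
  proof (rule suminf_le_const)
    fix k
    \<comment> \<open>A telescoping majorant: its differences dominate the single integrals, and
      \<open>b 0\<close> is the claimed bound.\<close>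
    define b where "b i = 4 / 3 * Gamma (3 / 4) * real (N + i) powr (- 3 / 4)" for i
    have term_le: "(\<integral>\<^sup>+ u. ennreal (u powr (3 / 4 - 1) * x i u) * indicator {0<..1} u \<partial>lborel) \<le> ennreal (b i - b (Suc i))" for i
    proof -
      define j where "j = N + 1 + i"
      have j: "j \<ge> 1" by (simp add: j_def)
      have "((\<lambda>u. u powr (3 / 4 - 1) * (1 - u) powr ((real j + 1) - 1)) has_integral Beta (3 / 4) (real j + 1)) {0..1}"
        by (intro has_integral_Beta_real) auto
      then have "((\<lambda>u. u powr (3 / 4 - 1) * (1 - u) powr real j / real j) has_integral Beta (3 / 4) (real j + 1) / real j) {0..1}"
        by (intro has_integral_divide) simp
      then have "(\<integral>\<^sup>+ u\<in>{0..1}. ennreal (u powr (3 / 4 - 1) * (1 - u) powr real j / real j) \<partial>lborel) = ennreal (Beta (3 / 4) (real j + 1) / real j)"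
        by (intro nn_integral_has_integral_lebesgue') auto
      moreover have "(\<integral>\<^sup>+ u. ennreal (u powr (3 / 4 - 1) * x i u) * indicator {0<..1} u \<partial>lborel) \<le>
          (\<integral>\<^sup>+ u\<in>{0..1}. ennreal (u powr (3 / 4 - 1) * (1 - u) powr real j / real j) \<partial>lborel)"
      proof (intro nn_integral_mono_AE)
        have "AE u in lborel. (u :: real) \<noteq> 1" by (rule AE_lborel_singleton)
        then show "AE u in lborel. ennreal (u powr (3 / 4 - 1) * x i u) * indicator {0<..1} u \<le>
            ennreal (u powr (3 / 4 - 1) * (1 - u) powr real j / real j) * indicator {0..1} u"
        proof eventually_elim
          case (elim u)
          show ?case
          proof (cases "0 < u \<and> u < 1")
            case True
            then have "(1 - u) powr real j = (1 - u) ^ j" by (intro powr_realpow) simp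
            then show ?thesis by (simp add: x_def j_def split: split_indicator)
          next
            case False
            then show ?thesis using elim by (auto split: split_indicator)
          qed
        qed
      qed
      ultimately have "(\<integral>\<^sup>+ u. ennreal (u powr (3 / 4 - 1) * x i u) * indicator {0<..1} u \<partial>lborel) \<le> ennreal (Beta (3 / 4) (real j + 1) / real j)"
        by simp
      also have "\<dots> \<le> ennreal (b i - b (Suc i))"
      proof (rule ennreal_leI)
        have "Beta (3 / 4) (real j + 1) / real j \<le> Gamma (3 / 4) * real j powr (- 3 / 4) / real j"
          using Beta_le[OF j] by (intro divide_right_mono) auto
        also have "\<dots> = Gamma (3 / 4) * (real (N + i) + 1) powr (- 7 / 4)"
        proof -
          have "real j powr (- 7 / 4) = real j powr (- 3 / 4) / real j powr 1"
            using powr_diff[of "real j" "- 3 / 4" 1] by simp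
          then show ?thesis using j by (simp add: j_def add_ac)
        qed
        also have "\<dots> \<le> Gamma (3 / 4) * (4 / 3 * (real (N + i) powr (- 3 / 4) - (real (N + i) + 1) powr (- 3 / 4)))"
          using N by (intro mult_left_mono powr_le_telescope) (auto intro!: less_imp_le Gamma_real_pos)
        also have "\<dots> = b i - b (Suc i)" by (simp add: b_def algebra_simps)
        finally show "Beta (3 / 4) (real j + 1) / real j \<le> b i - b (Suc i)" .
      qed
      finally show ?thesis .
    qed
    have b_nonneg: "b i \<ge> 0" for i
      unfolding b_def by (intro mult_nonneg_nonneg) (auto intro!: less_imp_le Gamma_real_pos)
    have b_mono: "b (Suc i) \<le> b i" for i
      unfolding b_def using N by (intro mult_left_mono powr_mono2') (auto intro!: less_imp_le Gamma_real_pos)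
    have "(\<Sum>i<k. \<integral>\<^sup>+ u. ennreal (u powr (3 / 4 - 1) * x i u) * indicator {0<..1} u \<partial>lborel) \<le> (\<Sum>i<k. ennreal (b i - b (Suc i)))"
      by (intro sum_mono term_le)
    also have "\<dots> = ennreal (\<Sum>i<k. b i - b (Suc i))"
      using b_mono by (intro sum_ennreal) simp
    also have "(\<Sum>i<k. b i - b (Suc i)) = b 0 - b k"
      by (rule sum_lessThan_telescope')
    also have "ennreal (b 0 - b k) \<le> ennreal (b 0)"
      using b_nonneg by (intro ennreal_leI) simp
    finally show "(\<Sum>i<k. \<integral>\<^sup>+ u. ennreal (u powr (3 / 4 - 1) * x i u) * indicator {0<..1} u \<partial>lborel) \<le>
      ennreal (4 / 3 * Gamma (3 / 4) * real N powr (- 3 / 4))"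
      by (simp add: b_def)
  qed auto
  finally show ?thesis .
qed

text \<open>The arithmetic-geometric mean inequality with the free weight \<open>\<mu>\<close> replaces the
  Cauchy-Schwarz inequality.\<close>
lemma nn_integral_fourth_root_weight_le:
  assumes T: "((\<lambda>u. (T u)\<^sup>2) has_integral I) {0..1}" and \<mu>: "\<mu> > 0"
  shows "(\<integral>\<^sup>+ u\<in>{0<..1}. ennreal \<bar>T u\<bar> * ennreal (u powr (- 1 / 4)) \<partial>lborel) \<le>
    ennreal ((\<mu> * I + 2 / \<mu>) / 2)"
proof -
  have "((\<lambda>u. u powr (- 1 / 2)) has_integral (1 powr (- 1 / 2 + 1) / (- 1 / 2 + 1))) {0..1 :: real}"
    by (rule has_integral_powr_from_0) auto
  then have "((\<lambda>u. u powr (- 1 / 2)) has_integral 2) {0..1 :: real}" by simp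
  then have "((\<lambda>u. (\<mu> * (T u)\<^sup>2 + u powr (- 1 / 2) / \<mu>) / 2) has_integral (\<mu> * I + 2 / \<mu>) / 2) {0..1}"
    by (intro has_integral_divide has_integral_add has_integral_mult_right T)
  then have "(\<integral>\<^sup>+ u\<in>{0..1}. ennreal ((\<mu> * (T u)\<^sup>2 + u powr (- 1 / 2) / \<mu>) / 2) \<partial>lborel) = ennreal ((\<mu> * I + 2 / \<mu>) / 2)"
    using \<mu> by (intro nn_integral_has_integral_lebesgue') auto
  moreover have "(\<integral>\<^sup>+ u\<in>{0<..1}. ennreal \<bar>T u\<bar> * ennreal (u powr (- 1 / 4)) \<partial>lborel) \<le>
      (\<integral>\<^sup>+ u\<in>{0..1}. ennreal ((\<mu> * (T u)\<^sup>2 + u powr (- 1 / 2) / \<mu>) / 2) \<partial>lborel)"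
  proof (intro nn_integral_mono)
    fix u :: real
    define y where "y = u powr (- 1 / 4)"
    have y2: "u powr (- 1 / 2) = y\<^sup>2" by (simp add: y_def power2_eq_square flip: powr_add)
    \<comment> \<open>Expanding the square bounds |T| y by (\<mu> T^2 + y^2/\<mu>)/2; here y^2 =
      u^(-1/2) has integral 2, the source of the term 2/\<mu>.\<close>
    have "0 \<le> (\<mu> * \<bar>T u\<bar> - y)\<^sup>2 / (2 * \<mu>)" using \<mu> by simp
    also have "\<dots> = (\<mu> * (T u)\<^sup>2 + y\<^sup>2 / \<mu>) / 2 - \<bar>T u\<bar> * y"
      using \<mu> by (simp add: power2_diff power_mult_distrib field_simps) (simp add: power2_eq_square algebra_simps)
    finally show "ennreal \<bar>T u\<bar> * ennreal (u powr (- 1 / 4)) * indicator {0<..1} u \<le>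
        ennreal ((\<mu> * (T u)\<^sup>2 + u powr (- 1 / 2) / \<mu>) / 2) * indicator {0..1} u"
      unfolding y2 y_def [symmetric]
      by (auto split: split_indicator simp: ennreal_mult [symmetric] y_def intro!: ennreal_leI)
  qed
  ultimately show ?thesis by simp
qed

text \<open>Four factors J0 with non-zero coefficient each decay like t^(-1/2); the remaining ones
  are bounded by 1. Together with t and the factor of order t^(-1/2) this gives t^(1 - 1/2 - 2) =
  t^(-3/2), which is integrable at infinity.\<close>

lemma G_integral_finite:
  assumes four: "4 \<le> card {m. m \<le> n \<and> W m \<noteq> 0}" and c: "c_const n W > 0"
  shows "G_integral n W < \<infinity>"
proof -
  let ?c = "c_const n W"
  from four obtain B where B: "B \<subseteq> {m. m \<le> n \<and> W m \<noteq> 0}" "card B = 4"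
    by (meson obtain_subset_with_card_n)
  then have finB: "finite B" by (intro card_ge_0_finite) simp
  define K where "K = (pi / 2 * ?c) powr (- 1 / 2) * (\<Prod>m\<in>B. sqrt (2 / (pi * cmod (W m))))"
  have K: "K \<ge> 0" unfolding K_def by (intro mult_nonneg_nonneg prod_nonneg) auto
  define f where "f t = t * max 1 (pi / 2 * ?c * t) powr (- 1 / 2) * (\<Prod>m\<le>n. \<bar>bessel_J0 (cmod (W m) * t)\<bar>)" for t
  have small: "f t \<le> 1" if t: "0 \<le> t" "t \<le> 1" for t
  proof -
    have "max 1 (pi / 2 * ?c * t) powr (- 1 / 2) \<le> 1 powr (- 1 / 2)"
      by (intro powr_mono2') auto
    moreover have "(\<Prod>m\<le>n. \<bar>bessel_J0 (cmod (W m) * t)\<bar>) \<le> 1"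
      by (intro prod_le_1) (auto simp: abs_bessel_J0_le_1)
    ultimately have "f t \<le> 1 * 1 * 1"
      unfolding f_def using t by (intro mult_mono) (auto intro!: prod_nonneg)
    then show ?thesis by simp
  qed
  have large: "f t \<le> K * t powr (- 3 / 2)" if t: "1 \<le> t" for t
  proof -
    have "(\<Prod>m\<le>n. \<bar>bessel_J0 (cmod (W m) * t)\<bar>) =
        (\<Prod>m\<in>{..n} - B. \<bar>bessel_J0 (cmod (W m) * t)\<bar>) * (\<Prod>m\<in>B. \<bar>bessel_J0 (cmod (W m) * t)\<bar>)"
      using B by (intro prod.subset_diff) auto
    also have "\<dots> \<le> 1 * (\<Prod>m\<in>B. \<bar>bessel_J0 (cmod (W m) * t)\<bar>)"
      by (intro mult_right_mono prod_le_1 prod_nonneg) (auto simp: abs_bessel_J0_le_1)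
    also have "\<dots> \<le> (\<Prod>m\<in>B. sqrt (2 / (pi * cmod (W m))) * (1 / sqrt t))"
      unfolding mult_1_left
    proof (intro prod_mono conjI)
      fix m assume "m \<in> B"
      then have "W m \<noteq> 0" using B by auto
      then have "\<bar>bessel_J0 (cmod (W m) * t)\<bar> \<le> sqrt (2 / (pi * (cmod (W m) * t)))"
        using t by (intro abs_bessel_J0_le) auto
      also have "\<dots> = sqrt (2 / (pi * cmod (W m))) * (1 / sqrt t)"
        by (simp add: real_sqrt_divide real_sqrt_mult)
      finally show "\<bar>bessel_J0 (cmod (W m) * t)\<bar> \<le> sqrt (2 / (pi * cmod (W m))) * (1 / sqrt t)" .
    qed auto
    also have "\<dots> = (\<Prod>m\<in>B. sqrt (2 / (pi * cmod (W m)))) * (1 / sqrt t) ^ 4"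
      unfolding prod.distrib by (simp add: B(2))
    also have "(1 / sqrt t) ^ 4 = t powr (- 2)"
    proof -
      have "(1 / sqrt t) ^ 4 = ((1 / sqrt t)\<^sup>2)\<^sup>2" by (simp flip: power_mult)
      also have "\<dots> = t powr (- 2)" using t by (simp add: power_divide powr_minus_divide powr_numeral)
      finally show ?thesis .
    qed
    finally have prod_le: "(\<Prod>m\<le>n. \<bar>bessel_J0 (cmod (W m) * t)\<bar>) \<le> (\<Prod>m\<in>B. sqrt (2 / (pi * cmod (W m)))) * t powr (- 2)" .
    have "max 1 (pi / 2 * ?c * t) powr (- 1 / 2) \<le> (pi / 2 * ?c * t) powr (- 1 / 2)"
      using c t by (intro powr_mono2') auto
    also have "\<dots> = (pi / 2 * ?c) powr (- 1 / 2) * t powr (- 1 / 2)"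
      using c t powr_mult[of "pi / 2 * ?c" t "- 1 / 2"] by simp
    finally have "f t \<le> t * ((pi / 2 * ?c) powr (- 1 / 2) * t powr (- 1 / 2)) *
        ((\<Prod>m\<in>B. sqrt (2 / (pi * cmod (W m)))) * t powr (- 2))"
      unfolding f_def using t prod_le by (intro mult_mono) (auto intro!: prod_nonneg mult_nonneg_nonneg)
    also have "\<dots> = K * (t powr 1 * t powr (- 1 / 2) * t powr (- 2))"
      using t by (simp add: K_def)
    also have "t powr 1 * t powr (- 1 / 2) * t powr (- 2) = t powr (- 3 / 2)"
      by (simp only: powr_add [symmetric]) simp
    finally show ?thesis .
  qed
  have "G_integral n W = (\<integral>\<^sup>+ t\<in>{0..}. ennreal (f t) \<partial>lborel)"
    by (simp add: G_integral_def f_def)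
  also have "\<dots> \<le> (\<integral>\<^sup>+ t. indicator {0..1} t + ennreal (K * t powr (- 3 / 2)) * indicator {1..} t \<partial>lborel)"
  proof (intro nn_integral_mono)
    fix t :: real
    consider "t < 0" | "0 \<le> t" "t < 1" | "t \<ge> 1" by linarith
    then show "ennreal (f t) * indicator {0..} t \<le> indicator {0..1} t + ennreal (K * t powr (- 3 / 2)) * indicator {1..} t"
    proof cases
      case 2
      then show ?thesis using small[of t] by (simp add: ennreal_le_1)
    next
      case 3
      then have "ennreal (f t) \<le> ennreal (K * t powr (- 3 / 2))"
        by (intro ennreal_leI large)
      then show ?thesis using 3 by (simp add: add_increasing)
    qed simp
  qed
  also have "\<dots> = (\<integral>\<^sup>+ t. indicator {0..1} (t :: real) \<partial>lborel) + (\<integral>\<^sup>+ t\<in>{1..}. ennreal (K * t powr (- 3 / 2)) \<partial>lborel)"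
    by (subst nn_integral_add) auto
  also have "(\<integral>\<^sup>+ t\<in>{1..}. ennreal (K * t powr (- 3 / 2)) \<partial>lborel) = ennreal (0 - K * (- 2 * 1 powr (- 1 / 2)))"
  proof (rule nn_integral_FTC_atLeast[where F = "\<lambda>t. K * (- 2 * t powr (- 1 / 2))" and T = 0])
    fix t :: real assume t: "1 \<le> t"
    then show "((\<lambda>t. K * (- 2 * t powr (- 1 / 2))) has_real_derivative K * t powr (- 3 / 2)) (at t)"
      by (auto intro!: derivative_eq_intros simp: powr_diff)
    show "0 \<le> K * t powr (- 3 / 2)" using K by simp
  next
    have "((\<lambda>t :: real. - 2 * t powr (- 1 / 2)) \<longlongrightarrow> 0) at_top" by real_asymp
    then show "((\<lambda>t. K * (- 2 * t powr (- 1 / 2))) \<longlongrightarrow> 0) at_top"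
      using tendsto_mult_right_zero by blast
  qed auto
  finally show ?thesis
    by (rule le_less_trans) (simp add: emeasure_lborel_Icc_eq)
qed

section \<open>From the law of U to the error bounds\<close>

context
  fixes n :: nat and W :: "nat \<Rightarrow> complex"
  assumes c: "c_const n W > 0"
begin

definition "rel_square \<theta> = (cmod (rotated_sum {..n} W \<theta>) / c_const n W)\<^sup>2"

lemma rel_square_measurable [measurable]: "rel_square \<in> borel_measurable (torus {..n})"
  unfolding rel_square_def by measurable

lemma rel_square_bounds: "0 \<le> rel_square \<theta>" "rel_square \<theta> \<le> 1"
  using cmod_rotated_sum_le_c_const[of n W \<theta>] c by (auto simp: rel_square_def intro!: power_le_one)

lemma integrable_rel_square_power: "integrable (torus {..n}) (\<lambda>\<theta>. rel_square \<theta> ^ k)"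
  by (rule integrable_torus_bounded[where B = 1]) (use rel_square_bounds in \<open>auto simp: power_abs intro!: power_le_one\<close>)

lemma integral_rel_square_power: "(LINT \<theta>|torus {..n}. rel_square \<theta> ^ k) = a_coeff n k W / c_const n W ^ (2 * k)"
  unfolding integral_torus_power_eq_a_coeff [symmetric]
  by (simp add: rel_square_def power_divide flip: power_mult)

lemma integrable_rel_square_poly: "integrable (torus {..n}) (\<lambda>\<theta>. \<Sum>k = 0..j. d k * rel_square \<theta> ^ k)"
  by (intro Bochner_Integration.integrable_sum integrable_mult_right integrable_rel_square_power)

lemma integral_rel_square_poly: "(LINT \<theta>|torus {..n}. (\<Sum>k = 0..j. d k * rel_square \<theta> ^ k)) =
    (\<Sum>k = 0..j. d k * (a_coeff n k W / c_const n W ^ (2 * k)))"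
  by (simp add: Bochner_Integration.integral_sum integrable_rel_square_power integral_rel_square_power)

lemma one_minus_power_eq: "(1 - u) ^ j = (\<Sum>k = 0..j. (real (j choose k) * (- 1) ^ k) * u ^ k)"
  using binomial_ring[of "- u" 1 j] by (simp add: atLeast0AtMost power_minus[of u] mult.assoc)

lemma legendre_eq: "legendre j u = (\<Sum>k = 0..j. legendre_coeff j k * u ^ k)"
  by (simp add: legendre_def atLeast0AtMost)

lemma E1_eq: "E1 N n W = ln (c_const n W) - 1 / 2 * (LINT \<theta>|torus {..n}. (\<Sum>j = 1..N. 1 / real j * (1 - rel_square \<theta>) ^ j))"
proof -
  have "(LINT \<theta>|torus {..n}. (\<Sum>j = 1..N. 1 / real j * (1 - rel_square \<theta>) ^ j)) =
      (\<Sum>j = 1..N. 1 / real j * (\<Sum>k = 0..j. (real (j choose k) * (- 1) ^ k) * (a_coeff n k W / c_const n W ^ (2 * k))))"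
    unfolding one_minus_power_eq integral_rel_square_poly [symmetric]
    by (subst Bochner_Integration.integral_sum) (auto intro!: integrable_mult_right integrable_rel_square_poly)
  then show ?thesis by (simp add: E1_def mult.assoc)
qed

lemma E2_eq: "E2 N n W = ln (c_const n W) - 1 / 2 * (LINT \<theta>|torus {..n}.
    (1 + (\<Sum>j = 1..N. real (2 * j + 1) / real (j * (j + 1)) * legendre j (rel_square \<theta>))))"
proof -
  have int: "integrable (torus {..n}) (\<lambda>\<theta>. real (2 * j + 1) / real (j * (j + 1)) * (\<Sum>k = 0..j. legendre_coeff j k * rel_square \<theta> ^ k))" for j
    by (intro integrable_mult_right integrable_rel_square_poly)
  interpret prob_space "torus {..n}" by (rule prob_space_torus)
  have "(LINT \<theta>|torus {..n}. (1 + (\<Sum>j = 1..N. real (2 * j + 1) / real (j * (j + 1)) * legendre j (rel_square \<theta>)))) =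
      1 + (\<Sum>j = 1..N. real (2 * j + 1) / real (j * (j + 1)) *
        (\<Sum>k = 0..j. legendre_coeff j k * (a_coeff n k W / c_const n W ^ (2 * k))))"
    unfolding legendre_eq integral_rel_square_poly [symmetric]
    by (subst Bochner_Integration.integral_add)
       (auto simp only: Bochner_Integration.integral_sum int integral_mult_right_zero prob_space lebesgue_integral_const
         intro!: Bochner_Integration.integrable_sum int integrable_const, simp)
  then show ?thesis
    by (simp add: E2_def legendre_coeff_def algebra_simps)
qed

text \<open>Common to both expansions: -R is the truncated expansion of \<open>ln\<close>, and the
  error is half the mean of ln U + R(U). The factor 1/2 from ln|Z| = ln c + (ln U)/2 and the density
  constant c^2 g/2 give c^2 g/4.\<close>

lemma mahler_error_le:
  assumes g: "g \<ge> 0" and G_integral: "G_integral n W = ennreal g"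
    and [measurable]: "R \<in> borel_measurable borel"
    and int_R: "integrable (torus {..n}) (\<lambda>\<theta>. R (rel_square \<theta>))"
  shows "ennreal \<bar>log_mahler_measure (n + 1) (linear_form n W) -
      (ln (c_const n W) - 1 / 2 * (LINT \<theta>|torus {..n}. R (rel_square \<theta>)))\<bar> \<le>
    ennreal ((c_const n W)\<^sup>2 * g / 4) *
      (\<integral>\<^sup>+ u\<in>{0<..1}. ennreal \<bar>ln u + R u\<bar> * ennreal (u powr (- 1 / 4)) \<partial>lborel)"
proof -
  interpret prob_space "torus {..n}" by (rule prob_space_torus)
  let ?c = "c_const n W"
  note law = nn_integral_rotated_sum_le[OF c g G_integral, folded rel_square_def]
  \<comment> \<open>Since \<open>ln 0 = 0\<close>, the identity ln|Z| = ln c + (ln U)/2 can fail at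
    U = 0; the density bound makes this a null event.\<close>
  have rel_square_nonzero: "AE \<theta> in torus {..n}. rel_square \<theta> \<noteq> 0"
  proof -
    have "(\<integral>\<^sup>+ u\<in>{0<..1}. indicator {0} u * ennreal (u powr (- 1 / 4)) \<partial>lborel) = 0"
      by (rule nn_integral_zero') (auto split: split_indicator)
    then have "(\<integral>\<^sup>+ \<theta>. indicator {0} (rel_square \<theta>) \<partial>torus {..n}) = 0"
      using law[of "indicator {0}"] by simp
    then have "AE \<theta> in torus {..n}. indicator {0} (rel_square \<theta>) = (0 :: ennreal)"
      by (subst (asm) nn_integral_0_iff_AE) auto
    then show ?thesis by eventually_elim (auto simp: indicator_def split: if_splits)
  qed
  \<comment> \<open>The square of \<open>ln\<close> has integral 2 over {0..1}, so the weighted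
    bound with \<mu> = 1 gives a finite mean of |ln U|.\<close>
  have int_ln: "integrable (torus {..n}) (\<lambda>\<theta>. ln (rel_square \<theta>))"
  proof (rule integrableI_bounded)
    have "(\<integral>\<^sup>+ \<theta>. ennreal \<bar>ln (rel_square \<theta>)\<bar> \<partial>torus {..n}) \<le> ennreal (?c\<^sup>2 * g / 2) *
        (\<integral>\<^sup>+ u\<in>{0<..1}. ennreal \<bar>ln u\<bar> * ennreal (u powr (- 1 / 4)) \<partial>lborel)"
      by (rule law[of "\<lambda>u. ennreal \<bar>ln u\<bar>"]) measurable
    also have "\<dots> \<le> ennreal (?c\<^sup>2 * g / 2) * ennreal ((1 * 2 + 2 / 1) / 2)"
      by (intro mult_left_mono nn_integral_fourth_root_weight_le has_integral_ln_square) auto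
    also have "\<dots> < \<infinity>" by (simp add: ennreal_mult_less_top)
    finally show "(\<integral>\<^sup>+ \<theta>. ennreal (norm (ln (rel_square \<theta>))) \<partial>torus {..n}) < \<infinity>" by simp
  qed measurable
  have "log_mahler_measure (n + 1) (linear_form n W) = (LINT \<theta>|torus {..n}. ln ?c + 1 / 2 * ln (rel_square \<theta>))"
    unfolding log_mahler_measure_linear_form
  proof (rule integral_cong_AE)
    show "AE \<theta> in torus {..n}. ln (cmod (rotated_sum {..n} W \<theta>)) = ln ?c + 1 / 2 * ln (rel_square \<theta>)"
      using rel_square_nonzero
    proof eventually_elim
      case (elim \<theta>)
      then have "cmod (rotated_sum {..n} W \<theta>) > 0" by (auto simp: rel_square_def)
      then show ?case using c by (simp add: rel_square_def ln_realpow ln_div diff_divide_distrib)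
    qed
  qed measurable
  also have "\<dots> = ln ?c + 1 / 2 * (LINT \<theta>|torus {..n}. ln (rel_square \<theta>))"
    using int_ln by (simp add: prob_space)
  finally have "log_mahler_measure (n + 1) (linear_form n W) - (ln ?c - 1 / 2 * (LINT \<theta>|torus {..n}. R (rel_square \<theta>))) =
      1 / 2 * (LINT \<theta>|torus {..n}. ln (rel_square \<theta>) + R (rel_square \<theta>))"
    using int_ln int_R by simp
  then have "ennreal \<bar>log_mahler_measure (n + 1) (linear_form n W) - (ln ?c - 1 / 2 * (LINT \<theta>|torus {..n}. R (rel_square \<theta>)))\<bar> =
      ennreal (1 / 2) * ennreal \<bar>LINT \<theta>|torus {..n}. ln (rel_square \<theta>) + R (rel_square \<theta>)\<bar>"
    by (simp only: abs_mult ennreal_mult'' abs_ge_zero) simp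
  also have "\<dots> \<le> ennreal (1 / 2) * (\<integral>\<^sup>+ \<theta>. ennreal \<bar>ln (rel_square \<theta>) + R (rel_square \<theta>)\<bar> \<partial>torus {..n})"
    using integral_norm_bound_ennreal[OF Bochner_Integration.integrable_add[OF int_ln int_R]]
    by (intro mult_left_mono) simp_all
  also have "\<dots> \<le> ennreal (1 / 2) * (ennreal (?c\<^sup>2 * g / 2) *
      (\<integral>\<^sup>+ u\<in>{0<..1}. ennreal \<bar>ln u + R u\<bar> * ennreal (u powr (- 1 / 4)) \<partial>lborel))"
  proof (rule mult_left_mono)
    show "(\<integral>\<^sup>+ \<theta>. ennreal \<bar>ln (rel_square \<theta>) + R (rel_square \<theta>)\<bar> \<partial>torus {..n}) \<le> ennreal (?c\<^sup>2 * g / 2) *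
        (\<integral>\<^sup>+ u\<in>{0<..1}. ennreal \<bar>ln u + R u\<bar> * ennreal (u powr (- 1 / 4)) \<partial>lborel)"
      by (rule law[of "\<lambda>u. ennreal \<bar>ln u + R u\<bar>"]) measurable
  qed simp
  also have "\<dots> = ennreal (?c\<^sup>2 * g / 4) *
      (\<integral>\<^sup>+ u\<in>{0<..1}. ennreal \<bar>ln u + R u\<bar> * ennreal (u powr (- 1 / 4)) \<partial>lborel)"
  proof -
    have "ennreal (1 / 2) * ennreal (?c\<^sup>2 * g / 2) = ennreal (1 / 2 * (?c\<^sup>2 * g / 2))"
      using g by (intro ennreal_mult [symmetric]) auto
    then have "ennreal (1 / 2) * ennreal (?c\<^sup>2 * g / 2) = ennreal (?c\<^sup>2 * g / 4)" by simp
    then show ?thesis by (simp only: mult.assoc [symmetric])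
  qed
  finally show ?thesis .
qed

text \<open>The constant is c^2 g/4 times (4/3) Gamma(3/4), which is Gamma(3/4)/3 times c^2
  g.\<close>

lemma E1_error_le:
  assumes N: "N \<ge> 1" and g: "g \<ge> 0" and G_integral: "G_integral n W = ennreal g"
  shows "ennreal \<bar>log_mahler_measure (n + 1) (linear_form n W) - E1 N n W\<bar> \<le>
    ennreal (Gamma (3 / 4) / 3 * ((c_const n W)\<^sup>2 * g) / real N powr (3 / 4))"
proof -
  let ?R = "\<lambda>u. \<Sum>j = 1..N. 1 / real j * (1 - u) ^ j"
  have "integrable (torus {..n}) (\<lambda>\<theta>. ?R (rel_square \<theta>))"
    unfolding one_minus_power_eq
    by (intro Bochner_Integration.integrable_sum integrable_mult_right integrable_rel_square_poly)
  then have "ennreal \<bar>log_mahler_measure (n + 1) (linear_form n W) - E1 N n W\<bar> \<le>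
      ennreal ((c_const n W)\<^sup>2 * g / 4) *
        (\<integral>\<^sup>+ u\<in>{0<..1}. ennreal \<bar>ln u + ?R u\<bar> * ennreal (u powr (- 1 / 4)) \<partial>lborel)"
    unfolding E1_eq by (intro mahler_error_le g G_integral) auto
  also have "\<dots> \<le> ennreal ((c_const n W)\<^sup>2 * g / 4) * ennreal (4 / 3 * Gamma (3 / 4) * real N powr (- 3 / 4))"
    using nn_integral_ln_power_tail_le[OF N] unfolding ln_power_tail_def by (intro mult_left_mono) auto
  also have "\<dots> = ennreal ((c_const n W)\<^sup>2 * g / 4 * (4 / 3 * Gamma (3 / 4) * real N powr (- 3 / 4)))"
    using g by (intro ennreal_mult [symmetric] mult_nonneg_nonneg) (auto intro!: less_imp_le Gamma_real_pos)
  also have "(c_const n W)\<^sup>2 * g / 4 * (4 / 3 * Gamma (3 / 4) * real N powr (- 3 / 4)) =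
      Gamma (3 / 4) / 3 * ((c_const n W)\<^sup>2 * g) / real N powr (3 / 4)"
    by (simp add: powr_minus_divide)
  finally show ?thesis .
qed

lemma E2_error_le:
  assumes N: "N \<ge> 1" and g: "g \<ge> 0" and G_integral: "G_integral n W = ennreal g"
  shows "ennreal \<bar>log_mahler_measure (n + 1) (linear_form n W) - E2 N n W\<bar> \<le>
    ennreal (2 * root 4 2 * ((c_const n W)\<^sup>2 * g) / sqrt (real N))"
proof -
  let ?R = "\<lambda>u. 1 + (\<Sum>j = 1..N. real (2 * j + 1) / real (j * (j + 1)) * legendre j u)"
  \<comment> \<open>Also used as the weight \<mu>: as the squared norm of the tail is 1/M^2, it
    makes both terms of \<mu> I + 2/\<mu> of order 1/M.\<close>
  define M where "M = real N + 1"
  have M: "M > 0" by (simp add: M_def)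
  interpret prob_space "torus {..n}" by (rule prob_space_torus)
  have "integrable (torus {..n}) (\<lambda>\<theta>. ?R (rel_square \<theta>))"
    unfolding legendre_eq
    by (intro Bochner_Integration.integrable_add integrable_const Bochner_Integration.integrable_sum
          integrable_mult_right integrable_rel_square_poly)
  then have "ennreal \<bar>log_mahler_measure (n + 1) (linear_form n W) - E2 N n W\<bar> \<le>
      ennreal ((c_const n W)\<^sup>2 * g / 4) *
        (\<integral>\<^sup>+ u\<in>{0<..1}. ennreal \<bar>ln u + ?R u\<bar> * ennreal (u powr (- 1 / 4)) \<partial>lborel)"
    unfolding E2_eq by (intro mahler_error_le g G_integral) (auto simp: legendre_def)
  also have "\<dots> = ennreal ((c_const n W)\<^sup>2 * g / 4) *
        (\<integral>\<^sup>+ u\<in>{0<..1}. ennreal \<bar>ln_legendre_tail N u\<bar> * ennreal (u powr (- 1 / 4)) \<partial>lborel)"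
    by (simp add: ln_legendre_tail_def add.assoc)
  also have "\<dots> \<le> ennreal ((c_const n W)\<^sup>2 * g / 4) * ennreal ((M * (1 / M\<^sup>2) + 2 / M) / 2)"
    using has_integral_ln_legendre_tail_square[of N] M
    by (intro mult_left_mono nn_integral_fourth_root_weight_le) (auto simp: M_def)
  also have "\<dots> = ennreal ((c_const n W)\<^sup>2 * g / 4 * ((M * (1 / M\<^sup>2) + 2 / M) / 2))"
    using g M by (intro ennreal_mult [symmetric]) auto
  also have "\<dots> \<le> ennreal (2 * root 4 2 * ((c_const n W)\<^sup>2 * g) / sqrt (real N))"
  proof (rule ennreal_leI)
    have sN: "sqrt (real N) > 0" using N by simp
    have "sqrt (real N) * 1 \<le> sqrt (real N) * sqrt (real N)"
      using N by (intro mult_left_mono) auto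
    then have "sqrt (real N) \<le> M" by (simp add: M_def)
    \<comment> \<open>The estimate obtained is (3/8) c^2 g / (N + 1), of better order than the
      stated one; the rest is the comparison sqrt N <= N + 1 and 3/8 <= 2 root 4 2.\<close>
    have "(M * (1 / M\<^sup>2) + 2 / M) / 2 / 4 = 3 / 8 * (1 / M)"
      using M by (simp add: power2_eq_square)
    also have "\<dots> \<le> 2 * root 4 2 * (1 / sqrt (real N))"
    proof (intro mult_mono)
      show "3 / 8 \<le> 2 * root 4 2"
        using real_root_ge_1_iff[of 4 2] by linarith
      show "1 / M \<le> 1 / sqrt (real N)" using sN \<open>sqrt (real N) \<le> M\<close> by (intro frac_le) auto
    qed (use M in auto)
    finally have "((c_const n W)\<^sup>2 * g) * ((M * (1 / M\<^sup>2) + 2 / M) / 2 / 4) \<le> ((c_const n W)\<^sup>2 * g) * (2 * root 4 2 * (1 / sqrt (real N)))"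
      using g by (intro mult_left_mono) auto
    then show "(c_const n W)\<^sup>2 * g / 4 * ((M * (1 / M\<^sup>2) + 2 / M) / 2) \<le> 2 * root 4 2 * ((c_const n W)\<^sup>2 * g) / sqrt (real N)"
      by (simp add: mult_ac)
  qed
  finally show ?thesis .
qed

end

text \<open>Both bounds split on the value of \<open>G_integral\<close>: a real g leads to the error
  lemmas above, and an infinite value makes the right sides infinite. The first conjunct gives a
  condition under which the bounds have content.\<close>

theorem theorem3:
  fixes n :: nat and W :: "nat \<Rightarrow> complex"
  assumes "n \<ge> 3"
    and "\<exists>m\<le>n. W m \<noteq> 0"
  shows "(4 \<le> card {m. m \<le> n \<and> W m \<noteq> 0} \<longrightarrow> G_const n W < \<infinity>) \<and>
    (\<forall>N::nat. N \<ge> 1 \<longrightarrow>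
      ennreal \<bar>log_mahler_measure (n + 1) (linear_form n W) - E1 N n W\<bar>
        \<le> ennreal (Gamma (3 / 4) / 3) * G_const n W / ennreal (real N powr (3 / 4)) \<and>
      ennreal \<bar>log_mahler_measure (n + 1) (linear_form n W) - E2 N n W\<bar>
        \<le> ennreal (2 * root 4 2) * G_const n W / ennreal (sqrt (real N)))"
proof (intro conjI impI allI)
  have c: "c_const n W > 0" by (rule c_const_pos[OF assms(2)])
  show "G_const n W < \<infinity>" if "4 \<le> card {m. m \<le> n \<and> W m \<noteq> 0}"
    using G_integral_finite[OF that c] by (simp add: G_const_eq ennreal_mult_less_top)
  have Gamma_pos: "Gamma (3 / 4 :: real) > 0" by (rule Gamma_real_pos) simp
  have rhs: "ennreal a * G_const n W / ennreal b = ennreal (a * ((c_const n W)\<^sup>2 * g) / b)"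
    if "G_integral n W = ennreal g" "g \<ge> 0" "a > 0" "b > 0" for a b g
    using that by (simp add: G_const_eq divide_ennreal flip: ennreal_mult)
  \<comment> \<open>In [0, infinity] the product of 0 and infinity is 0, so positivity of c and of
    the constant is what keeps the right side infinite; the divisor is finite.\<close>
  have rhs_top: "ennreal a * G_const n W / ennreal b = \<infinity>"
    if "G_integral n W = \<infinity>" "a > 0" "b > 0" for a b
    using that c by (simp add: G_const_eq ennreal_mult_top ennreal_top_divide)
  fix N :: nat assume N: "N \<ge> 1"
  show "ennreal \<bar>log_mahler_measure (n + 1) (linear_form n W) - E1 N n W\<bar>
      \<le> ennreal (Gamma (3 / 4) / 3) * G_const n W / ennreal (real N powr (3 / 4))"
  proof (cases "G_integral n W")
    case (real g)
    show ?thesis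
      using E1_error_le[OF c N real] rhs[OF real(2,1), of "Gamma (3 / 4) / 3" "real N powr (3 / 4)"] Gamma_pos N by simp
  next
    case top
    then show ?thesis using rhs_top[of "Gamma (3 / 4) / 3" "real N powr (3 / 4)"] Gamma_pos N by simp
  qed
  show "ennreal \<bar>log_mahler_measure (n + 1) (linear_form n W) - E2 N n W\<bar>
      \<le> ennreal (2 * root 4 2) * G_const n W / ennreal (sqrt (real N))"
  proof (cases "G_integral n W")
    case (real g)
    show ?thesis
      using E2_error_le[OF c N real] rhs[OF real(2,1), of "2 * root 4 2" "sqrt (real N)"] N by simp
  next
    case top
    then show ?thesis using rhs_top[of "2 * root 4 2" "sqrt (real N)"] N by simp
  qed
qed

end
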